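(* There is a deterministic LOCAL algorithm solving $(\text{edge-degree}+1)$-edge coloring in $O(\log^{12/13} n)$ rounds on $n$-node trees, and in $O(a+\log^{12/13} n)$ rounds on $n$-node graphs of arboricity at most $a$, for any $a\le 2^{\log^{1/13} n}$ (with $a$ known to the nodes).
   Context: For an edge $e$ of a graph, $\mathrm{edge\text{-}degree}(e)$ is the number of edges sharing an endpoint with $e$. An $(\text{edge-degree}+1)$-edge coloring assigns to each edge $e$ a color in $\{1,\dots,\mathrm{edge\text{-}degree}(e)+1\}$ such that any two edges sharing an endpoint receive different colors. The arboricity of a graph is the minimum number of forests into which its edge set can be partitioned. LOCAL model: nodes have unique IDs from $\{1,\dots,n^c\}$, know $n$, have unbounded computation, and communicate with neighbors in synchronous rounds with unbounded messages; each edge's color must be output by its endpoints. *)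

theory Defs
  imports Complex_Main
begin

definition simple_graph :: "nat set \<Rightarrow> nat set set \<Rightarrow> bool" where
  "simple_graph V E \<longleftrightarrow> finite V \<and>
     (\<forall>e\<in>E. \<exists>u v. u \<noteq> v \<and> u \<in> V \<and> v \<in> V \<and> e = {u, v})"

definition is_cycle :: "nat set set \<Rightarrow> nat list \<Rightarrow> bool" where
  "is_cycle E vs \<longleftrightarrow> length vs \<ge> 3 \<and> distinct vs \<and>
     (\<forall>i < length vs. {vs ! i, vs ! ((i + 1) mod length vs)} \<in> E)"

definition forest :: "nat set \<Rightarrow> nat set set \<Rightarrow> bool" where
  "forest V E \<longleftrightarrow> simple_graph V E \<and> \<not> (\<exists>vs. is_cycle E vs)"

definition connected_graph :: "nat set \<Rightarrow> nat set set \<Rightarrow> bool" where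
  "connected_graph V E \<longleftrightarrow>
     (\<forall>u\<in>V. \<forall>v\<in>V. (\<lambda>x y. {x, y} \<in> E)\<^sup>*\<^sup>* u v)"

definition tree :: "nat set \<Rightarrow> nat set set \<Rightarrow> bool" where
  "tree V E \<longleftrightarrow> V \<noteq> {} \<and> forest V E \<and> connected_graph V E"

definition arboricity :: "nat set \<Rightarrow> nat set set \<Rightarrow> nat" where
  "arboricity V E = (LEAST k. \<exists>P :: nat set \<Rightarrow> nat.
       (\<forall>e\<in>E. P e < k) \<and> (\<forall>i<k. forest V {e\<in>E. P e = i}))"

definition edge_degree :: "nat set set \<Rightarrow> nat set \<Rightarrow> nat" where
  "edge_degree E e = card {e'\<in>E. e' \<noteq> e \<and> e' \<inter> e \<noteq> {}}"

definition edge_deg_plus1_coloring :: "nat set set \<Rightarrow> (nat set \<Rightarrow> nat) \<Rightarrow> bool" where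
  "edge_deg_plus1_coloring E col \<longleftrightarrow>
     (\<forall>e\<in>E. 1 \<le> col e \<and> col e \<le> edge_degree E e + 1) \<and>
     (\<forall>e\<in>E. \<forall>e'\<in>E. e \<noteq> e' \<and> e \<inter> e' \<noteq> {} \<longrightarrow> col e \<noteq> col e')"

text \<open>A deterministic LOCAL algorithm is given by
  \<^item> init: initial state of a node as a function of its ID (global knowledge such as n, a
    is passed by instantiating init with it),
  \<^item> send: the message a node sends (to all neighbours) in a round, computed from its state
    (messages are unbounded),
  \<^item> step: the new state, computed from the old state and the messages received, indexed by
    the ID of the sending neighbour,
  \<^item> out: after the last round, the color a node outputs for the edge to the neighbour with a
    given ID.
  States and messages are natural numbers (arbitrary finite information can be encoded);
  computation is unbounded since init/send/step/out are arbitrary functions.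
  ID maps vertices to IDs.\<close>

fun local_run :: "(nat \<Rightarrow> nat) \<Rightarrow> (nat \<Rightarrow> nat) \<Rightarrow> (nat \<Rightarrow> (nat \<Rightarrow> nat option) \<Rightarrow> nat)
     \<Rightarrow> nat set set \<Rightarrow> (nat \<Rightarrow> nat) \<Rightarrow> nat \<Rightarrow> nat \<Rightarrow> nat" where
  "local_run init send step E ID 0 v = init (ID v)"
| "local_run init send step E ID (Suc t) v =
     step (local_run init send step E ID t v)
       (\<lambda>i. if \<exists>u. {u, v} \<in> E \<and> ID u = i
            then Some (send (local_run init send step E ID t (SOME u. {u, v} \<in> E \<and> ID u = i)))
            else None)"

definition valid_ids :: "nat \<Rightarrow> nat set \<Rightarrow> (nat \<Rightarrow> nat) \<Rightarrow> bool" where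
  "valid_ids c V ID \<longleftrightarrow> inj_on ID V \<and> (\<forall>v\<in>V. 1 \<le> ID v \<and> ID v \<le> card V ^ c)"

definition solves_edge_coloring ::
  "(nat \<Rightarrow> nat) \<Rightarrow> (nat \<Rightarrow> nat) \<Rightarrow> (nat \<Rightarrow> (nat \<Rightarrow> nat option) \<Rightarrow> nat) \<Rightarrow> (nat \<Rightarrow> nat \<Rightarrow> nat)
     \<Rightarrow> nat \<Rightarrow> nat set set \<Rightarrow> (nat \<Rightarrow> nat) \<Rightarrow> bool" where
  "solves_edge_coloring init send step out T E ID \<longleftrightarrow>
     (\<exists>col. edge_deg_plus1_coloring E col \<and>
        (\<forall>u v. {u, v} \<in> E \<longrightarrow> out (local_run init send step E ID T u) (ID v) = col {u, v}))"

end

theory Submission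
  imports Defs "HOL-Library.FuncSet" "HOL-Library.Nat_Bijection"
begin

text \<open>Write \<open>q\<close> for \<open>log\<close> of \<open>n\<close> to the power \<open>1/13\<close>. Repeatedly removing the vertices that have degree at most
  \<open>k = 4 a 2^q\<close> and at most \<open>2 a\<close> neighbours of larger degree shrinks the graph by a factor \<open>2^q\<close>, so
  it empties within \<open>q^12 + 1\<close> steps. The edges split into a graph of maximum degree \<open>k\<close> and a graph
  with an orientation of out-degree at most \<open>2 a\<close>. The former is coloured in \<open>O(q^12)\<close> rounds; the
  latter is a union of \<open>2 a\<close> rooted forests, whose stars can be completed greedily, in
  \<open>O(a)\<close> rounds once the forests are coloured with constantly many colours.

  In the graph of degree \<open>k\<close> the degree of the uncoloured part is halved \<open>O(q)\<close> times. Each time the edges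
  are partitioned into \<open>O(q)\<close> bipartite classes in which every edge has a list four times as long as
  its degree. In such a class the colour space is halved repeatedly, every edge moving to one of
  the two halves so that the ratio of list length to degree drops only by a factor
  \<open>1 + O(1/q)\<close>. This splitting is a balanced placement of the edges at their ends, found in
  \<open>O(q^9)\<close> rounds by moving tokens along the edges.\<close>

text \<open>The exponent is a trade-off. Peeling at degree about \<open>2 ^ q\<close> takes
  \<open>log n / q\<close> steps, and the bounded-degree colouring takes the twelfth power of the
  logarithm of the degree; the two meet when \<open>q ^ 13 = log n\<close>. The twelfth power is
  made of \<open>O(q)\<close> degree halvings, \<open>O(q)\<close> bipartite classes,
  \<open>O(q)\<close> halvings of the colour space and \<open>q ^ 9\<close> for one split. The ninth
  power arises because each of \<open>p = O(q)\<close> levels may lose only a factor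
  \<open>1 + 1 / p\<close> while a half may hold as little as a \<open>1 / (2 * p)\<close> share of
  a list: the error of a split must be a \<open>1 / p ^ 2\<close> share of the degree. A token game
  of precision \<open>1 / K\<close> has \<open>p + 1\<close> phases of \<open>O(K ^ 4)\<close>
  rounds, with \<open>K = O(p ^ 2)\<close>. The game balances loads, not degrees. Bipartiteness
  bridges this: on one side the upper half consists of the edges whose token is present, on the
  other side of those whose token is absent, so degrees inside a half become differences of loads.
  Every labelling is a function of a whole graph. Its locality is proved by comparing two graphs
  that look alike near a node; the nodes then only gather edges and evaluate these functions on what
  they know.\<close>

definition inc :: "nat set set \<Rightarrow> nat \<Rightarrow> nat set set" where
  "inc H v = {e \<in> H. v \<in> e}"

definition adj :: "nat set set \<Rightarrow> nat set \<Rightarrow> nat set set" where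
  "adj H e = {f \<in> H. f \<noteq> e \<and> f \<inter> e \<noteq> {}}"

text \<open>The working measure of the degree of an edge. It differs from
  \<open>card (adj H e)\<close> by 2 but is a sum over the ends, so it can be controlled by
  balancing at each node.\<close>

definition esum :: "nat set set \<Rightarrow> nat set \<Rightarrow> nat" where
  "esum H e = (\<Sum>v\<in>e. card (inc H v))"

definition other :: "nat set \<Rightarrow> nat \<Rightarrow> nat" where
  "other e v = the_elem (e - {v})"

definition pairs :: "nat set set \<Rightarrow> bool" where
  "pairs H \<longleftrightarrow> finite H \<and> (\<forall>e\<in>H. card e = 2)"

lemma pairs_subset: "pairs H \<Longrightarrow> H' \<subseteq> H \<Longrightarrow> pairs H'"
  unfolding pairs_def using finite_subset by blast

lemma other_pair:
  assumes "card e = 2" "v \<in> e"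
  shows "e = {v, other e v}" "other e v \<noteq> v" "other e v \<in> e" "other e (other e v) = v"
proof -
  obtain a b where ab: "e = {a, b}" "a \<noteq> b" using assms(1) by (auto simp: card_2_iff)
  have "{a, b} - {a} = {b}" "{a, b} - {b} = {a}" using ab by auto
  then have o: "other e a = b" "other e b = a" unfolding other_def ab(1) by simp_all
  show "e = {v, other e v}" "other e v \<noteq> v" "other e v \<in> e" "other e (other e v) = v"
    using assms(2) ab o by auto
qed

lemma other_unique: "card e = 2 \<Longrightarrow> v \<in> e \<Longrightarrow> w \<in> e \<Longrightarrow> w \<noteq> v \<Longrightarrow> w = other e v"
  using other_pair(1) by blast

lemma esum_other:
  assumes "card e = 2" "v \<in> e"
  shows "esum H e = card (inc H v) + card (inc H (other e v))"
proof -
  have "esum H e = (\<Sum>w\<in>{v, other e v}. card (inc H w))"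
    unfolding esum_def using other_pair(1)[OF assms] by (rule sum.cong) simp
  then show ?thesis using other_pair(2)[OF assms] by simp
qed

lemma finite_inc: "finite H \<Longrightarrow> finite (inc H v)" by (simp add: inc_def)
lemma finite_adj: "finite H \<Longrightarrow> finite (adj H e)" by (simp add: adj_def)

lemma inc_mono: "H \<subseteq> H' \<Longrightarrow> inc H v \<subseteq> inc H' v" by (auto simp: inc_def)
lemma adj_mono: "H \<subseteq> H' \<Longrightarrow> adj H v \<subseteq> adj H' v" by (auto simp: adj_def)

lemma esum_mono: "H \<subseteq> H' \<Longrightarrow> finite H' \<Longrightarrow> esum H e \<le> esum H' e"
  unfolding esum_def by (intro sum_mono card_mono finite_inc inc_mono)

lemma card_adj:
  assumes "pairs H" "e \<in> H"
  shows "card (adj H e) + 2 = esum H e"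
proof -
  have c: "card e = 2" "finite H" using assms by (auto simp: pairs_def)
  obtain u v where uv: "e = {u, v}" "u \<noteq> v" using c(1) by (auto simp: card_2_iff)
  have only: "f = e" if "f \<in> inc H u" "f \<in> inc H v" for f
  proof -
    have f: "f \<in> H" "{u, v} \<subseteq> f" using that by (auto simp: inc_def)
    have c2: "card f = 2" using f(1) assms(1) by (auto simp: pairs_def)
    then have "finite f" using card.infinite by force
    then show ?thesis using card_subset_eq[of f "{u, v}"] f(2) c2 uv by simp
  qed
  have e: "e \<in> inc H u" "e \<in> inc H v" using uv(1) assms(2) by (simp_all add: inc_def)
  have i: "inc H u \<inter> inc H v = {e}" using only e by blast
  have a: "adj H e = (inc H u \<union> inc H v) - {e}"
    unfolding adj_def inc_def uv(1) by auto
  have "card (inc H u) + card (inc H v) = card (inc H u \<union> inc H v) + card (inc H u \<inter> inc H v)"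
    by (rule card_Un_Int) (simp_all add: c(2) finite_inc)
  moreover have "card (inc H u \<union> inc H v) = Suc (card (adj H e))"
    unfolding a by (rule card.remove) (use e c(2) in \<open>simp_all add: finite_inc\<close>)
  moreover have "esum H e = card (inc H u) + card (inc H v)" using uv by (simp add: esum_def)
  ultimately show ?thesis using i by simp
qed

lemma sum_card_swap:
  assumes "finite I" "finite R"
  shows "(\<Sum>r\<in>R. card {e \<in> I. Q r e}) = (\<Sum>e\<in>I. card {r \<in> R. Q r e})"
proof -
  have "(\<Sum>r\<in>R. card {e \<in> I. Q r e}) = (\<Sum>r\<in>R. \<Sum>e\<in>I. if Q r e then 1 else 0)"
    using assms by (intro sum.cong refl) (simp flip: sum.inter_filter)
  also have "\<dots> = (\<Sum>e\<in>I. \<Sum>r\<in>R. if Q r e then 1 else 0)" by (rule sum.swap)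
  also have "\<dots> = (\<Sum>e\<in>I. card {r \<in> R. Q r e})"
    using assms by (intro sum.cong refl) (simp flip: sum.inter_filter)
  finally show ?thesis .
qed

section \<open>Colour reduction by codes\<close>

text \<open>The code behind Linial's colour reduction: two words agree in fewer than
  \<open>t\<close> of the \<open>D * t\<close> places, so the agreements of one word with
  \<open>D\<close> others cannot cover all places.\<close>

definition separating :: "nat \<Rightarrow> nat \<Rightarrow> (nat \<Rightarrow> nat \<Rightarrow> nat) \<Rightarrow> bool" where
  "separating D t h \<longleftrightarrow> (\<forall>x<2 ^ t. \<forall>j<D * t. h x j \<le> 2 * (D * t)) \<and>
     (\<forall>x<2 ^ t. \<forall>y<2 ^ t. x \<noteq> y \<longrightarrow> card {j. j < D * t \<and> h x j = h y j} < t)"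

text \<open>Gilbert--Varshamov: by counting, some word is far from all earlier codewords.\<close>

lemma separating_exists:
  assumes "1 \<le> D" "1 \<le> t"
  shows "\<exists>h. separating D t h"
proof -
  define l where "l = D * t"
  define q where "q = 2 * l + 1"
  define W where "W = PiE {..<l} (\<lambda>_. {..<q})"
  have tl: "t \<le> l" "1 \<le> l" using assms by (simp_all add: l_def)
  have finW: "finite W" unfolding W_def by (intro finite_PiE) auto
  have cW: "card W = q ^ l" unfolding W_def by (simp add: card_PiE)
  have "\<exists>h. (\<forall>x<m. h x \<in> W) \<and> (\<forall>x<m. \<forall>y<m. x \<noteq> y \<longrightarrow> card {j. j < l \<and> h x j = h y j} < t)"
    if "m \<le> 2 ^ t" for m :: nat using that
  proof (induction m)
    case 0 then show ?case by simp
  next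
    case (Suc m)
    then obtain h where h: "\<forall>x<m. h x \<in> W"
      "\<forall>x<m. \<forall>y<m. x \<noteq> y \<longrightarrow> card {j. j < l \<and> h x j = h y j} < t"
      using Suc_leD by blast
    \<comment> \<open>A word too close to \<open>h x\<close> agrees with it on some set of exactly
      \<open>t\<close> places, so the bad words are covered by the sets
      \<open>B x J\<close>.\<close>
    define Js where "Js = {J. J \<subseteq> {..<l} \<and> card J = t}"
    define B where "B = (\<lambda>x J. {w \<in> W. \<forall>j\<in>J. w j = h x j})"
    have finJ: "finite Js" unfolding Js_def by simp
    have cJ: "card Js \<le> l ^ t"
      unfolding Js_def using n_subsets[of "{..<l}" t] binomial_le_pow[OF tl(1)] by simp
    have cB: "card (B x J) \<le> q ^ (l - t)" if "J \<in> Js" for x J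
    proof -
      have J: "J \<subseteq> {..<l}" "card J = t" using that by (auto simp: Js_def)
      have "card (B x J) \<le> card (PiE ({..<l} - J) (\<lambda>_. {..<q}))"
      proof (rule card_inj_on_le)
        show "inj_on (\<lambda>w. restrict w ({..<l} - J)) (B x J)"
        proof (rule inj_onI)
          fix w w' assume a: "w \<in> B x J" "w' \<in> B x J"
            and e: "restrict w ({..<l} - J) = restrict w' ({..<l} - J)"
          show "w = w'"
          proof
            fix j
            consider "j \<in> J" | "j \<in> {..<l} - J" | "j \<notin> {..<l}" by blast
            then show "w j = w' j"
            proof cases
              case 1 then show ?thesis using a by (simp add: B_def)
            next
              case 2 then show ?thesis using fun_cong[OF e, of j] by simp
            next
              case 3
              have "w \<in> W" "w' \<in> W" using a by (simp_all add: B_def)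
              then show ?thesis using PiE_arb[OF _ 3] unfolding W_def by metis
            qed
          qed
        qed
        show "(\<lambda>w. restrict w ({..<l} - J)) ` B x J \<subseteq> PiE ({..<l} - J) (\<lambda>_. {..<q})"
          unfolding B_def W_def by (rule image_subsetI) (auto simp: PiE_iff)
        show "finite (PiE ({..<l} - J) (\<lambda>_. {..<q}))" by (intro finite_PiE) auto
      qed
      also have "\<dots> = q ^ card ({..<l} - J)" by (simp add: card_PiE)
      also have "card ({..<l} - J) = l - t" using J by (simp add: card_Diff_subset finite_subset)
      finally show ?thesis .
    qed
    have "card (\<Union>x<m. \<Union>J\<in>Js. B x J) \<le> (\<Sum>x<m. card (\<Union>J\<in>Js. B x J))"
      by (rule card_UN_le) simp
    also have "\<dots> \<le> (\<Sum>x<m. \<Sum>J\<in>Js. card (B x J))"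
      by (intro sum_mono card_UN_le finJ)
    also have "\<dots> \<le> (\<Sum>x<m. \<Sum>J\<in>Js. q ^ (l - t))" by (intro sum_mono cB)
    also have "\<dots> = m * (card Js * q ^ (l - t))" by simp
    also have "\<dots> \<le> 2 ^ t * (l ^ t * q ^ (l - t))"
      using Suc.prems cJ by (intro mult_le_mono) auto
    also have "\<dots> = (2 * l) ^ t * q ^ (l - t)" by (simp add: power_mult_distrib)
    \<comment> \<open>Here the alphabet size \<open>q = 2 * l + 1\<close> is decided: the factor 2
      pays for the \<open>2 ^ t\<close> codewords and \<open>l\<close> for the choice of
      \<open>t\<close> places.\<close>
    also have "\<dots> < q ^ t * q ^ (l - t)"
      using assms(2) by (intro mult_strict_right_mono power_strict_mono) (auto simp: q_def)
    also have "\<dots> = card W" using tl by (simp add: cW flip: power_add)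
    finally have lt: "card (\<Union>x<m. \<Union>J\<in>Js. B x J) < card W" .
    have "\<not> W \<subseteq> (\<Union>x<m. \<Union>J\<in>Js. B x J)"
    proof
      assume "W \<subseteq> (\<Union>x<m. \<Union>J\<in>Js. B x J)"
      moreover have "finite (\<Union>x<m. \<Union>J\<in>Js. B x J)"
        using finW finJ unfolding B_def by (intro finite_UN_I) simp_all
      ultimately show False using lt card_mono leD by blast
    qed
    then obtain w where w: "w \<in> W" "\<forall>x<m. \<forall>J\<in>Js. w \<notin> B x J" by blast
    have ww: "card {j. j < l \<and> w j = h x j} < t" if "x < m" for x
    proof (rule ccontr)
      assume "\<not> ?thesis"
      then have "t \<le> card {j. j < l \<and> w j = h x j}" by simp
      then obtain J where "J \<subseteq> {j. j < l \<and> w j = h x j}" "card J = t"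
        by (rule obtain_subset_with_card_n)
      then have "J \<in> Js" "w \<in> B x J" using w(1) by (auto simp: Js_def B_def)
      then show False using w(2) that by blast
    qed
    have ww': "card {j. j < l \<and> h x j = w j} < t" if "x < m" for x
    proof -
      have "{j. j < l \<and> h x j = w j} = {j. j < l \<and> w j = h x j}" by auto
      then show ?thesis using ww[OF that] by simp
    qed
    show ?case
    proof (intro exI[of _ "h(m := w)"] conjI allI impI)
      fix x assume "x < Suc m"
      then show "(h(m := w)) x \<in> W" using h(1) w(1) by (cases "x = m") simp_all
    next
      fix x y assume "x < Suc m" "y < Suc m" "x \<noteq> y"
      then show "card {j. j < l \<and> (h(m := w)) x j = (h(m := w)) y j} < t"
        using h(2) ww ww' by (cases "x = m"; cases "y = m") simp_all
    qed
  qed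
  then obtain h :: "nat \<Rightarrow> nat \<Rightarrow> nat" where h: "\<forall>x<2^t. h x \<in> W"
      "\<forall>x<2^t. \<forall>y<2^t. x \<noteq> y \<longrightarrow> card {j. j < l \<and> h x j = h y j} < t" by blast
  have "separating D t h" unfolding separating_def l_def[symmetric]
  proof (intro conjI allI impI)
    fix x j :: nat assume "x < 2 ^ t" "j < l"
    then have "h x j \<in> {..<q}" using h(1) PiE_mem unfolding W_def by (metis lessThan_iff)
    then show "h x j \<le> 2 * l" unfolding q_def by simp
  qed (use h(2) in blast)
  then show ?thesis by blast
qed

definition hcode :: "nat \<Rightarrow> nat \<Rightarrow> nat \<Rightarrow> nat \<Rightarrow> nat" where
  "hcode D t = (SOME h. separating D t h)"

definition hpos :: "nat \<Rightarrow> nat \<Rightarrow> nat \<Rightarrow> nat set \<Rightarrow> nat" where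
  "hpos D t x Y = (SOME j. j < D * t \<and> (\<forall>y\<in>Y. hcode D t x j \<noteq> hcode D t y j))"

definition recolor :: "nat \<Rightarrow> nat \<Rightarrow> nat \<Rightarrow> nat set \<Rightarrow> nat" where
  "recolor D t x Y = hpos D t x Y * (2 * (D * t) + 1) + hcode D t x (hpos D t x Y)"

definition palette :: "nat \<Rightarrow> nat \<Rightarrow> nat" where
  "palette D t = D * t * (2 * (D * t) + 1)"

lemma separating_hcode: "1 \<le> D \<Longrightarrow> 1 \<le> t \<Longrightarrow> separating D t (hcode D t)"
  unfolding hcode_def using separating_exists by (rule someI_ex)

text \<open>Each member of \<open>Y\<close> spoils fewer than \<open>t\<close> of the
  \<open>D * t\<close> positions, so one position separates \<open>x\<close> from all of
  them.\<close>

lemma hpos: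
  assumes D: "1 \<le> D" "1 \<le> t" and x: "x < 2 ^ t" and Y: "Y \<subseteq> {..<2 ^ t}" "x \<notin> Y" "card Y \<le> D"
  shows "hpos D t x Y < D * t" "\<And>y. y \<in> Y \<Longrightarrow> hcode D t x (hpos D t x Y) \<noteq> hcode D t y (hpos D t x Y)"
proof -
  let ?B = "\<lambda>y. {j. j < D * t \<and> hcode D t x j = hcode D t y j}"
  have finY: "finite Y" using Y(1) finite_subset by blast
  have "\<exists>j. j < D * t \<and> (\<forall>y\<in>Y. hcode D t x j \<noteq> hcode D t y j)"
  proof (cases "Y = {}")
    \<comment> \<open>The strict estimate of the other case would read \<open>0 < 0\<close>
      here.\<close>
    case True then show ?thesis using D by (intro exI[of _ 0]) auto
  next
    case False
    have "card (\<Union>y\<in>Y. ?B y) \<le> (\<Sum>y\<in>Y. card (?B y))" by (rule card_UN_le[OF finY])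
    also have "\<dots> < (\<Sum>y\<in>Y. t)"
    proof (rule sum_strict_mono[OF finY False])
      fix y assume "y \<in> Y"
      then have "y < 2 ^ t" "x \<noteq> y" using Y by auto
      then show "card (?B y) < t" using separating_hcode[OF D] x by (auto simp: separating_def)
    qed
    also have "\<dots> \<le> D * t" using Y(3) by simp
    finally have "\<not> {..<D * t} \<subseteq> (\<Union>y\<in>Y. ?B y)"
      using card_mono[of "\<Union>y\<in>Y. ?B y" "{..<D * t}"] finY by auto
    then show ?thesis by blast
  qed
  from someI_ex[OF this] show "hpos D t x Y < D * t"
    "\<And>y. y \<in> Y \<Longrightarrow> hcode D t x (hpos D t x Y) \<noteq> hcode D t y (hpos D t x Y)"
    unfolding hpos_def by blast+
qed

lemma recolor_less:
  assumes D: "1 \<le> D" "1 \<le> t" and x: "x < 2 ^ t" and Y: "Y \<subseteq> {..<2 ^ t}" "x \<notin> Y" "card Y \<le> D"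
  shows "recolor D t x Y < palette D t"
proof -
  let ?j = "hpos D t x Y" and ?q = "2 * (D * t) + 1"
  have j: "?j < D * t" using hpos(1)[OF assms] .
  have "hcode D t x ?j < ?q" using separating_hcode[OF D] x j by (auto simp: separating_def less_Suc_eq_le)
  then have "recolor D t x Y < (?j + 1) * ?q" unfolding recolor_def by simp
  also have "\<dots> \<le> D * t * ?q" using j by (intro mult_le_mono) auto
  finally show ?thesis by (simp add: palette_def)
qed

text \<open>Equal new colours name the same position and the same symbol, but the position of
  \<open>x\<close> was chosen so that the codeword of \<open>y\<close> has another symbol there. It
  is enough that one of the two sees the other.\<close>

lemma recolor_neq:
  assumes D: "1 \<le> D" "1 \<le> t" and x: "x < 2 ^ t" and Y: "Y \<subseteq> {..<2 ^ t}" "x \<notin> Y" "card Y \<le> D"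
    and y: "y \<in> Y" and Z: "Z \<subseteq> {..<2 ^ t}" "y \<notin> Z" "card Z \<le> D"
  shows "recolor D t x Y \<noteq> recolor D t y Z"
proof
  let ?q = "2 * (D * t) + 1" and ?j = "hpos D t x Y" and ?k = "hpos D t y Z"
  assume eq: "recolor D t x Y = recolor D t y Z"
  have y2: "y < 2 ^ t" using y Y by auto
  have j: "?j < D * t" "?k < D * t" using hpos(1)[OF D x Y] hpos(1)[OF D y2 Z] .
  have h: "hcode D t x ?j < ?q" "hcode D t y ?k < ?q"
    using separating_hcode[OF D] x y2 j by (auto simp: separating_def less_Suc_eq_le)
  have aux: "a = (a * r + b) div r" if "b < r" for a b r :: nat
    using that by (metis add.commute add_0 div_less div_mult_self1 gr_implies_not0)
  have "?j = (?j * ?q + hcode D t x ?j) div ?q" "?k = (?k * ?q + hcode D t y ?k) div ?q"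
    using aux h by blast+
  then have jk: "?j = ?k" using eq unfolding recolor_def by metis
  then have "hcode D t x ?j = hcode D t y ?j" using eq unfolding recolor_def by simp
  then show False using hpos(2)[OF D x Y y] by simp
qed

section \<open>Greedy colouring along a key\<close>

text \<open>The argument \<open>s\<close> counts the key values already treated. Staging by key,
  instead of recursion along edges, makes locality an induction with one round per stage.\<close>

primrec gcs :: "nat set set \<Rightarrow> (nat set \<Rightarrow> nat set) \<Rightarrow> (nat set \<Rightarrow> nat) \<Rightarrow> nat \<Rightarrow> nat set \<Rightarrow> nat" where
  "gcs H L key 0 = (\<lambda>e. 0)"
| "gcs H L key (Suc s) = (\<lambda>e. if e \<in> H \<and> key e = s
     then LEAST c. c \<in> L e \<and> (\<forall>f\<in>adj H e. key f < s \<longrightarrow> gcs H L key s f \<noteq> c)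
     else gcs H L key s e)"

definition gcol :: "nat set set \<Rightarrow> (nat set \<Rightarrow> nat set) \<Rightarrow> (nat set \<Rightarrow> nat) \<Rightarrow> nat set \<Rightarrow> nat" where
  "gcol H L key e = gcs H L key (Suc (key e)) e"

lemma gcs_stable: "key e < s \<Longrightarrow> gcs H L key s e = gcol H L key e"
proof (induction s)
  case (Suc s)
  then show ?case by (cases "key e = s") (auto simp: gcol_def)
qed simp

lemma gcol_rec:
  assumes "e \<in> H"
  shows "gcol H L key e = (LEAST c. c \<in> L e \<and> (\<forall>f\<in>adj H e. key f < key e \<longrightarrow> gcol H L key f \<noteq> c))"
proof -
  have "gcol H L key e = (LEAST c. c \<in> L e \<and> (\<forall>f\<in>adj H e. key f < key e \<longrightarrow> gcs H L key (key e) f \<noteq> c))"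
    using assms by (simp add: gcol_def)
  also have "\<dots> = (LEAST c. c \<in> L e \<and> (\<forall>f\<in>adj H e. key f < key e \<longrightarrow> gcol H L key f \<noteq> c))"
    by (intro arg_cong[where f = Least] ext) (auto simp: gcs_stable)
  finally show ?thesis .
qed

lemma gcol_outside: "e \<notin> H \<Longrightarrow> gcol H L key e = 0"
proof -
  assume "e \<notin> H"
  then have "gcs H L key s e = 0" for s by (induction s) auto
  then show ?thesis unfolding gcol_def by blast
qed

text \<open>Only earlier neighbours with a common colour compete, and neighbours with equal keys are
  harmless if their lists are disjoint. This generality is for lists that lie in disjoint blocks of
  the colour space.\<close>

lemma gcol_proper:
  assumes fin: "finite H"
    and size: "\<And>e. e \<in> H \<Longrightarrow> card {f \<in> adj H e. key f < key e \<and> L f \<inter> L e \<noteq> {}} < card (L e)"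
    and same: "\<And>e f. e \<in> H \<Longrightarrow> f \<in> adj H e \<Longrightarrow> key f = key e \<Longrightarrow> L f \<inter> L e = {}"
  shows "e \<in> H \<Longrightarrow> gcol H L key e \<in> L e"
    and "e \<in> H \<Longrightarrow> f \<in> adj H e \<Longrightarrow> gcol H L key f \<noteq> gcol H L key e"
proof -
  have main: "gcol H L key e \<in> L e \<and> (\<forall>f\<in>adj H e. key f < key e \<longrightarrow> gcol H L key f \<noteq> gcol H L key e)"
    if "e \<in> H" for e using that
  proof (induction "key e" arbitrary: e rule: less_induct)
    case less
    let ?F = "{f \<in> adj H e. key f < key e \<and> L f \<inter> L e \<noteq> {}}"
    have finF: "finite ?F" using fin by (simp add: finite_adj)
    have "card (gcol H L key ` ?F) < card (L e)"
      using size[OF less.prems] card_image_le[OF finF, of "gcol H L key"] by linarith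
    then have "\<not> L e \<subseteq> gcol H L key ` ?F"
      using card_mono[of "gcol H L key ` ?F" "L e"] finF by auto
    then obtain c where c: "c \<in> L e" "c \<notin> gcol H L key ` ?F" by blast
    have "c \<in> L e \<and> (\<forall>f\<in>adj H e. key f < key e \<longrightarrow> gcol H L key f \<noteq> c)"
    proof (intro conjI ballI impI)
      fix f assume f: "f \<in> adj H e" "key f < key e"
      then have "gcol H L key f \<in> L f" using less.hyps by (auto simp: adj_def)
      then show "gcol H L key f \<noteq> c" using c f by blast
    qed (fact c(1))
    from LeastI[of "\<lambda>c. c \<in> L e \<and> (\<forall>f\<in>adj H e. key f < key e \<longrightarrow> gcol H L key f \<noteq> c)", OF this]
    show ?case using gcol_rec[OF less.prems, of L key] by simp
  qed
  show 1: "e \<in> H \<Longrightarrow> gcol H L key e \<in> L e" for e using main by blast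
  assume e: "e \<in> H" and f: "f \<in> adj H e"
  then have f': "f \<in> H" "e \<in> adj H f" by (auto simp: adj_def)
  consider "key f < key e" | "key e < key f" | "key f = key e" by linarith
  then show "gcol H L key f \<noteq> gcol H L key e"
  proof cases
    case 1 then show ?thesis using main e f by blast
  next
    case 2 then show ?thesis using main[OF f'(1)] f'(2) by metis
  next
    case 3 then show ?thesis using same[OF e f] 1[OF e] 1[OF f'(1)] by (metis disjoint_iff)
  qed
qed

section \<open>Balanced placement of edges by token dropping\<close>

text \<open>The choice by \<open>SOME\<close> depends on the set alone, so two graphs that agree
  around a node make the same choice there.\<close>

definition pick :: "nat \<Rightarrow> 'a set \<Rightarrow> 'a set" where
  "pick n S = (SOME P. P \<subseteq> S \<and> card P = min n (card S))"

lemma pick: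
  assumes "finite S"
  shows "pick n S \<subseteq> S" "card (pick n S) = min n (card S)" "pick n S \<noteq> S \<Longrightarrow> card (pick n S) = n"
proof -
  have "min n (card S) \<le> card S" by simp
  then obtain P where "P \<subseteq> S" "card P = min n (card S)"
    by (rule obtain_subset_with_card_n)
  then have "\<exists>P. P \<subseteq> S \<and> card P = min n (card S)" by blast
  from someI_ex[OF this] show *: "pick n S \<subseteq> S" "card (pick n S) = min n (card S)"
    unfolding pick_def by auto
  show "card (pick n S) = n" if "pick n S \<noteq> S"
  proof (rule ccontr)
    assume "card (pick n S) \<noteq> n"
    then have "card (pick n S) = card S" using *(2) by linarith
    then show False using card_subset_eq[OF assms *(1)] that by blast
  qed
qed

text \<open>\<open>sd\<close> names the sides of a bipartite graph, \<open>g e\<close> is the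
  surplus of load that the end of \<open>e\<close> on side \<open>sd\<close> should have over the
  other end, \<open>1 / K\<close> is the relative precision, and \<open>2 ^ p\<close> bounds the
  degrees.\<close>

locale game =
  fixes H :: "nat set set" and sd :: "nat \<Rightarrow> bool" and g :: "nat set \<Rightarrow> real" and K p :: nat
begin

text \<open>About a \<open>1 / K\<close> share of the degree: one round changes a load only a
  little, while a node that fills its quota in many rounds must use its edges many times.\<close>

definition quota :: "nat \<Rightarrow> nat" where
  "quota v = card (inc H v) div K + 1"

definition eta :: "nat set \<Rightarrow> nat \<Rightarrow> real" where
  "eta e v = (if sd v then g e else - g e)"

definition thr :: "nat set \<Rightarrow> real" where
  "thr e = real (esum H e) / real K"

definition mindeg :: "nat \<Rightarrow> nat" where
  "mindeg t = 2 ^ (p - t div (8 * K ^ 4))"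

definition rise :: "nat \<Rightarrow> real" where
  "rise t = real (mindeg t) / (4 * real K ^ 4)"

definition load :: "(nat set \<Rightarrow> nat) \<Rightarrow> nat \<Rightarrow> nat" where
  "load P v = card {e \<in> inc H v. P e = v}"

definition cong :: "nat \<Rightarrow> (nat set \<Rightarrow> nat) \<Rightarrow> (nat \<Rightarrow> real) \<Rightarrow> nat \<Rightarrow> bool" where
  "cong t P Y v \<longleftrightarrow> mindeg t \<le> card (inc H v) \<and> 2 * real (quota v) \<le> real (load P v) - Y v"

definition cand :: "nat \<Rightarrow> (nat set \<Rightarrow> nat) \<Rightarrow> (nat \<Rightarrow> real) \<Rightarrow> nat \<Rightarrow> nat set set" where
  "cand t P Y v = {e \<in> inc H v. P e = v \<and> \<not> cong t P Y (other e v) \<and>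
     eta e v + thr e \<le> Y v - Y (other e v)}"

definition offer :: "nat \<Rightarrow> (nat set \<Rightarrow> nat) \<Rightarrow> (nat \<Rightarrow> real) \<Rightarrow> nat \<Rightarrow> nat set set" where
  "offer t P Y v = (if cong t P Y v then pick (quota v) (cand t P Y v) else {})"

definition received :: "nat \<Rightarrow> (nat set \<Rightarrow> nat) \<Rightarrow> (nat \<Rightarrow> real) \<Rightarrow> nat \<Rightarrow> nat set set" where
  "received t P Y u = {e \<in> inc H u. P e \<noteq> u \<and> e \<in> offer t P Y (other e u)}"

definition accept :: "nat \<Rightarrow> (nat set \<Rightarrow> nat) \<Rightarrow> (nat \<Rightarrow> real) \<Rightarrow> nat \<Rightarrow> nat set set" where
  "accept t P Y u = (if mindeg t \<le> card (inc H u) then pick (quota u) (received t P Y u)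
     else received t P Y u)"

primrec st :: "nat \<Rightarrow> (nat set \<Rightarrow> nat) \<times> (nat \<Rightarrow> real)" where
  "st 0 = (\<lambda>e. SOME v. v \<in> e \<and> 0 \<le> eta e v, \<lambda>v. 0)"
| "st (Suc t) =
    (\<lambda>e. if e \<in> H \<and> e \<in> accept t (fst (st t)) (snd (st t)) (other e (fst (st t) e))
         then other e (fst (st t) e) else fst (st t) e,
     \<lambda>v. if cong t (fst (st t)) (snd (st t)) v then snd (st t) v + rise t else snd (st t) v)"

abbreviation "pos t \<equiv> fst (st t)"
abbreviation "lev t \<equiv> snd (st t)"
abbreviation "C t \<equiv> cong t (pos t) (lev t)"
abbreviation "Of t \<equiv> offer t (pos t) (lev t)"
abbreviation "Rc t \<equiv> received t (pos t) (lev t)"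
abbreviation "Ac t \<equiv> accept t (pos t) (lev t)"

definition rounds :: nat where "rounds = 8 * K ^ 4 * (p + 1)"

definition final :: "nat set \<Rightarrow> nat" where "final = pos rounds"

end

text \<open>Every edge carries a token placed at one of its ends. A node raises its level together with
  all other congested nodes, so along an edge the levels can only drift apart in the rounds in
  which an end is congested, the other is not, and the token still fails to move. Each such round
  uses up a whole quota of moves at one of the two ends, and the hysteresis \<open>thr\<close>
  bounds how often a single token can move. Nodes of smaller degree join later, when the increment
  \<open>rise\<close> is small compared with their degree; before that they accept every token.\<close>

locale game_ok = game +
  assumes pairsH: "pairs H" and K2: "2 \<le> K" and degp: "\<And>v. card (inc H v) \<le> 2 ^ p"
    and bip: "\<And>e v. e \<in> H \<Longrightarrow> v \<in> e \<Longrightarrow> sd (other e v) = (\<not> sd v)"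
begin

lemma finH: "finite H" using pairsH by (simp add: pairs_def)
lemma c2: "e \<in> H \<Longrightarrow> card e = 2" using pairsH by (simp add: pairs_def)
lemma c2i: "e \<in> inc H v \<Longrightarrow> card e = 2 \<and> e \<in> H \<and> v \<in> e" using c2 by (simp add: inc_def)

lemma eta_other: "e \<in> H \<Longrightarrow> v \<in> e \<Longrightarrow> eta e (other e v) = - eta e v"
  using bip by (simp add: eta_def)

lemma finite_sets: "finite (cand t P Y v)" "finite (received t P Y v)"
  using finite_inc[OF finH] by (simp_all add: cand_def received_def)

lemma offer_sub: "offer t P Y v \<subseteq> cand t P Y v"
  using pick(1)[OF finite_sets(1)] by (auto simp: offer_def)

lemma offer_card: "card (offer t P Y v) \<le> quota v"
  using pick(2)[OF finite_sets(1)] by (auto simp: offer_def)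

lemma accept_sub: "accept t P Y v \<subseteq> received t P Y v"
  using pick(1)[OF finite_sets(2)] by (auto simp: accept_def)

lemma acceptD: "e \<in> accept t P Y u \<Longrightarrow> e \<in> inc H u \<and> P e \<noteq> u \<and> e \<in> offer t P Y (other e u)"
  using subsetD[OF accept_sub, of e t P Y u] by (simp add: received_def)

lemma offerD: "e \<in> offer t P Y v \<Longrightarrow> e \<in> H \<and> v \<in> e \<and> P e = v \<and> cong t P Y v \<and>
    \<not> cong t P Y (other e v) \<and> eta e v + thr e \<le> Y v - Y (other e v)"
  using offer_sub[of t P Y v] by (auto simp: cand_def inc_def offer_def split: if_splits)

lemma deg_quota: "card (inc H v) \<le> K * quota v"
proof -
  have "card (inc H v) mod K < K" using K2 by simp
  moreover have "K * (card (inc H v) div K) + card (inc H v) mod K = card (inc H v)" by simp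
  ultimately show ?thesis unfolding quota_def distrib_left by linarith
qed

lemma quota_le: "real (quota v) \<le> real (card (inc H v)) / real K + 1"
  unfolding quota_def using of_nat_div_le_of_nat[of "card (inc H v)" K] by simp

lemma thr_nonneg: "0 \<le> thr e" by (simp add: thr_def)

lemma rise_nonneg: "0 \<le> rise t" by (simp add: rise_def)

text \<open>The values of \<open>eta\<close> at the two ends are opposite, so one of them is
  nonnegative. Placing the token there is what starts the induction of
  \<open>lev_gap\<close>.\<close>

lemma pos_0: assumes "e \<in> H" shows "pos 0 e \<in> e" "0 \<le> eta e (pos 0 e)"
proof -
  obtain v where v: "v \<in> e" using c2[OF assms] by fastforce
  have "\<exists>v. v \<in> e \<and> 0 \<le> eta e v"
  proof (cases "0 \<le> eta e v")
    case False
    then have "0 \<le> eta e (other e v)" using eta_other[OF assms v] by simp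
    then show ?thesis using other_pair(3)[OF c2[OF assms] v] by blast
  qed (use v in blast)
  from someI_ex[OF this] show "pos 0 e \<in> e" "0 \<le> eta e (pos 0 e)" by simp_all
qed

lemma pos_in: "e \<in> H \<Longrightarrow> pos t e \<in> e"
proof (induction t)
  case 0 then show ?case using pos_0 by blast
next
  case (Suc t)
  then show ?case using other_pair(3)[OF c2] by simp
qed

lemma flip_in_iff:
  assumes "e \<in> H" "u \<in> e"
  shows "pos t e \<noteq> u \<and> pos (Suc t) e = u \<longleftrightarrow> e \<in> Ac t u"
proof
  assume a: "pos t e \<noteq> u \<and> pos (Suc t) e = u"
  then have "other e (pos t e) = u" by (auto split: if_splits)
  then show "e \<in> Ac t u" using a by (auto split: if_splits)
next
  assume a: "e \<in> Ac t u"
  then have n: "pos t e \<noteq> u" using acceptD by blast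
  have "u = other e (pos t e)" by (rule other_unique) (use assms n c2 pos_in in auto)
  then show "pos t e \<noteq> u \<and> pos (Suc t) e = u" using a n assms by simp
qed

lemma flip_out:
  assumes "e \<in> H" "pos t e = v" "pos (Suc t) e \<noteq> v"
  shows "e \<in> Of t v" "pos (Suc t) e = other e v"
proof -
  have v: "v \<in> e" using pos_in assms by blast
  have "e \<in> Ac t (other e v)" using assms by (auto split: if_splits)
  then have "e \<in> Rc t (other e v)" using accept_sub by blast
  then show "e \<in> Of t v" using other_pair(4)[OF c2[OF assms(1)] v] by (simp add: received_def)
  show "pos (Suc t) e = other e v" using assms by (auto split: if_splits)
qed

text \<open>Offers are made only across edges whose other end is uncongested, so a congested node
  can only lose tokens in that round.\<close>

lemma cong_Ac: "C t u \<Longrightarrow> Ac t u = {}"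
proof (rule ccontr)
  assume c: "C t u" and "Ac t u \<noteq> {}"
  then obtain e where "e \<in> Rc t u" using accept_sub by blast
  then have e: "e \<in> inc H u" "e \<in> Of t (other e u)" by (auto simp: received_def)
  have "\<not> C t (other e (other e u))" using offerD[OF e(2)] by blast
  moreover have "other e (other e u) = u" using c2i[OF e(1)] other_pair(4) by blast
  ultimately show False using c by simp
qed

lemma load_noncong: assumes "\<not> C t v" shows "load (pos (Suc t)) v = load (pos t) v + card (Ac t v)"
proof -
  have "{e \<in> inc H v. pos (Suc t) e = v} = {e \<in> inc H v. pos t e = v} \<union> Ac t v" (is "?A = ?B \<union> _")
  proof (intro equalityI subsetI)
    fix e assume e: "e \<in> ?A"
    then show "e \<in> ?B \<union> Ac t v" using flip_in_iff[of e v t] c2i[of e v] by blast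
  next
    fix e assume "e \<in> ?B \<union> Ac t v"
    then consider "e \<in> ?B" | "e \<in> Ac t v" by blast
    then show "e \<in> ?A"
    proof cases
      case 1
      then have "e \<in> H" "pos t e = v" using c2i by blast+
      then show ?thesis using 1 flip_out(1)[of e t v] assms offerD by blast
    next
      case 2
      then have "e \<in> inc H v" using acceptD by blast
      then show ?thesis using 2 flip_in_iff[of e v t] c2i[of e v] by blast
    qed
  qed
  moreover have "?B \<inter> Ac t v = {}" using flip_in_iff c2i by blast
  moreover have "finite (Ac t v)" using finite_subset[OF accept_sub finite_sets(2)] .
  ultimately show ?thesis
    unfolding load_def using card_Un_disjoint[of ?B "Ac t v"] finite_inc[OF finH] by simp
qed

lemma load_cong: assumes "C t v"
  shows "load (pos (Suc t)) v \<le> load (pos t) v" "load (pos t) v \<le> load (pos (Suc t)) v + quota v"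
proof -
  let ?A = "{e \<in> inc H v. pos (Suc t) e = v}" and ?B = "{e \<in> inc H v. pos t e = v}"
  have fin: "finite ?A" "finite ?B" using finite_inc[OF finH] by simp_all
  have "?A \<subseteq> ?B" using flip_in_iff c2i cong_Ac[OF assms] by blast
  then show "load (pos (Suc t)) v \<le> load (pos t) v" unfolding load_def using fin card_mono by blast
  have f: "finite (Of t v)" using finite_subset[OF offer_sub finite_sets(1)] .
  have "?B \<subseteq> ?A \<union> Of t v" using flip_out(1) c2i by blast
  then have "card ?B \<le> card (?A \<union> Of t v)" using fin f by (intro card_mono) auto
  also have "\<dots> \<le> card ?A + card (Of t v)" by (rule card_Un_le)
  finally show "load (pos t) v \<le> load (pos (Suc t)) v + quota v"
    unfolding load_def using offer_card[of t "pos t" "lev t" v] by linarith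
qed

lemma accept_card: "mindeg t \<le> card (inc H v) \<Longrightarrow> card (Ac t v) \<le> quota v"
  using pick(2)[OF finite_sets(2)] by (simp add: accept_def)

lemma rise_le: "mindeg t \<le> card (inc H v) \<Longrightarrow> rise t \<le> real (card (inc H v)) / (4 * real K ^ 4)"
  unfolding rise_def by (intro divide_right_mono) auto

lemma rise_quota: assumes "mindeg t \<le> card (inc H v)" shows "rise t \<le> real (quota v)"
proof -
  have "real (card (inc H v)) \<le> real K * real (quota v)" using deg_quota[of v]
    by (metis of_nat_le_iff of_nat_mult)
  moreover have "real K * 1 \<le> 4 * real K ^ 4" 
  proof -
    have "real K ^ 1 \<le> real K ^ 4" using K2 by (intro power_increasing) auto
    then show ?thesis using zero_le_power[of "real K" 4] by (simp only: power_one_right mult_1_right)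
  qed
  then have "real K * real (quota v) \<le> 4 * real K ^ 4 * real (quota v)" by (intro mult_right_mono) auto
  ultimately have "real (card (inc H v)) / (4 * real K ^ 4) \<le> real (quota v)"
    using K2 by (simp add: pos_divide_le_eq mult.commute)
  then show ?thesis using rise_le[OF assms] by linarith
qed

lemma lev_mono: "lev t v \<le> lev (Suc t) v" using rise_nonneg by simp

text \<open>A level rises only while the load exceeds it by two quotas: one of them covers the
  tokens that leave in that round, the other covers \<open>rise\<close>.\<close>

lemma lev_bounds: "0 \<le> lev t v \<and> lev t v \<le> real (load (pos t) v)"
proof (induction t)
  case (Suc t)
  show ?case
  proof (cases "C t v")
    case True
    then have m: "mindeg t \<le> card (inc H v)" "2 * real (quota v) \<le> real (load (pos t) v) - lev t v"
      by (simp_all add: cong_def)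
    have "real (load (pos t) v) \<le> real (load (pos (Suc t)) v) + real (quota v)"
      using load_cong(2)[OF True] by linarith
    then have "lev t v + rise t \<le> real (load (pos (Suc t)) v)"
      using m(2) rise_quota[OF m(1)] by linarith
    moreover have "lev (Suc t) v = lev t v + rise t" using True by simp
    ultimately show ?thesis using Suc.IH rise_nonneg[of t] by linarith
  next
    case False
    then have "lev (Suc t) v = lev t v" by simp
    then show ?thesis using load_noncong[OF False] Suc.IH by linarith
  qed
qed simp

lemma lev_deg: "lev t v \<le> real (card (inc H v))"
proof -
  have "load (pos t) v \<le> card (inc H v)"
    unfolding load_def using finite_inc[OF finH] by (intro card_mono) auto
  then show ?thesis using lev_bounds[of t v] by linarith
qed

definition flips :: "nat \<Rightarrow> nat set \<Rightarrow> nat \<Rightarrow> nat" where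
  "flips t e v = card {r. r < t \<and> pos r e \<noteq> v \<and> pos (Suc r) e = v}"

lemma flips_Suc: "flips (Suc t) e v = flips t e v + (if pos t e \<noteq> v \<and> pos (Suc t) e = v then 1 else 0)"
proof -
  have "{r. r < Suc t \<and> pos r e \<noteq> v \<and> pos (Suc r) e = v} =
     (if pos t e \<noteq> v \<and> pos (Suc t) e = v then insert t {r. r < t \<and> pos r e \<noteq> v \<and> pos (Suc r) e = v}
      else {r. r < t \<and> pos r e \<noteq> v \<and> pos (Suc r) e = v})"
    by (auto simp del: st.simps simp: less_Suc_eq)
  then show ?thesis unfolding flips_def by (simp del: st.simps)
qed

text \<open>Leaving \<open>v\<close> and coming back pass the threshold with opposite signs of
  \<open>eta\<close>, so \<open>eta\<close> cancels and each return costs \<open>2 * thr e\<close>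
  of level. The two bounds, by the level of \<open>v\<close> and by that of the other end, feed each
  other: a move out turns the second into the first, a move in the first into the second.\<close>

lemma flips_inv:
  assumes e: "e \<in> H" and v: "v \<in> e"
  shows "2 * thr e * real (flips t e v) \<le> lev t v + (if pos t e = v then 2 * thr e else 0) \<and>
    (pos t e = v \<longrightarrow> 2 * thr e * real (flips t e v) \<le> lev t (other e v) + eta e v + thr e)"
proof (induction t)
  case 0
  then show ?case using thr_nonneg[of e] pos_0(2)[OF e] by (auto simp: flips_def)
next
  case (Suc t)
  let ?u = "other e v"
  note o = other_pair[OF c2[OF e] v]
  have mono: "lev t v \<le> lev (Suc t) v" "lev t ?u \<le> lev (Suc t) ?u" by (rule lev_mono)+
  show ?case
  proof (cases "pos t e = v")
    case at: True
    then have fl: "flips (Suc t) e v = flips t e v" by (simp add: flips_Suc del: st.simps)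
    show ?thesis
    proof (cases "pos (Suc t) e = v")
      case True
      then show ?thesis using Suc.IH at mono unfolding fl by (auto simp del: st.simps)
    next
      case False
      have "eta e v + thr e \<le> lev t v - lev t ?u" using offerD[OF flip_out(1)[OF e at False]] by blast
      then show ?thesis using Suc.IH at mono False unfolding fl by (auto simp del: st.simps)
    qed
  next
    case at: False
    then have at': "pos t e = ?u" using other_unique[OF c2[OF e] v pos_in[OF e]] by blast
    show ?thesis
    proof (cases "pos (Suc t) e = v")
      case True
      then have "pos (Suc t) e \<noteq> ?u" using o(2) by simp
      from offerD[OF flip_out(1)[OF e at' this]]
      have "eta e ?u + thr e \<le> lev t ?u - lev t v" using o(4) by simp
      moreover have "eta e ?u = - eta e v" using eta_other[OF e v] .
      moreover have fl: "flips (Suc t) e v = flips t e v + 1" using at True by (simp add: flips_Suc del: st.simps)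
      then have "2 * thr e * real (flips (Suc t) e v) = 2 * thr e * real (flips t e v) + 2 * thr e"
        by (simp add: algebra_simps)
      ultimately show ?thesis using Suc.IH at True mono by (auto simp del: st.simps)
    next
      case False
      then have "flips (Suc t) e v = flips t e v" by (simp add: flips_Suc del: st.simps)
      then show ?thesis using Suc.IH at False mono by (auto simp del: st.simps)
    qed
  qed
qed

text \<open>Levels never exceed a degree, and the degree of \<open>v\<close> is at most
  \<open>K * thr e\<close>; dividing by \<open>2 * thr e\<close> leaves \<open>K / 2 + 1\<close>
  moves.\<close>

lemma flips_le: assumes e: "e \<in> H" and v: "v \<in> e" shows "flips t e v \<le> K"
proof -
  have "e \<in> inc H v" using e v by (simp add: inc_def)
  then have "card (inc H v) \<noteq> 0" using finite_inc[OF finH] by auto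
  then have es: "0 < esum H e" "card (inc H v) \<le> esum H e" using esum_other[OF c2[OF e] v, of H] by auto
  have tp: "0 < thr e" using es K2 by (simp add: thr_def)
  have "real (card (inc H v)) \<le> real K * thr e" using es K2 by (simp add: thr_def)
  then have "2 * thr e * real (flips t e v) \<le> real K * thr e + 2 * thr e"
    using flips_inv[OF e v, of t] lev_deg[of t v] tp by (auto split: if_splits)
  then have "thr e * (2 * real (flips t e v)) \<le> thr e * (real K + 2)" by (simp add: algebra_simps)
  then have "2 * real (flips t e v) \<le> real K + 2" using tp by (simp only: mult_le_cancel_left_pos)
  then show ?thesis using K2 by linarith
qed

lemma sum_accept: "(\<Sum>r<t. card (Ac r u)) \<le> card (inc H u) * K"
proof -
  have "(\<Sum>r<t. card (Ac r u)) = (\<Sum>r<t. card {e \<in> inc H u. pos r e \<noteq> u \<and> pos (Suc r) e = u})"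
  proof (intro sum.cong refl arg_cong[where f = card] equalityI subsetI)
    fix r e assume e: "e \<in> Ac r u"
    then have "e \<in> inc H u" using acceptD by blast
    then show "e \<in> {e \<in> inc H u. pos r e \<noteq> u \<and> pos (Suc r) e = u}" using e flip_in_iff c2i by blast
  next
    fix r e assume "e \<in> {e \<in> inc H u. pos r e \<noteq> u \<and> pos (Suc r) e = u}"
    then show "e \<in> Ac r u" using flip_in_iff c2i by blast
  qed
  also have "\<dots> = (\<Sum>e\<in>inc H u. card {r \<in> {..<t}. pos r e \<noteq> u \<and> pos (Suc r) e = u})"
    by (rule sum_card_swap) (simp_all add: finite_inc finH)
  also have "\<dots> = (\<Sum>e\<in>inc H u. flips t e u)" by (simp add: flips_def del: st.simps)
  also have "\<dots> \<le> card (inc H u) * K"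
    using sum_bounded_above[of "inc H u" "\<lambda>e. flips t e u" K] flips_le c2i by auto
  finally show ?thesis .
qed

text \<open>\<open>K\<close> quotas amount to at least the degree, so a supply of \<open>b\<close>
  per edge fills at most \<open>K * b\<close> quotas.\<close>

lemma full_rounds:
  fixes f :: "nat \<Rightarrow> nat"
  assumes "(\<Sum>r<t. f r) \<le> card (inc H u) * b"
  shows "card {r. r < t \<and> quota u \<le> f r} \<le> K * b"
proof -
  let ?R = "{r. r < t \<and> quota u \<le> f r}"
  have "quota u * card ?R = (\<Sum>r\<in>?R. quota u)" by simp
  also have "\<dots> \<le> (\<Sum>r\<in>?R. f r)" by (intro sum_mono) auto
  also have "\<dots> \<le> (\<Sum>r<t. f r)" by (intro sum_mono2) auto
  also have "\<dots> \<le> (K * quota u) * b" using assms deg_quota[of u] mult_le_mono1 order_trans by blast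
  finally have "quota u * card ?R \<le> quota u * (K * b)" by (simp add: algebra_simps)
  moreover have "0 < quota u" by (simp add: quota_def)
  ultimately show ?thesis by (simp only: mult_le_cancel1)
qed

text \<open>By \<open>offered_accepted\<close>, these are the only rounds in which \<open>u\<close>
  may turn down an offered token.\<close>

definition rejecting :: "nat \<Rightarrow> nat \<Rightarrow> nat set" where
  "rejecting t u = {r. r < t \<and> quota u \<le> card (Ac r u)}"

text \<open>For a congested \<open>v\<close>, the only rounds in which it may withhold a
  candidate.\<close>

definition exhausted :: "nat \<Rightarrow> nat \<Rightarrow> nat set" where
  "exhausted t v = {r. r < t \<and> quota v \<le> card (Of r v)}"

lemma card_rejecting: "card (rejecting t u) \<le> K\<^sup>2"
  unfolding rejecting_def power2_eq_square by (rule full_rounds[OF sum_accept])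

lemma offered_accepted:
  assumes "e \<in> Of r v" shows "e \<in> Ac r (other e v) \<or> quota (other e v) \<le> card (Ac r (other e v))"
proof -
  let ?u = "other e v"
  have e: "e \<in> H" "v \<in> e" "pos r e = v" using offerD[OF assms] by auto
  note o = other_pair[OF c2[OF e(1)] e(2)]
  have rc: "e \<in> Rc r ?u" unfolding received_def inc_def using e o assms by simp
  show ?thesis
  proof (cases "Ac r ?u = Rc r ?u")
    case False
    then have "Ac r ?u = pick (quota ?u) (Rc r ?u)" by (auto simp: accept_def split: if_splits)
    then show ?thesis using pick(3)[OF finite_sets(2)] False by (metis order_refl)
  qed (use rc in simp)
qed

text \<open>An offer either moves the edge, which happens at most \<open>K\<close> times, or falls
  into one of at most \<open>K ^ 2\<close> rejecting rounds of the other end.\<close>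

lemma card_exhausted: "card (exhausted t v) \<le> K * (K + K\<^sup>2)"
  unfolding exhausted_def
proof (rule full_rounds)
  have "(\<Sum>r<t. card (Of r v)) = (\<Sum>r<t. card {e \<in> inc H v. e \<in> Of r v})"
  proof (intro sum.cong refl arg_cong[where f = card])
    fix r show "Of r v = {e \<in> inc H v. e \<in> Of r v}" using offerD by (auto simp: inc_def)
  qed
  also have "\<dots> = (\<Sum>e\<in>inc H v. card {r \<in> {..<t}. e \<in> Of r v})"
    by (rule sum_card_swap) (simp_all add: finite_inc finH)
  also have "\<dots> \<le> card (inc H v) * (K + K\<^sup>2)"
  proof -
    have "card {r \<in> {..<t}. e \<in> Of r v} \<le> K + K\<^sup>2" if "e \<in> inc H v" for e
    proof -
      let ?u = "other e v"
      have e: "e \<in> H" "v \<in> e" using that c2i by auto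
      note o = other_pair[OF c2[OF e(1)] e(2)]
      have "{r \<in> {..<t}. e \<in> Of r v} \<subseteq> {r. r < t \<and> pos r e \<noteq> ?u \<and> pos (Suc r) e = ?u} \<union> rejecting t ?u"
      proof
        fix r assume "r \<in> {r \<in> {..<t}. e \<in> Of r v}"
        then have r: "r < t" "e \<in> Of r v" by auto
        show "r \<in> {r. r < t \<and> pos r e \<noteq> ?u \<and> pos (Suc r) e = ?u} \<union> rejecting t ?u"
          using offered_accepted[OF r(2)] flip_in_iff[OF e(1) o(3), of r] r(1)
          unfolding rejecting_def by blast
      qed
      then have "card {r \<in> {..<t}. e \<in> Of r v} \<le>
          card ({r. r < t \<and> pos r e \<noteq> ?u \<and> pos (Suc r) e = ?u} \<union> rejecting t ?u)"
        by (intro card_mono) (auto simp: rejecting_def)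
      also have "\<dots> \<le> flips t e ?u + card (rejecting t ?u)"
        unfolding flips_def by (rule card_Un_le)
      also have "\<dots> \<le> K + K\<^sup>2" by (intro add_mono flips_le e(1) o(3) card_rejecting)
      finally show ?thesis .
    qed
    then have "(\<Sum>e\<in>inc H v. card {r \<in> {..<t}. e \<in> Of r v}) \<le> of_nat (card (inc H v)) * (K + K\<^sup>2)"
      by (rule sum_bounded_above)
    then show ?thesis by (simp only: of_nat_id)
  qed
  finally show "(\<Sum>r<t. card (Of r v)) \<le> card (inc H v) * (K + K\<^sup>2)" .
qed

text \<open>While the token rests at \<open>v\<close>, the gap widens only if \<open>v\<close> is
  congested and \<open>u\<close> is not. Past the threshold the token is then a candidate that
  failed to move, which makes the round exhausted for \<open>v\<close> or rejecting for
  \<open>u\<close>. The summand 1 pays for the single rise that may overshoot the threshold.\<close>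

lemma lev_gap:
  assumes e: "e \<in> H" and v: "v \<in> e" and u: "u = other e v"
  shows "pos t e = v \<Longrightarrow> lev t v - lev t u - eta e v \<le>
    thr e + real (card (inc H v)) / (4 * real K ^ 4) * (1 + real (card (rejecting t u \<union> exhausted t v)))"
proof (induction t)
  case 0
  have "0 \<le> eta e v" using pos_0(2)[OF e] 0 by simp
  moreover have "0 \<le> real (card (inc H v)) / (4 * real K ^ 4) * (1 + real (card (rejecting 0 u \<union> exhausted 0 v)))"
    by (intro mult_nonneg_nonneg) auto
  moreover have "lev 0 v = 0" "lev 0 u = 0" by simp_all
  ultimately show ?case using thr_nonneg[of e] by linarith
next
  case (Suc t)
  note o = other_pair[OF c2[OF e] v]
  let ?B = "\<lambda>t. rejecting t u \<union> exhausted t v"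
  let ?c = "real (card (inc H v)) / (4 * real K ^ 4)"
  have fin: "finite (?B t)" for t by (simp add: rejecting_def exhausted_def)
  have c0: "0 \<le> ?c" by simp
  have sub: "?B t \<subseteq> ?B (Suc t)" by (auto simp: rejecting_def exhausted_def)
  have mono: "lev t v \<le> lev (Suc t) v" "lev t u \<le> lev (Suc t) u" by (rule lev_mono)+
  have cm: "card (?B t) \<le> card (?B (Suc t))" using card_mono[OF fin sub] .
  then have cm': "?c * (1 + real (card (?B t))) \<le> ?c * (1 + real (card (?B (Suc t))))"
    by (intro mult_left_mono c0) simp
  have c1: "?c \<le> ?c * (1 + real (card (?B (Suc t))))" using c0 by (simp add: mult_le_cancel_left1 algebra_simps)
  show ?case
  proof (cases "pos t e = v")
    case False
    \<comment> \<open>The token has just arrived: its move required \<open>u\<close> to be above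
      \<open>v\<close> by \<open>thr e - eta e v\<close>, so the gap restarts at most at
      \<open>- thr e\<close>.\<close>
    then have at: "pos t e = u" using other_unique[OF c2[OF e] v pos_in[OF e]] u by blast
    have "pos (Suc t) e \<noteq> u" using Suc.prems o(2) u by metis
    note od = offerD[OF flip_out(1)[OF e at this]]
    have ou: "other e u = v" using o(4) u by simp
    have "\<not> C t v" using od ou by simp
    then have "lev (Suc t) v = lev t v" by simp
    moreover have "eta e u + thr e \<le> lev t u - lev t v" using od ou by simp
    moreover have "eta e u = - eta e v" using eta_other[OF e v] u by simp
    ultimately have "lev (Suc t) v - lev (Suc t) u - eta e v \<le> - thr e" using mono by linarith
    then show ?thesis using thr_nonneg[of e] c0 c1 by linarith
  next
    case at: True
    note IH = Suc.IH[OF at]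
    consider "\<not> C t v" | "C t v" "C t u" | "C t v" "\<not> C t u" by blast
    then show ?thesis
    proof cases
      case 1
      then have "lev (Suc t) v = lev t v" by simp
      then show ?thesis using IH mono cm' by linarith
    next
      case 2
      then have "lev (Suc t) v = lev t v + rise t" "lev (Suc t) u = lev t u + rise t" by simp_all
      then show ?thesis using IH cm' by linarith
    next
      case 3
      then have l: "lev (Suc t) v = lev t v + rise t" "lev (Suc t) u = lev t u" by simp_all
      have r: "rise t \<le> ?c" using 3(1) rise_le by (simp add: cong_def)
      show ?thesis
      proof (cases "eta e v + thr e \<le> lev t v - lev t u")
        case False
        then show ?thesis using l r c1 by linarith
      next
        case True
        have cd: "e \<in> cand t (pos t) (lev t) v"
          unfolding cand_def inc_def using e v at 3(2) True u by simp
        have tB: "t \<in> ?B (Suc t)"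
        proof (cases "e \<in> Of t v")
          case True
          have "e \<notin> Ac t u"
          proof
            assume "e \<in> Ac t u"
            then have "pos (Suc t) e = u" using flip_in_iff[OF e, of u t] o(3) u by blast
            then show False using Suc.prems o(2) u by metis
          qed
          then show ?thesis using offered_accepted[OF True] u by (auto simp: rejecting_def)
        next
          case False
          then have "Of t v \<noteq> cand t (pos t) (lev t) v" using cd by blast
          moreover have "Of t v = pick (quota v) (cand t (pos t) (lev t) v)" using 3(1) by (simp add: offer_def)
          ultimately have "card (Of t v) = quota v" using pick(3)[OF finite_sets(1)] by metis
          then show ?thesis by (simp add: exhausted_def)
        qed
        moreover have "t \<notin> ?B t" by (simp add: rejecting_def exhausted_def)
        ultimately have "?B t \<subset> ?B (Suc t)" using sub by blast
        then have "Suc (card (?B t)) \<le> card (?B (Suc t))" using psubset_card_mono[OF fin] by (simp add: Suc_le_eq)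
        then have "1 + (1 + real (card (?B t))) \<le> 1 + real (card (?B (Suc t)))" by linarith
        then have "?c * (1 + (1 + real (card (?B t)))) \<le> ?c * (1 + real (card (?B (Suc t))))"
          by (intro mult_left_mono c0)
        moreover have "?c * (1 + (1 + real (card (?B t)))) = ?c + ?c * (1 + real (card (?B t)))"
          by (simp only: distrib_left mult_1_right)
        ultimately show ?thesis using IH l r by linarith
      qed
    qed
  qed
qed

lemma excess_step:
  assumes "mindeg t \<le> card (inc H v)"
  shows "C t v \<Longrightarrow> real (load (pos (Suc t)) v) - lev (Suc t) v \<le> real (load (pos t) v) - lev t v"
    and "\<not> C t v \<Longrightarrow> real (load (pos (Suc t)) v) - lev (Suc t) v \<le> 3 * real (quota v)"
proof -
  assume c: "C t v"
  have "real (load (pos (Suc t)) v) \<le> real (load (pos t) v)" using load_cong(1)[OF c] by (rule of_nat_mono)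
  then show "real (load (pos (Suc t)) v) - lev (Suc t) v \<le> real (load (pos t) v) - lev t v"
    using lev_mono[of t v] by linarith
next
  assume c: "\<not> C t v"
  then have "real (load (pos t) v) - lev t v \<le> 2 * real (quota v)" using assms by (simp add: cong_def)
  moreover have "lev (Suc t) v = lev t v" using c by simp
  moreover have "real (load (pos (Suc t)) v) \<le> real (load (pos t) v) + real (quota v)"
    using load_noncong[OF c] accept_card[OF assms] by linarith
  ultimately show "real (load (pos (Suc t)) v) - lev (Suc t) v \<le> 3 * real (quota v)" by linarith
qed

text \<open>In the first phase that admits \<open>v\<close>, either the excess falls to three quotas
  in some round and stays there, or the level rises in all \<open>8 * K ^ 4\<close> rounds and
  overtakes the degree, hence the load.\<close>

lemma final_excess:
  assumes "1 \<le> card (inc H v)"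
  shows "real (load final v) - lev rounds v \<le> 3 * real (quota v)"
proof -
  let ?M = "8 * K ^ 4"
  have M: "0 < ?M" using K2 by simp
  let ?ex = "\<lambda>t. real (load (pos t) v) - lev t v"
  define j where "j = (LEAST j. 2 ^ (p - j) \<le> card (inc H v))"
  have "2 ^ (p - p) \<le> card (inc H v)" using assms by simp
  then have j: "2 ^ (p - j) \<le> card (inc H v)" "j \<le> p"
    unfolding j_def by (rule LeastI, rule Least_le)
  \<comment> \<open>The previous phase did not admit \<open>v\<close>, so its degree is below twice
    the current threshold; if there is no previous phase, the bound \<open>2 ^ p\<close> on degrees
    takes over.\<close>
  have dj: "card (inc H v) \<le> 2 * 2 ^ (p - j)"
  proof (cases j)
    case 0
    have "card (inc H v) \<le> 2 ^ p" by (rule degp)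
    then show ?thesis using 0 by simp
  next
    case (Suc i)
    have "\<not> 2 ^ (p - i) \<le> card (inc H v)" using not_less_Least[of i "\<lambda>j. 2 ^ (p - j) \<le> card (inc H v)"] Suc
      unfolding j_def by simp
    moreover have "p - i = Suc (p - j)" using Suc j(2) by simp
    ultimately show ?thesis by simp
  qed
  have md: "mindeg t \<le> card (inc H v)" if "?M * j \<le> t" for t
  proof -
    have "j \<le> t div ?M" using that M by (metis div_le_mono nonzero_mult_div_cancel_left less_not_refl2)
    then have "(2::nat) ^ (p - t div ?M) \<le> 2 ^ (p - j)" by (intro power_increasing) auto
    then show ?thesis using j(1) unfolding mindeg_def by linarith
  qed
  let ?r = "2 ^ (p - j) / (4 * real K ^ 4)"
  have first: "i \<le> ?M \<Longrightarrow> ?ex (?M * j + i) \<le> 3 * real (quota v) \<or> real i * ?r \<le> lev (?M * j + i) v" for i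
  proof (induction i)
    case 0
    then show ?case using lev_bounds[of "?M * j" v] by simp
  next
    case (Suc i)
    let ?t = "?M * j + i"
    have "?t div ?M = j" using Suc.prems M by (simp add: div_mult_self4[where b = ?M] del: div_mult_self2)
    then have rt: "rise ?t = ?r" unfolding rise_def mindeg_def by simp
    have m: "mindeg ?t \<le> card (inc H v)" by (rule md) simp
    have ih: "?ex ?t \<le> 3 * real (quota v) \<or> real i * ?r \<le> lev ?t v" using Suc by simp
    show ?case
    proof (cases "C ?t v")
      case True
      have "lev (Suc ?t) v = lev ?t v + ?r" using True rt by simp
      moreover have "real (Suc i) * ?r = real i * ?r + ?r" by (simp only: of_nat_Suc distrib_right mult_1_left add.commute)
      ultimately show ?thesis using ih excess_step(1)[OF m True] by (auto simp del: st.simps)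
    next
      case False
      then show ?thesis using excess_step(2)[OF m False] by (simp del: st.simps)
    qed
  qed
  have base: "?ex (?M * j + ?M) \<le> 3 * real (quota v)"
  proof -
    have "real ?M * ?r = 2 * 2 ^ (p - j)" using K2 by (simp add: field_simps)
    moreover have "real (card (inc H v)) \<le> real (2 * 2 ^ (p - j))" using dj by (rule of_nat_mono)
    moreover have "real (load (pos t) v) \<le> real (card (inc H v))" for t
      unfolding load_def using finite_inc[OF finH] by (intro of_nat_mono card_mono) auto
    ultimately have "real (load (pos (?M * j + ?M)) v) \<le> real ?M * ?r"
      using order_trans by (metis of_nat_mult of_nat_numeral of_nat_power)
    moreover have "0 \<le> 3 * real (quota v)" by simp
    ultimately show ?thesis using first[of ?M] by linarith
  qed
  have "?ex (?M * j + ?M + i) \<le> 3 * real (quota v)" for i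
  proof (induction i)
    case (Suc i)
    let ?t = "?M * j + ?M + i"
    have m: "mindeg ?t \<le> card (inc H v)" by (rule md) simp
    have "?ex (Suc ?t) \<le> 3 * real (quota v)"
      using excess_step[OF m] Suc.IH by (cases "C ?t v") (auto simp del: st.simps)
    then show ?case by (simp only: add_Suc_right)
  qed (use base in simp)
  note later = this
  have "rounds = ?M * j + ?M + ?M * (p - j)" unfolding rounds_def using j(2)
    by (simp add: algebra_simps flip: add_mult_distrib2)
  then show ?thesis unfolding final_def using later[of "?M * (p - j)"] by simp
qed

text \<open>The load of \<open>v\<close> is within three quotas of its level, the load of
  \<open>u\<close> is at least its level, and \<open>lev_gap\<close> compares the levels. The 5
  consists of 3 for the quotas, 1 for \<open>thr\<close> and 1 for the drift; the final 3 is the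
  rounding in the quotas.\<close>

theorem balanced:
  assumes e: "e \<in> H" and v: "final e = v" and u: "u = other e v"
  shows "real (load final v) - real (load final u) \<le> eta e v + 5 * real (esum H e) / real K + 3"
proof -
  let ?d = "real (card (inc H v))" and ?B = "rejecting rounds u \<union> exhausted rounds v"
  have ve: "v \<in> e" using pos_in[OF e] v final_def by metis
  have "e \<in> inc H v" using e ve by (simp add: inc_def)
  then have d1: "1 \<le> card (inc H v)" using finite_inc[OF finH, of v] by (metis One_nat_def Suc_leI card_gt_0_iff empty_iff)
  have K0: "0 < real K" using K2 by simp
  have "card ?B \<le> K\<^sup>2 + K * (K + K\<^sup>2)"
    using card_Un_le[of "rejecting rounds u"] card_rejecting card_exhausted by (meson add_mono order_trans)
  \<comment> \<open>There are at most \<open>K ^ 3 + 2 * K ^ 2\<close> bad rounds. The divisor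
    \<open>4 * K ^ 4\<close> in \<open>rise\<close> is chosen so that their total drift is a
    \<open>1 / K\<close> share of the degree.\<close>
  then have "1 + card ?B \<le> 4 * K ^ 3"
  proof -
    assume a: "card ?B \<le> K\<^sup>2 + K * (K + K\<^sup>2)"
    have "2 * K\<^sup>2 \<le> K * K\<^sup>2" using K2 by (rule mult_le_mono1)
    moreover have "K * K\<^sup>2 = K ^ 3" by (simp add: power2_eq_square power3_eq_cube)
    moreover have "1 \<le> K ^ 3" using K2 by simp
    moreover have "K * (K + K\<^sup>2) = K\<^sup>2 + K * K\<^sup>2" by (simp add: power2_eq_square algebra_simps)
    ultimately show ?thesis using a by linarith
  qed
  then have "1 + real (card ?B) \<le> 4 * real K ^ 3" using of_nat_mono[of "1 + card ?B" "4 * K ^ 3"] by simp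
  then have "?d / (4 * real K ^ 4) * (1 + real (card ?B)) \<le> ?d / (4 * real K ^ 4) * (4 * real K ^ 3)"
    by (intro mult_left_mono) auto
  also have "\<dots> = ?d / real K" using K0 by (simp add: field_simps power4_eq_xxxx power3_eq_cube)
  finally have 1: "?d / (4 * real K ^ 4) * (1 + real (card ?B)) \<le> ?d / real K" .
  have 2: "lev rounds v - lev rounds u - eta e v \<le> thr e + ?d / (4 * real K ^ 4) * (1 + real (card ?B))"
    using lev_gap[OF e ve u, of rounds] v by (simp add: final_def)
  have 3: "real (load final v) - lev rounds v \<le> 3 * (?d / real K + 1)"
    using final_excess[OF d1] quota_le[of v] by (simp add: algebra_simps)
  have 4: "lev rounds u \<le> real (load final u)" using lev_bounds unfolding final_def by blast
  have "card (inc H v) \<le> esum H e" using esum_other[OF c2[OF e] ve, of H] by simp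
  then have "?d / real K \<le> real (esum H e) / real K" by (intro divide_right_mono) auto
  then show ?thesis using 1 2 3 4 unfolding thr_def by (simp add: algebra_simps)
qed

end

section \<open>Locality\<close>

text \<open>Two graphs that look the same from the nodes in \<open>A t\<close> up to distance \<open>t\<close>: a
  labelling computed in \<open>t\<close> rounds takes the same values in both of them at these nodes.\<close>

locale agreement =
  fixes E E' :: "nat set set" and A :: "nat \<Rightarrow> nat set"
  assumes finE: "finite E" "finite E'"
    and E2: "\<And>e. e \<in> E \<Longrightarrow> card e = 2"
    and A_anti: "\<And>t. A (Suc t) \<subseteq> A t"
    and A_inc: "\<And>t v. v \<in> A (Suc t) \<Longrightarrow> inc E v = inc E' v"
    and A_nb: "\<And>t v e u. v \<in> A (Suc t) \<Longrightarrow> e \<in> inc E v \<Longrightarrow> u \<in> e \<Longrightarrow> u \<in> A t"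
begin

text \<open>The index counts rounds: nodes in \<open>A t\<close> have the same view in both graphs.
  It starts at 1 because membership in \<open>A 0\<close> says nothing about incident edges.\<close>

definition hsim :: "nat \<Rightarrow> nat set set \<Rightarrow> nat set set \<Rightarrow> bool" where
  "hsim t H H' \<longleftrightarrow> 1 \<le> t \<and> H \<subseteq> E \<and> H' \<subseteq> E' \<and> (\<forall>v\<in>A t. inc H v = inc H' v)"

definition nsim :: "nat \<Rightarrow> (nat \<Rightarrow> 'a) \<Rightarrow> (nat \<Rightarrow> 'a) \<Rightarrow> bool" where
  "nsim t f f' \<longleftrightarrow> (\<forall>v\<in>A t. f v = f' v)"

definition esim :: "nat \<Rightarrow> (nat set \<Rightarrow> 'a) \<Rightarrow> (nat set \<Rightarrow> 'a) \<Rightarrow> bool" where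
  "esim t x x' \<longleftrightarrow> (\<forall>v\<in>A t. \<forall>e\<in>inc E v. x e = x' e)"

lemma A_le: "t \<le> t' \<Longrightarrow> A t' \<subseteq> A t"
  using lift_Suc_antimono_le[of A] A_anti by blast

lemma A_leD: "v \<in> A t' \<Longrightarrow> t \<le> t' \<Longrightarrow> v \<in> A t" using A_le by blast

lemma hsim_le: "hsim t H H' \<Longrightarrow> t \<le> t' \<Longrightarrow> hsim t' H H'"
  unfolding hsim_def using A_leD by (meson order_trans)
lemma nsim_le: "nsim t f f' \<Longrightarrow> t \<le> t' \<Longrightarrow> nsim t' f f'"
  unfolding nsim_def using A_leD by blast
lemma esim_le: "esim t x x' \<Longrightarrow> t \<le> t' \<Longrightarrow> esim t' x x'"
  unfolding esim_def using A_leD by blast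

lemma esimI: "(\<And>v e. v \<in> A t \<Longrightarrow> e \<in> E \<Longrightarrow> v \<in> e \<Longrightarrow> x e = x' e) \<Longrightarrow> esim t x x'"
  by (auto simp: esim_def inc_def)
lemma esimD: "esim t x x' \<Longrightarrow> v \<in> A t \<Longrightarrow> e \<in> E \<Longrightarrow> v \<in> e \<Longrightarrow> x e = x' e"
  by (auto simp: esim_def inc_def)
lemma nsimI: "(\<And>v. v \<in> A t \<Longrightarrow> f v = f' v) \<Longrightarrow> nsim t f f'" by (auto simp: nsim_def)
lemma nsimD: "nsim t f f' \<Longrightarrow> v \<in> A t \<Longrightarrow> f v = f' v" by (auto simp: nsim_def)

lemma nb: "v \<in> A (Suc t) \<Longrightarrow> e \<in> E \<Longrightarrow> v \<in> e \<Longrightarrow> u \<in> e \<Longrightarrow> u \<in> A t"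
  using A_nb by (simp add: inc_def)

lemma hsim_mem: "hsim t H H' \<Longrightarrow> v \<in> A t \<Longrightarrow> v \<in> e \<Longrightarrow> e \<in> H \<longleftrightarrow> e \<in> H'"
  unfolding hsim_def inc_def by blast

lemma hsim_inc: "hsim t H H' \<Longrightarrow> v \<in> A t \<Longrightarrow> inc H v = inc H' v" by (simp add: hsim_def)

lemma hsim_sub: "hsim t H H' \<Longrightarrow> H \<subseteq> E" "hsim t H H' \<Longrightarrow> H' \<subseteq> E'" by (simp_all add: hsim_def)

lemma hsim_fin: "hsim t H H' \<Longrightarrow> finite H" "hsim t H H' \<Longrightarrow> finite H'"
  unfolding hsim_def using finE finite_subset by blast+

lemma hsim_base: "hsim 1 E E'" unfolding hsim_def using A_inc[of _ 0] by simp

lemma hsimI: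
  assumes "1 \<le> t" "H \<subseteq> E" "H' \<subseteq> E'"
    and "\<And>v e. v \<in> A t \<Longrightarrow> e \<in> E \<Longrightarrow> v \<in> e \<Longrightarrow> e \<in> H \<longleftrightarrow> e \<in> H'"
  shows "hsim t H H'"
proof -
  have "inc H v = inc H' v" if v: "v \<in> A t" for v
  proof -
    obtain t0 where t: "t = Suc t0" using assms(1) by (cases t) auto
    have "inc E v = inc E' v" using A_inc[of v t0] v t by simp
    then show ?thesis using assms(2,3) assms(4)[OF v] unfolding inc_def by blast
  qed
  then show ?thesis using assms by (simp add: hsim_def)
qed

lemma hsim_filter:
  assumes "hsim t H H'" "\<And>v e. v \<in> A t \<Longrightarrow> e \<in> H \<Longrightarrow> e \<in> E \<Longrightarrow> v \<in> e \<Longrightarrow> Q e = Q' e"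
  shows "hsim t {e \<in> H. Q e} {e \<in> H'. Q' e}"
proof (rule hsimI)
  fix v e assume "v \<in> A t" "e \<in> E" "v \<in> e"
  then show "e \<in> {e \<in> H. Q e} \<longleftrightarrow> e \<in> {e \<in> H'. Q' e}"
    using assms(2)[of v e] hsim_mem[OF assms(1), of v e] by blast
qed (use assms(1) in \<open>auto simp: hsim_def\<close>)

lemma esum_sim: assumes "hsim t H H'" shows "esim (Suc t) (esum H) (esum H')"
proof (rule esimI)
  fix v e assume "v \<in> A (Suc t)" "e \<in> E" "v \<in> e"
  then have "inc H u = inc H' u" if "u \<in> e" for u using nb that hsim_inc[OF assms] by blast
  then show "esum H e = esum H' e" unfolding esum_def by simp
qed

lemma adj_eq:
  assumes "hsim t H H'" "v \<in> A (Suc t)" "e \<in> E" "v \<in> e"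
  shows "adj H e = adj H' e"
proof -
  have "f \<in> H \<longleftrightarrow> f \<in> H'" if "f \<inter> e \<noteq> {}" for f
    using that nb[OF assms(2-4)] hsim_mem[OF assms(1)] by blast
  then show ?thesis unfolding adj_def by blast
qed

lemma adj_esim:
  assumes "hsim t H H'" "esim t x x'" "v \<in> A (Suc t)" "e \<in> E" "v \<in> e" "f \<in> adj H e"
  shows "x f = x' f"
proof -
  have f: "f \<in> H" "f \<inter> e \<noteq> {}" using assms(6) by (auto simp: adj_def)
  obtain w where w: "w \<in> f" "w \<in> e" using f(2) by blast
  have "w \<in> A t" by (rule nb[OF assms(3-5) w(2)])
  moreover have "f \<in> E" using f(1) hsim_sub(1)[OF assms(1)] by blast
  ultimately show ?thesis using w(1) by (intro esimD[OF assms(2)])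
qed

lemma adj_image_sim:
  assumes "hsim t H H'" "esim t x x'"
  shows "esim (Suc t) (\<lambda>e. x ` adj H e) (\<lambda>e. x' ` adj H' e)"
proof (rule esimI)
  fix v e assume ve: "v \<in> A (Suc t)" "e \<in> E" "v \<in> e"
  have "x ` adj H e = x' ` adj H e"
    by (rule image_cong[OF refl]) (rule adj_esim[OF assms ve])
  then show "x ` adj H e = x' ` adj H' e" using adj_eq[OF assms(1) ve] by simp
qed

lemma nsim_image: assumes "nsim t f f'" shows "esim (Suc t) (\<lambda>e. f ` e) (\<lambda>e. f' ` e)"
proof (rule esimI)
  fix v e assume "v \<in> A (Suc t)" "e \<in> E" "v \<in> e"
  then show "f ` e = f' ` e" using nb nsimD[OF assms] by (intro image_cong refl) blast
qed

lemma other_in: "e \<in> E \<Longrightarrow> v \<in> e \<Longrightarrow> other e v \<in> e" using E2 other_pair(3) by blast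

text \<open>A stage reads adjacent edges only, so every key value costs one round.\<close>

lemma gcs_sim:
  assumes "hsim t H H'" "esim t L L'" "esim t key key'"
  shows "esim (t + s) (gcs H L key s) (gcs H' L' key' s)"
proof (induction s)
  case 0 then show ?case by (simp add: esim_def)
next
  case (Suc s)
  show ?case
  proof (rule esimI)
    fix v e assume v: "v \<in> A (t + Suc s)" and e: "e \<in> E" "v \<in> e"
    have v': "v \<in> A (Suc (t + s))" using v by simp
    have vt: "v \<in> A t" using A_leD[OF v] by simp
    have m: "e \<in> H \<longleftrightarrow> e \<in> H'" by (rule hsim_mem[OF assms(1) vt e(2)])
    have k: "key e = key' e" by (rule esimD[OF assms(3) vt e])
    have l: "L e = L' e" by (rule esimD[OF assms(2) vt e])
    have h: "hsim (t + s) H H'" using hsim_le[OF assms(1)] by simp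
    have a: "adj H e = adj H' e" by (rule adj_eq[OF h v' e])
    have kf: "key f = key' f" if "f \<in> adj H e" for f
      using adj_esim[OF h esim_le[OF assms(3)] v' e that] by simp
    have gf: "gcs H L key s f = gcs H' L' key' s f" if "f \<in> adj H e" for f
      by (rule adj_esim[OF h Suc.IH v' e that])
    have ge: "gcs H L key s e = gcs H' L' key' s e"
      by (rule esimD[OF Suc.IH _ e]) (use v in \<open>simp add: A_leD\<close>)
    have "(\<lambda>c. c \<in> L e \<and> (\<forall>f\<in>adj H e. key f < s \<longrightarrow> gcs H L key s f \<noteq> c)) =
        (\<lambda>c. c \<in> L' e \<and> (\<forall>f\<in>adj H' e. key' f < s \<longrightarrow> gcs H' L' key' s f \<noteq> c))"
      using kf gf unfolding l a[symmetric] by (intro ext) auto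
    then show "gcs H L key (Suc s) e = gcs H' L' key' (Suc s) e"
      using m k ge by simp
  qed
qed

lemma gcol_sim:
  assumes "hsim t H H'" "esim t L L'" "esim t key key'" and N: "\<And>e. e \<in> H \<Longrightarrow> key e < N"
  shows "esim (t + N) (gcol H L key) (gcol H' L' key')"
proof (rule esimI)
  fix v e assume v: "v \<in> A (t + N)" and e: "e \<in> E" "v \<in> e"
  have vt: "v \<in> A t" using A_leD[OF v] by simp
  have m: "e \<in> H \<longleftrightarrow> e \<in> H'" by (rule hsim_mem[OF assms(1) vt e(2)])
  have k: "key e = key' e" by (rule esimD[OF assms(3) vt e])
  show "gcol H L key e = gcol H' L' key' e"
  proof (cases "e \<in> H")
    case True
    have "v \<in> A (t + Suc (key e))" using A_leD[OF v] N[OF True] by simp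
    then show ?thesis unfolding gcol_def k[symmetric] by (intro esimD[OF gcs_sim[OF assms(1-3)] _ e])
  qed (use m in \<open>simp add: gcol_outside\<close>)
qed

text \<open>Without the assumptions of \<open>game_ok\<close> the token position may lie off the
  edge. This settles that case: nothing is accepted there in either graph.\<close>

lemma accept_mem: "finite G \<Longrightarrow> e \<in> game.accept G sd g K p t P Y w \<Longrightarrow> w \<in> e"
proof -
  assume a: "finite G" "e \<in> game.accept G sd g K p t P Y w"
  have "finite (game.received G sd g K p t P Y w)"
    unfolding game.received_def using finite_inc[OF a(1)] by simp
  then have "e \<in> game.received G sd g K p t P Y w"
    using a(2) pick(1) unfolding game.accept_def by (metis subsetD)
  then show ?thesis by (simp add: game.received_def inc_def)
qed

text \<open>A step costs three rounds: candidates depend on the state of the neighbour, acceptance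
  on the neighbour's offers, and an edge must learn what its far end accepted. The additional first
  round reveals \<open>sd\<close> and \<open>esum\<close> at both ends.\<close>

lemma game_sim:
  fixes K p :: nat
  assumes H: "hsim t H H'" and S: "nsim t sd sd'" and G: "esim t g g'"
  shows "esim (t + 1 + 3 * r) (fst (game.st H sd g K p r)) (fst (game.st H' sd' g' K p r)) \<and>
    nsim (t + 1 + 3 * r) (snd (game.st H sd g K p r)) (snd (game.st H' sd' g' K p r))"
proof (induction r)
  case 0
  have "esim (t + 1) (\<lambda>e. SOME v. v \<in> e \<and> 0 \<le> game.eta sd g e v) (\<lambda>e. SOME v. v \<in> e \<and> 0 \<le> game.eta sd' g' e v)"
  proof (rule esimI)
    fix v e assume v: "v \<in> A (t + 1)" and e: "e \<in> E" "v \<in> e"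
    have "sd w = sd' w" if "w \<in> e" for w using nb[of v t e w] v e that nsimD[OF S] by simp
    moreover have "g e = g' e" by (rule esimD[OF G _ e]) (use A_leD[OF v] in simp)
    ultimately have "(\<lambda>v. v \<in> e \<and> 0 \<le> game.eta sd g e v) = (\<lambda>v. v \<in> e \<and> 0 \<le> game.eta sd' g' e v)"
      unfolding game.eta_def by auto
    then show "(SOME v. v \<in> e \<and> 0 \<le> game.eta sd g e v) = (SOME v. v \<in> e \<and> 0 \<le> game.eta sd' g' e v)"
      by simp
  qed
  then show ?case by (simp add: game.st.simps nsim_def)
next
  case (Suc r)
  define T where "T = t + 1 + 3 * r"
  define P where "P = fst (game.st H sd g K p r)"
  define P' where "P' = fst (game.st H' sd' g' K p r)"
  define Y where "Y = snd (game.st H sd g K p r)"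
  define Y' where "Y' = snd (game.st H' sd' g' K p r)"
  have P: "esim T P P'" and Y: "nsim T Y Y'" using Suc.IH unfolding T_def P_def P'_def Y_def Y'_def by auto
  have HT: "hsim T H H'" using hsim_le[OF H] by (simp add: T_def)
  have i: "inc H v = inc H' v" if "v \<in> A T" for v using hsim_inc[OF HT that] .
  have subE: "e \<in> E" "v \<in> e" if "e \<in> inc H v" for e v using that hsim_sub(1)[OF H] by (auto simp: inc_def)
  have q: "game.quota H K v = game.quota H' K v" if "v \<in> A T" for v
    unfolding game.quota_def i[OF that] ..
  have l: "game.load H P v = game.load H' P' v" if "v \<in> A T" for v
  proof -
    have "{e \<in> inc H v. P e = v} = {e \<in> inc H v. P' e = v}"
      using esimD[OF P that] subE[of _ v] by (intro Collect_cong) metis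
    then show ?thesis unfolding game.load_def i[OF that, symmetric] by simp
  qed
  have c: "game.cong H K p r P Y v = game.cong H' K p r P' Y' v" if "v \<in> A T" for v
    unfolding game.cong_def by (simp only: q[OF that] l[OF that] nsimD[OF Y that] i[OF that])
  have th: "game.thr H K e = game.thr H' K e" if "v \<in> A T" "e \<in> E" "v \<in> e" for v e
  proof -
    have "v \<in> A (Suc t)" using A_leD[OF that(1)] by (simp add: T_def)
    then show ?thesis unfolding game.thr_def using esimD[OF esum_sim[OF H] _ that(2,3)] by simp
  qed
  have eta: "game.eta sd g e v = game.eta sd' g' e v" if "v \<in> A T" "e \<in> E" "v \<in> e" for v e
  proof -
    have "v \<in> A t" using A_leD[OF that(1)] by (simp add: T_def)
    then show ?thesis unfolding game.eta_def using nsimD[OF S] esimD[OF G _ that(2,3)] by simp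
  qed
  have cd: "game.cand H sd g K p r P Y v = game.cand H' sd' g' K p r P' Y' v" if v: "v \<in> A (Suc T)" for v
  proof -
    have vT: "v \<in> A T" using A_leD[OF v] by simp
    have "game.cand H sd g K p r P Y v = {e \<in> inc H v. P' e = v \<and> \<not> game.cong H' K p r P' Y' (other e v) \<and>
       game.eta sd' g' e v + game.thr H' K e \<le> Y' v - Y' (other e v)}"
      unfolding game.cand_def
    proof (rule Collect_cong, rule conj_cong[OF refl])
      fix e assume e: "e \<in> inc H v"
      note e' = subE[OF e]
      have o: "other e v \<in> A T" using nb[OF v e'] other_in[OF e'] by blast
      show "(P e = v \<and> \<not> game.cong H K p r P Y (other e v) \<and>
           game.eta sd g e v + game.thr H K e \<le> Y v - Y (other e v)) =
          (P' e = v \<and> \<not> game.cong H' K p r P' Y' (other e v) \<and>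
           game.eta sd' g' e v + game.thr H' K e \<le> Y' v - Y' (other e v))"
        by (simp only: esimD[OF P vT e'] c[OF o] eta[OF vT e'] th[OF vT e'] nsimD[OF Y vT] nsimD[OF Y o])
    qed
    then show ?thesis unfolding game.cand_def i[OF vT] .
  qed
  have of: "game.offer H sd g K p r P Y v = game.offer H' sd' g' K p r P' Y' v" if v: "v \<in> A (Suc T)" for v
  proof -
    have vT: "v \<in> A T" using A_leD[OF v] by simp
    show ?thesis unfolding game.offer_def by (simp only: c[OF vT] cd[OF v] q[OF vT])
  qed
  have rc: "game.received H sd g K p r P Y v = game.received H' sd' g' K p r P' Y' v" if v: "v \<in> A (Suc (Suc T))" for v
  proof -
    have vT: "v \<in> A T" using A_leD[OF v] by simp
    have "game.received H sd g K p r P Y v =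
        {e \<in> inc H v. P' e \<noteq> v \<and> e \<in> game.offer H' sd' g' K p r P' Y' (other e v)}"
      unfolding game.received_def
    proof (rule Collect_cong, rule conj_cong[OF refl])
      fix e assume e: "e \<in> inc H v"
      note e' = subE[OF e]
      have o: "other e v \<in> A (Suc T)" using nb[OF v e'] other_in[OF e'] by blast
      show "(P e \<noteq> v \<and> e \<in> game.offer H sd g K p r P Y (other e v)) =
          (P' e \<noteq> v \<and> e \<in> game.offer H' sd' g' K p r P' Y' (other e v))"
        by (simp only: esimD[OF P vT e'] of[OF o])
    qed
    then show ?thesis unfolding game.received_def i[OF vT] .
  qed
  have ac: "game.accept H sd g K p r P Y v = game.accept H' sd' g' K p r P' Y' v" if v: "v \<in> A (Suc (Suc T))" for v
  proof -
    have vT: "v \<in> A T" using A_leD[OF v] by simp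
    show ?thesis unfolding game.accept_def by (simp only: rc[OF v] q[OF vT] i[OF vT])
  qed
  have pos: "esim (Suc (Suc (Suc T)))
      (\<lambda>e. if e \<in> H \<and> e \<in> game.accept H sd g K p r P Y (other e (P e)) then other e (P e) else P e)
      (\<lambda>e. if e \<in> H' \<and> e \<in> game.accept H' sd' g' K p r P' Y' (other e (P' e)) then other e (P' e) else P' e)"
  proof (rule esimI)
    fix v e assume v: "v \<in> A (Suc (Suc (Suc T)))" and e: "e \<in> E" "v \<in> e"
    have vT: "v \<in> A T" using A_leD[OF v] by simp
    have Pe: "P e = P' e" by (rule esimD[OF P vT e])
    have m: "e \<in> H \<longleftrightarrow> e \<in> H'" by (rule hsim_mem[OF HT vT e(2)])
    have "e \<in> game.accept H sd g K p r P Y (other e (P e)) \<longleftrightarrow> e \<in> game.accept H' sd' g' K p r P' Y' (other e (P e))"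
    proof (cases "other e (P e) \<in> e")
      case True
      then show ?thesis using ac[OF nb[OF v e True]] by simp
    next
      case False
      then show ?thesis using accept_mem hsim_fin[OF H] by blast
    qed
    then show "(if e \<in> H \<and> e \<in> game.accept H sd g K p r P Y (other e (P e)) then other e (P e) else P e) =
      (if e \<in> H' \<and> e \<in> game.accept H' sd' g' K p r P' Y' (other e (P' e)) then other e (P' e) else P' e)"
      using m Pe by simp
  qed
  have lev: "nsim (Suc (Suc (Suc T)))
      (\<lambda>v. if game.cong H K p r P Y v then Y v + game.rise K p r else Y v)
      (\<lambda>v. if game.cong H' K p r P' Y' v then Y' v + game.rise K p r else Y' v)"
  proof (rule nsimI)
    fix v assume "v \<in> A (Suc (Suc (Suc T)))"
    then have vT: "v \<in> A T" by (rule A_leD) simp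
    show "(if game.cong H K p r P Y v then Y v + game.rise K p r else Y v) =
      (if game.cong H' K p r P' Y' v then Y' v + game.rise K p r else Y' v)"
      by (simp only: c[OF vT] nsimD[OF Y vT])
  qed
  have T3: "t + 1 + 3 * Suc r = Suc (Suc (Suc T))" by (simp add: T_def)
  show ?case unfolding T3 game.st.simps fst_conv snd_conv
    using pos lev unfolding P_def P'_def Y_def Y'_def by blast
qed

lemma game_final_sim:
  assumes "hsim t H H'" "nsim t sd sd'" "esim t g g'"
  shows "esim (t + 1 + 3 * game.rounds K p) (game.final H sd g K p) (game.final H' sd' g' K p)"
  unfolding game.final_def using game_sim[OF assms] by blast

end

section \<open>List colouring with slack by halving the colour space\<close>

context game
begin

text \<open>Testing membership in \<open>{v \<in> e. sd v}\<close> confines the test to the ends of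
  \<open>e\<close>, where the sides are known to agree in two similar graphs.\<close>

definition red :: "nat set set" where
  "red = {e \<in> H. final e \<in> {v \<in> e. sd v}}"

text \<open>On a bipartite edge the sum has one term; it is the constant by which the degree of the
  edge in \<open>red\<close> differs from a difference of loads.\<close>

definition lowdeg :: "nat set \<Rightarrow> real" where
  "lowdeg e = (\<Sum>v\<in>{v \<in> e. \<not> sd v}. real (card (inc H v)))"

end

context game_ok
begin

lemma final_in: "e \<in> H \<Longrightarrow> final e \<in> e" using pos_in by (simp add: final_def)

lemma ends:
  assumes "e \<in> H"
  obtains v u where "e = {v, u}" "v \<noteq> u" "sd v" "\<not> sd u" "u = other e v" "v = other e u"
proof -
  obtain w where w: "w \<in> e" using c2[OF assms] by fastforce
  note o = other_pair[OF c2[OF assms] w]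
  note b = bip[OF assms w]
  show thesis
  proof (cases "sd w")
    case True
    show thesis by (rule that[of w "other e w"]) (use True o b in \<open>simp_all\<close>)
  next
    case False
    show thesis by (rule that[of "other e w" w]) (use False o b in \<open>auto\<close>)
  qed
qed

lemma red_at_top: assumes "sd v" shows "inc red v = {f \<in> inc H v. final f = v}"
proof -
  have "final f \<in> {w \<in> f. sd w} \<longleftrightarrow> final f = v" if f: "f \<in> H" "v \<in> f" for f
  proof
    assume a: "final f \<in> {w \<in> f. sd w}"
    show "final f = v"
    proof (rule ccontr)
      assume "final f \<noteq> v"
      then have "final f = other f v" using other_unique[OF c2[OF f(1)] f(2)] a by blast
      then show False using bip[OF f] assms a by simp
    qed
  qed (use f assms in simp)
  then show ?thesis unfolding red_def inc_def by auto
qed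

lemma red_at_bottom: assumes "\<not> sd u" shows "inc red u = inc H u - {f \<in> inc H u. final f = u}"
proof -
  have "final f \<in> {w \<in> f. sd w} \<longleftrightarrow> final f \<noteq> u" if f: "f \<in> H" "u \<in> f" for f
  proof
    assume "final f \<noteq> u"
    then have "final f = other f u" using other_unique[OF c2[OF f(1)] f(2)] final_in[OF f(1)] by blast
    then show "final f \<in> {w \<in> f. sd w}" using bip[OF f] assms final_in[OF f(1)] by simp
  qed (use assms in auto)
  then show ?thesis unfolding red_def inc_def by auto
qed

lemma inc_blue: "inc (H - red) w = inc H w - inc red w" by (auto simp: inc_def)

lemma load_le: "load P w \<le> card (inc H w)"
  unfolding load_def using finite_inc[OF finH] by (intro card_mono) auto

text \<open>On side \<open>sd\<close> a node's red edges are those whose token it holds, on the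
  other side those whose token it does not hold. So red and blue degrees are differences of loads up
  to a constant, and \<open>balanced\<close> applies to them.\<close>

lemma class_sums:
  assumes "e = {v, u}" "v \<noteq> u" "sd v" "\<not> sd u"
  shows "real (esum red e) = real (load final v) + (real (card (inc H u)) - real (load final u))"
    and "real (esum (H - red) e) = (real (card (inc H v)) - real (load final v)) + real (load final u)"
    and "lowdeg e = real (card (inc H u))"
proof -
  have f: "finite (inc H w)" for w by (rule finite_inc[OF finH])
  have t: "card (inc red v) = load final v" by (simp add: red_at_top[OF assms(3)] load_def)
  have bt: "card (inc red u) = card (inc H u) - load final u"
    unfolding red_at_bottom[OF assms(4)] load_def using f by (subst card_Diff_subset) auto
  have bv: "card (inc (H - red) v) = card (inc H v) - load final v"
    unfolding inc_blue red_at_top[OF assms(3)] load_def using f by (subst card_Diff_subset) auto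
  have "inc (H - red) u = {f \<in> inc H u. final f = u}" unfolding inc_blue red_at_bottom[OF assms(4)] by auto
  then have bu: "card (inc (H - red) u) = load final u" by (simp add: load_def)
  have es: "esum G e = card (inc G v) + card (inc G u)" for G unfolding esum_def using assms by simp
  show "real (esum red e) = real (load final v) + (real (card (inc H u)) - real (load final u))"
    unfolding es t bt using load_le[of final u] by simp
  show "real (esum (H - red) e) = (real (card (inc H v)) - real (load final v)) + real (load final u)"
    unfolding es bv bu using load_le[of final v] by simp
  have "{w \<in> e. \<not> sd w} = {u}" using assms by auto
  then show "lowdeg e = real (card (inc H u))" by (simp add: lowdeg_def)
qed

lemma red_bound:
  assumes "e \<in> red"
  shows "real (esum red e) \<le> lowdeg e + g e + 5 * real (esum H e) / real K + 3"
proof -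
  have e: "e \<in> H" using assms by (simp add: red_def)
  obtain v u where vu: "e = {v, u}" "v \<noteq> u" "sd v" "\<not> sd u" "u = other e v" "v = other e u"
    using ends[OF e] .
  have "final e = v" using assms vu(1,4) by (auto simp: red_def)
  from balanced[OF e this vu(5)] show ?thesis
    unfolding class_sums[OF vu(1-4)] using vu(3) by (simp add: eta_def)
qed

lemma blue_bound:
  assumes "e \<in> H - red"
  shows "real (esum (H - red) e) \<le> real (esum H e) - lowdeg e - g e + 5 * real (esum H e) / real K + 3"
proof -
  have e: "e \<in> H" using assms by simp
  obtain v u where vu: "e = {v, u}" "v \<noteq> u" "sd v" "\<not> sd u" "u = other e v" "v = other e u"
    using ends[OF e] .
  have "final e = u"
  proof (rule ccontr)
    assume "final e \<noteq> u"
    then have "final e = v" using final_in[OF e] vu(1) by blast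
    then show False using assms vu(1,3) by (simp add: red_def)
  qed
  note b = balanced[OF e this vu(6)]
  have "real (esum H e) = real (card (inc H v)) + real (card (inc H u))" unfolding esum_def using vu(1,2) by simp
  then show ?thesis unfolding class_sums[OF vu(1-4)] using b vu(4) by (simp add: eta_def)
qed

end

section \<open>Descent of the edges through the binary tree of colour blocks\<close>

locale cls =
  fixes H :: "nat set set" and sd :: "nat \<Rightarrow> bool" and L :: "nat set \<Rightarrow> nat set"
    and nu :: "nat set \<Rightarrow> nat" and p tau :: nat
begin

text \<open>Level \<open>i\<close> cuts the \<open>2 ^ p\<close> colours into blocks of length
  \<open>2 ^ (p - i)\<close>, and \<open>b\<close> is the number of the block.\<close>

definition sub :: "nat set \<Rightarrow> nat \<Rightarrow> nat \<Rightarrow> nat set" where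
  "sub e i b = {c \<in> L e. c div 2 ^ (p - i) = b}"

definition frac :: "nat set \<Rightarrow> nat \<Rightarrow> nat \<Rightarrow> real" where
  "frac e i b = real (card (sub e (Suc i) (2 * b + 1))) / real (card (sub e i b))"

text \<open>The extreme offsets force an edge into the half that contains almost all of its list.\<close>

definition offset :: "nat set set \<Rightarrow> nat \<Rightarrow> nat \<Rightarrow> nat set \<Rightarrow> real" where
  "offset G i b e = (if frac e i b < 1 / (2 * real p) then - (2 * real (esum G e) + 4)
     else if 1 - 1 / (2 * real p) < frac e i b then 2 * real (esum G e) + 4
     else frac e i b * real (esum G e) - game.lowdeg G sd e)"

text \<open>An edge stops when its list is short. Above \<open>48 * p\<^sup>2\<close> colours, four
  times the additive error 3 of a split is at most a \<open>1 / (4 * p\<^sup>2)\<close> share of the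
  list.\<close>

definition active :: "(nat set \<Rightarrow> nat \<times> nat) \<Rightarrow> nat \<Rightarrow> nat \<Rightarrow> nat set set" where
  "active s i b = {e \<in> H. s e = (i, b) \<and> 48 * p\<^sup>2 < card (sub e i b)}"

text \<open>With precision \<open>20 * p\<^sup>2\<close> the relative error \<open>5 / K\<close> of
  the game is \<open>1 / (4 * p\<^sup>2)\<close>.\<close>

definition upper :: "nat set set \<Rightarrow> nat \<Rightarrow> nat \<Rightarrow> nat set set" where
  "upper G i b = game.red G sd (offset G i b) (20 * p\<^sup>2) p"

primrec blk :: "nat \<Rightarrow> nat set \<Rightarrow> nat \<times> nat" where
  "blk 0 = (\<lambda>e. (0, 0))"
| "blk (Suc i) = (\<lambda>e. if e \<in> active (blk i) i (snd (blk i e))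
     then (Suc i, 2 * snd (blk i e) + (if e \<in> upper (active (blk i) i (snd (blk i e))) i (snd (blk i e)) then 1 else 0))
     else blk i e)"

definition stage_list :: "nat set \<Rightarrow> nat set" where
  "stage_list e = sub e (fst (blk p e)) (snd (blk p e))"

text \<open>Separates adjacent edges that stopped in the same block. An edge has fewer than
  \<open>48 * p\<^sup>2\<close> of those, because its degree there is below the length of its
  list.\<close>

definition sched :: "nat set \<Rightarrow> nat" where
  "sched e = recolor (48 * p\<^sup>2) tau (nu e) (nu ` {f \<in> adj H e. blk p f = blk p e})"

text \<open>Deeper edges come first. When an edge is coloured, its coloured competitors have all
  passed through its own block, so its degree at the level where it stopped already counts
  them.\<close>

definition ckey :: "nat set \<Rightarrow> nat" where
  "ckey e = (p - fst (blk p e)) * palette (48 * p\<^sup>2) tau + sched e"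

definition ccol :: "nat set \<Rightarrow> nat" where
  "ccol = gcol H stage_list ckey"

text \<open>Edges of this set may descend further later on. The degree inside it is what the part of
  the list in block \<open>b\<close> has to outweigh.\<close>

definition reach :: "nat \<Rightarrow> nat \<Rightarrow> nat set set" where
  "reach i b = {e \<in> H. blk i e = (i, b)}"

lemma blk_stop: assumes "fst (blk i e) \<noteq> i" shows "blk (Suc i) e = blk i e"
proof -
  have "e \<notin> active (blk i) i (snd (blk i e))" using assms by (auto simp: active_def prod_eq_iff)
  then show ?thesis by simp
qed

lemma blk_le: "fst (blk i e) \<le> i"
  by (induction i) auto

lemma blk_step:
  assumes "blk (Suc i) e \<noteq> blk i e"
  obtains b x where "blk i e = (i, b)" "x < 2" "blk (Suc i) e = (Suc i, 2 * b + x)" "e \<in> active (blk i) i b"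
    "x = 1 \<longleftrightarrow> e \<in> upper (active (blk i) i b) i b"
proof -
  let ?b = "snd (blk i e)"
  have a: "e \<in> active (blk i) i ?b" using assms by (auto split: if_splits)
  then have "blk i e = (i, ?b)" by (simp add: active_def)
  then show thesis
    by (rule that[of ?b "if e \<in> upper (active (blk i) i ?b) i ?b then 1 else 0"]) (use a in auto)
qed

text \<open>Every descent appends a binary digit to the block number, so earlier blocks are its
  prefixes.\<close>

lemma blk_prefix: "j \<le> fst (blk i e) \<Longrightarrow> blk j e = (j, snd (blk i e) div 2 ^ (fst (blk i e) - j))"
proof (induction i arbitrary: j)
  case (Suc i)
  show ?case
  proof (cases "blk (Suc i) e = blk i e")
    case True
    then show ?thesis using Suc by simp
  next
    case False
    then obtain b x where b: "blk i e = (i, b)" "x < 2" "blk (Suc i) e = (Suc i, 2 * b + x)"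
      using blk_step by metis
    show ?thesis
    proof (cases "j = Suc i")
      case True
      then show ?thesis unfolding b(3) using b(3) by simp
    next
      case False
      then have j: "j \<le> i" using Suc.prems unfolding b(3) by simp
      have "(2 * b + x) div 2 ^ (Suc i - j) = (2 * b + x) div 2 div 2 ^ (i - j)"
        using j by (simp add: Suc_diff_le div_mult2_eq)
      also have "(2 * b + x) div 2 = b" using b(2) by linarith
      finally show ?thesis unfolding b(3) using Suc.IH[of j] j b(1) by simp
    qed
  qed
qed simp

lemma sub_prefix:
  assumes "c \<in> stage_list e" "j \<le> fst (blk p e)"
  shows "blk j e = (j, c div 2 ^ (p - j))"
proof -
  let ?l = "fst (blk p e)" and ?b = "snd (blk p e)"
  have c: "c div 2 ^ (p - ?l) = ?b" using assms by (simp add: stage_list_def sub_def)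
  have l: "?l \<le> p" by (rule blk_le)
  have "c div 2 ^ (p - j) = c div 2 ^ ((p - ?l) + (?l - j))" using l assms(2) by simp
  also have "\<dots> = ?b div 2 ^ (?l - j)" by (simp only: power_add div_mult2_eq c)
  finally show ?thesis using blk_prefix[OF assms(2)] by simp
qed

lemma blk_stopped_size:
  "e \<in> H \<Longrightarrow> fst (blk i e) < i \<Longrightarrow> card (sub e (fst (blk i e)) (snd (blk i e))) \<le> 48 * p\<^sup>2"
proof (induction i)
  case (Suc i)
  show ?case
  proof (cases "fst (blk i e) < i")
    case True
    then have "blk (Suc i) e = blk i e" by (intro blk_stop) simp
    then show ?thesis using Suc True by simp
  next
    case False
    then have f: "fst (blk i e) = i" using blk_le[of i e] by simp
    have eq: "blk (Suc i) e = blk i e"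
    proof (rule ccontr)
      assume "blk (Suc i) e \<noteq> blk i e"
      then obtain b x where "blk (Suc i) e = (Suc i, 2 * b + x)" using blk_step by metis
      then show False using Suc.prems(2) by simp
    qed
    have "e \<notin> active (blk i) i (snd (blk i e))"
    proof
      assume "e \<in> active (blk i) i (snd (blk i e))"
      then have "fst (blk (Suc i) e) = Suc i" by simp
      then show False using eq f by simp
    qed
    then have "card (sub e i (snd (blk i e))) \<le> 48 * p\<^sup>2"
      using Suc.prems(1) f by (auto simp: active_def prod_eq_iff)
    then show ?thesis using eq f by simp
  qed
qed simp

end

locale cls_ok = cls +
  assumes pairsH: "pairs H" and p1: "1 \<le> p" and tau1: "1 \<le> tau"
    and bip: "\<And>e v. e \<in> H \<Longrightarrow> v \<in> e \<Longrightarrow> sd (other e v) = (\<not> sd v)"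
    and Lp: "\<And>e. e \<in> H \<Longrightarrow> L e \<subseteq> {..<2 ^ p}"
    and slack: "\<And>e. e \<in> H \<Longrightarrow> 4 * esum H e \<le> card (L e)"
    and nu: "\<And>e. e \<in> H \<Longrightarrow> nu e < 2 ^ tau" "\<And>e f. e \<in> H \<Longrightarrow> f \<in> adj H e \<Longrightarrow> nu f \<noteq> nu e"
begin

lemma finH: "finite H" using pairsH by (simp add: pairs_def)

lemma finL: "e \<in> H \<Longrightarrow> finite (L e)" using Lp finite_subset by blast

lemma deg_bound: "card (inc H v) \<le> 2 ^ p"
proof (cases "inc H v = {}")
  case False
  then obtain e where e: "e \<in> H" "v \<in> e" by (auto simp: inc_def)
  have "card (inc H v) \<le> esum H e" using esum_other[of e v H] pairsH e by (simp add: pairs_def)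
  also have "\<dots> \<le> card (L e)" using slack[OF e(1)] by simp
  also have "\<dots> \<le> 2 ^ p" using card_mono[OF _ Lp[OF e(1)]] by simp
  finally show ?thesis .
qed simp

lemma game_ok_sub: assumes "G \<subseteq> H" shows "game_ok G sd (20 * p\<^sup>2) p"
proof
  show "pairs G" using pairs_subset[OF pairsH assms] .
  have "1 \<le> p\<^sup>2" using p1 by simp
  then show "2 \<le> 20 * p\<^sup>2" by linarith
  show "card (inc G v) \<le> 2 ^ p" for v
    using deg_bound[of v] card_mono[OF finite_inc[OF finH] inc_mono[OF assms, of v]] by linarith
  show "sd (other e v) = (\<not> sd v)" if "e \<in> G" "v \<in> e" for e v using bip that assms by blast
qed

lemma card_split:
  assumes "e \<in> H" "i < p"
  shows "card (sub e i b) = card (sub e (Suc i) (2 * b + 1)) + card (sub e (Suc i) (2 * b))"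
proof -
  have "c div 2 ^ (p - i) = c div 2 ^ (p - Suc i) div 2" for c :: nat
    using assms(2) by (metis Suc_diff_Suc div_mult2_eq power_Suc2)
  then have "c div 2 ^ (p - i) = b \<longleftrightarrow> c div 2 ^ (p - Suc i) = 2 * b + 1 \<or> c div 2 ^ (p - Suc i) = 2 * b" for c
    by auto
  then have "sub e i b = sub e (Suc i) (2 * b + 1) \<union> sub e (Suc i) (2 * b)" unfolding sub_def by auto
  moreover have "sub e (Suc i) (2 * b + 1) \<inter> sub e (Suc i) (2 * b) = {}" unfolding sub_def by auto
  ultimately show ?thesis using finL[OF assms(1)] by (simp add: card_Un_disjoint sub_def)
qed

text \<open>\<open>mu\<close> is the share of the list that is kept and \<open>r\<close> the loss so
  far. The error is measured against \<open>n\<close>, the permitted loss against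
  \<open>mu * n\<close>; \<open>mu \<ge> 1 / (2 * P)\<close> converts one into the other. In the
  forced case the degree may stay as it was, and
  \<open>(1 - 1 / (2 * P)) * (1 + 1 / P) \<ge> 1\<close> is enough.\<close>

lemma slack_arith:
  fixes n n' W mu r P :: real
  assumes P: "1 \<le> P" and W: "48 * P\<^sup>2 \<le> W" and r: "1 \<le> r" and n: "4 * n \<le> W * r"
    and cases: "(1 / (2 * P) \<le> mu \<and> n' \<le> mu * n + n / (4 * P\<^sup>2) + 3) \<or> (1 - 1 / (2 * P) \<le> mu \<and> n' \<le> n)"
    and mu: "0 \<le> mu"
  shows "4 * n' \<le> mu * W * (r * (1 + 1 / P))"
proof -
  have P2: "0 < P\<^sup>2" using P by simp
  have W0: "0 < W" using W P2 by linarith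
  then have Wr: "0 < W * r" using r by simp
  from cases show ?thesis
  proof
    assume a: "1 / (2 * P) \<le> mu \<and> n' \<le> mu * n + n / (4 * P\<^sup>2) + 3"
    have 1: "mu * (4 * n) \<le> mu * (W * r)" using n mu by (rule mult_left_mono)
    have 2: "4 * n / (4 * P\<^sup>2) \<le> W * r / (4 * P\<^sup>2)" using n P2 by (intro divide_right_mono) auto
    have "12 \<le> W / (4 * P\<^sup>2)" using W P2 by (simp add: field_simps)
    also have "\<dots> \<le> W * r / (4 * P\<^sup>2)" using W0 r P2 by (intro divide_right_mono) auto
    finally have 3: "12 \<le> W * r / (4 * P\<^sup>2)" .
    have "1 / (2 * P) * (W * r / P) \<le> mu * (W * r / P)" using a Wr P by (intro mult_right_mono) auto
    moreover have "1 / (2 * P) * (W * r / P) = 2 * (W * r / (4 * P\<^sup>2))" using P by (simp add: field_simps power2_eq_square)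
    ultimately have 4: "2 * (W * r / (4 * P\<^sup>2)) \<le> mu * (W * r / P)" by linarith
    have "4 * n' \<le> mu * (4 * n) + 4 * n / (4 * P\<^sup>2) + 12" using a by (simp add: algebra_simps)
    also have "\<dots> \<le> mu * (W * r) + mu * (W * r / P)" using 1 2 3 4 by linarith
    also have "\<dots> = mu * W * (r * (1 + 1 / P))" by (simp add: algebra_simps)
    finally show ?thesis .
  next
    assume a: "1 - 1 / (2 * P) \<le> mu \<and> n' \<le> n"
    have "1 \<le> (1 - 1 / (2 * P)) * (1 + 1 / P)"
    proof -
      have "(1 - 1 / (2 * P)) * (1 + 1 / P) = 1 + (P - 1) / (2 * P\<^sup>2)" using P by (simp add: field_simps power2_eq_square)
      moreover have "0 \<le> (P - 1) / (2 * P\<^sup>2)" using P by simp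
      ultimately show ?thesis by linarith
    qed
    also have "\<dots> \<le> mu * (1 + 1 / P)" using a P by (intro mult_right_mono) auto
    finally have "1 * (W * r) \<le> mu * (1 + 1 / P) * (W * r)" using Wr by (intro mult_right_mono) auto
    then show ?thesis using a n by (simp add: algebra_simps)
  qed
qed

lemma reach_step:
  assumes "x < 2"
  shows "reach (Suc i) (2 * b + x) = (if x = 1 then upper (active (blk i) i b) i b
      else active (blk i) i b - upper (active (blk i) i b) i b)"
proof -
  let ?G = "active (blk i) i b"
  have up: "upper ?G i b \<subseteq> ?G" unfolding upper_def game.red_def by blast
  have 1: "e \<in> ?G \<and> (e \<in> upper ?G i b \<longleftrightarrow> x = 1)" if "e \<in> reach (Suc i) (2 * b + x)" for e
  proof -
    have r: "blk (Suc i) e = (Suc i, 2 * b + x)" "e \<in> H" using that by (auto simp: reach_def)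
    have "fst (blk (Suc i) e) \<noteq> fst (blk i e)" using blk_le[of i e] unfolding r(1) by simp
    then have "blk (Suc i) e \<noteq> blk i e" by metis
    then obtain b' x' where b': "blk i e = (i, b')" "x' < 2" "blk (Suc i) e = (Suc i, 2 * b' + x')"
      "e \<in> active (blk i) i b'" "x' = 1 \<longleftrightarrow> e \<in> upper (active (blk i) i b') i b'" using blk_step by metis
    have "2 * b' + x' = 2 * b + x" using r(1) b'(3) by simp
    then have "b' = b" "x' = x" using assms b'(2) by presburger+
    then show ?thesis using b' by blast
  qed
  have 2: "e \<in> reach (Suc i) (2 * b + x)" if "e \<in> ?G" "e \<in> upper ?G i b \<longleftrightarrow> x = 1" for e
  proof -
    have b: "blk i e = (i, b)" "e \<in> H" using that(1) by (auto simp: active_def)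
    have "blk (Suc i) e = (Suc i, 2 * b + (if e \<in> upper ?G i b then 1 else 0))" using that(1) b(1) by simp
    then show ?thesis using b(2) that(2) assms by (auto simp: reach_def)
  qed
  show ?thesis
  proof (cases "x = 1")
    case True
    then show ?thesis using 1 2 up by auto
  next
    case False
    then show ?thesis using 1 2 by auto
  qed
qed

text \<open>Each level may worsen the ratio of degree to list by \<open>1 + 1 / p\<close>. Over
  \<open>p\<close> levels this stays below 4, the slack granted at the start.\<close>

lemma slack_inv:
  "i \<le> p \<Longrightarrow> e \<in> reach i b \<Longrightarrow>
    4 * real (esum (reach i b) e) \<le> real (card (sub e i b)) * (1 + 1 / real p) ^ i"
proof (induction i arbitrary: e b)
  case 0
  then have e: "e \<in> H" "b = 0" by (auto simp: reach_def)
  have "reach 0 0 = H" by (auto simp: reach_def)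
  moreover have "sub e 0 0 = L e" using Lp[OF e(1)] by (auto simp: sub_def)
  moreover have "real (4 * esum H e) \<le> real (card (L e))" using slack[OF e(1)] by (rule of_nat_mono)
  ultimately show ?case using e by simp
next
  case (Suc i)
  define c where "c = b div 2"
  define x where "x = b mod 2"
  have b: "b = 2 * c + x" "x < 2" by (simp_all add: c_def x_def)
  define G where "G = active (blk i) i c"
  define R where "R = upper G i c"
  interpret ga: game_ok G sd "offset G i c" "20 * p\<^sup>2" p
    by (rule game_ok_sub) (auto simp: G_def active_def)
  have R: "R = ga.red" by (simp add: R_def upper_def)
  have rs: "reach (Suc i) b = (if x = 1 then R else G - R)" unfolding b(1) R_def G_def by (rule reach_step[OF b(2)])
  have RG: "R \<subseteq> G" unfolding R ga.red_def by blast
  have eG: "e \<in> G" using Suc.prems(2) rs RG by (auto split: if_splits)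
  have e: "e \<in> H" "blk i e = (i, c)" "48 * p\<^sup>2 < card (sub e i c)" using eG by (auto simp: G_def active_def)
  let ?n = "real (esum G e)" and ?n' = "real (esum (reach (Suc i) b) e)" and ?l = "frac e i c"
  let ?W = "real (card (sub e i c))" and ?P = "real p"
  have W0: "0 < ?W" using e(3) by simp
  have P1: "1 \<le> ?P" using p1 by simp
  have i: "i < p" using Suc.prems(1) by simp
  have sp: "?W = real (card (sub e (Suc i) (2 * c + 1))) + real (card (sub e (Suc i) (2 * c)))"
    using card_split[OF e(1) i, of c] by simp
  have l1: "real (card (sub e (Suc i) (2 * c + 1))) = ?l * ?W" using W0 by (simp add: frac_def)
  define mu where "mu = (if x = 1 then ?l else 1 - ?l)"
  have W': "real (card (sub e (Suc i) b)) = mu * ?W"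
  proof (cases "x = 1")
    case True then show ?thesis using l1 b by (simp add: mu_def)
  next
    case False
    then have "x = 0" using b(2) by simp
    then show ?thesis using sp l1 b by (simp add: mu_def algebra_simps)
  qed
  have mu0: "0 \<le> mu"
  proof -
    have "0 \<le> mu * ?W" using W' by (metis of_nat_0_le_iff)
    then show ?thesis using W0 by (simp add: zero_le_mult_iff)
  qed
  have sl: "5 * ?n / real (20 * p\<^sup>2) = ?n / (4 * ?P\<^sup>2)" using P1 by (simp add: field_simps)
  have sln: "?n / (4 * ?P\<^sup>2) \<le> ?n"
  proof -
    have "1 \<le> 4 * ?P\<^sup>2" using P1 one_le_power[of ?P 2] by linarith
    then show ?thesis by (simp add: divide_le_eq mult_le_cancel_left1)
  qed
  have low: "0 \<le> ga.lowdeg e" "ga.lowdeg e \<le> ?n"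
  proof -
    show "0 \<le> ga.lowdeg e" unfolding ga.lowdeg_def by (intro sum_nonneg) auto
    have "finite e" using ga.c2[OF eG] card.infinite by fastforce
    then show "ga.lowdeg e \<le> ?n" unfolding ga.lowdeg_def esum_def of_nat_sum by (intro sum_mono2) auto
  qed
  have bound: "?n' \<le> (if x = 1 then ga.lowdeg e + offset G i c e else ?n - ga.lowdeg e - offset G i c e) + ?n / (4 * ?P\<^sup>2) + 3"
  proof (cases "x = 1")
    case True
    then have "e \<in> ga.red" using Suc.prems(2) rs R by simp
    from ga.red_bound[OF this] show ?thesis using True rs R sl by simp
  next
    case False
    then have "e \<in> G - ga.red" using Suc.prems(2) rs R by simp
    from ga.blue_bound[OF this] show ?thesis using False rs R sl by simp
  qed
  have n'0: "0 \<le> ?n'" by simp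
  have n'n: "?n' \<le> ?n"
  proof -
    have "reach (Suc i) b \<subseteq> G" using rs RG by auto
    then show ?thesis using esum_mono ga.finH by (simp add: of_nat_mono)
  qed
  have cs: "(1 / (2 * ?P) \<le> mu \<and> ?n' \<le> mu * ?n + ?n / (4 * ?P\<^sup>2) + 3) \<or> (1 - 1 / (2 * ?P) \<le> mu \<and> ?n' \<le> ?n)"
  proof -
    consider "?l < 1 / (2 * ?P)" | "\<not> ?l < 1 / (2 * ?P)" "1 - 1 / (2 * ?P) < ?l"
      | "\<not> ?l < 1 / (2 * ?P)" "\<not> 1 - 1 / (2 * ?P) < ?l" by blast
    then show ?thesis
    proof cases
      case 1
      then have off: "offset G i c e = - (2 * ?n + 4)" by (simp add: offset_def)
      \<comment> \<open>In the poor half the bound on the degree would be at most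
        \<open>n - (2 * n + 4) + n + 3\<close>, which is negative; so the edge must go to the other
        half.\<close>
      have "x \<noteq> 1" using bound sln low n'0 unfolding off by auto
      then have "1 - 1 / (2 * ?P) \<le> mu" using 1 by (simp add: mu_def)
      then show ?thesis using n'n by blast
    next
      case 2
      then have off: "offset G i c e = 2 * ?n + 4" by (simp add: offset_def)
      have "x = 1" using bound sln low n'0 unfolding off by (auto split: if_splits)
      then have "1 - 1 / (2 * ?P) \<le> mu" using 2 by (simp add: mu_def)
      then show ?thesis using n'n by blast
    next
      case 3
      then have off: "offset G i c e = ?l * ?n - ga.lowdeg e" by (simp add: offset_def)
      have "?n' \<le> mu * ?n + ?n / (4 * ?P\<^sup>2) + 3" using bound unfolding off mu_def by (auto simp: algebra_simps split: if_splits)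
      moreover have "1 / (2 * ?P) \<le> mu" using 3 by (auto simp: mu_def)
      ultimately show ?thesis by blast
    qed
  qed
  have er: "e \<in> reach i c" using e by (simp add: reach_def)
  have "G \<subseteq> reach i c" by (auto simp: G_def active_def reach_def)
  then have "esum G e \<le> esum (reach i c) e" by (rule esum_mono) (use finH in \<open>simp add: reach_def\<close>)
  then have "?n \<le> real (esum (reach i c) e)" by (rule of_nat_mono)
  then have n4: "4 * ?n \<le> ?W * (1 + 1 / ?P) ^ i" using Suc.IH[OF _ er] i by linarith
  have W48: "48 * ?P\<^sup>2 \<le> ?W" using of_nat_mono[OF less_imp_le[OF e(3)], where 'a = real] by simp
  have "4 * ?n' \<le> mu * ?W * ((1 + 1 / ?P) ^ i * (1 + 1 / ?P))"
    by (rule slack_arith[OF P1 W48 _ n4 cs mu0]) simp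
  then show ?case unfolding W'[symmetric] by (simp add: mult.commute)
qed

lemma growth: "i \<le> p \<Longrightarrow> (1 + 1 / real p) ^ i \<le> 4"
proof -
  assume i: "i \<le> p"
  have "(1 + 1 / real p) ^ i \<le> (1 + 1 / real p) ^ p" by (rule power_increasing[OF i]) simp
  also have "\<dots> \<le> exp 1" using exp_ge_one_plus_x_over_n_power_n[of p 1] p1 by simp
  also have "\<dots> \<le> 3" by (rule exp_le)
  finally show ?thesis by simp
qed

lemma stage:
  assumes e: "e \<in> H"
  shows "e \<in> reach (fst (blk p e)) (snd (blk p e))"
    and "esum (reach (fst (blk p e)) (snd (blk p e))) e \<le> card (stage_list e)"
    and "card (stage_list e) \<le> 48 * p\<^sup>2"
proof -
  let ?l = "fst (blk p e)" and ?b = "snd (blk p e)"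
  have l: "?l \<le> p" by (rule blk_le)
  have "blk ?l e = (?l, ?b)" using blk_prefix[of ?l p e] by simp
  then show r: "e \<in> reach ?l ?b" using e by (simp add: reach_def)
  have "4 * real (esum (reach ?l ?b) e) \<le> real (card (stage_list e)) * (1 + 1 / real p) ^ ?l"
    using slack_inv[OF l r] by (simp add: stage_list_def)
  also have "\<dots> \<le> real (card (stage_list e)) * 4" by (intro mult_left_mono growth l) simp
  finally show "esum (reach ?l ?b) e \<le> card (stage_list e)" by simp
  show "card (stage_list e) \<le> 48 * p\<^sup>2"
  proof (cases "?l < p")
    case True
    then show ?thesis using blk_stopped_size[OF e] by (simp add: stage_list_def)
  next
    case False
    then have "?l = p" using l by simp
    then have "stage_list e \<subseteq> {?b}" by (auto simp: stage_list_def sub_def)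
    then have "card (stage_list e) \<le> 1" using card_mono[of "{?b}" "stage_list e"] by simp
    moreover have "1 \<le> p\<^sup>2" using p1 by simp
    ultimately show ?thesis by linarith
  qed
qed

lemma adj_reach:
  assumes e: "e \<in> H" and f: "f \<in> adj H e" and l: "fst (blk p e) \<le> fst (blk p f)"
    and c: "stage_list f \<inter> stage_list e \<noteq> {}"
  shows "f \<in> adj (reach (fst (blk p e)) (snd (blk p e))) e"
proof -
  let ?l = "fst (blk p e)" and ?b = "snd (blk p e)"
  obtain c where c: "c \<in> stage_list f" "c \<in> stage_list e" using c by blast
  have "blk ?l f = (?l, c div 2 ^ (p - ?l))" by (rule sub_prefix[OF c(1) l])
  moreover have "c div 2 ^ (p - ?l) = ?b" using c(2) by (simp add: stage_list_def sub_def)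
  ultimately show ?thesis using f by (auto simp: adj_def reach_def)
qed

lemma card_adj_reach:
  assumes e: "e \<in> H"
  shows "card (adj (reach (fst (blk p e)) (snd (blk p e))) e) < card (stage_list e)"
proof -
  have "pairs (reach (fst (blk p e)) (snd (blk p e)))" using pairs_subset[OF pairsH] by (auto simp: reach_def)
  from card_adj[OF this stage(1)[OF e]] show ?thesis using stage(2)[OF e] by linarith
qed

lemma sched_arg:
  assumes e: "e \<in> H"
  defines "F \<equiv> {f \<in> adj H e. blk p f = blk p e}"
  shows "nu e < 2 ^ tau" "nu ` F \<subseteq> {..<2 ^ tau}" "nu e \<notin> nu ` F" "card (nu ` F) \<le> 48 * p\<^sup>2"
proof -
  show "nu e < 2 ^ tau" using nu(1)[OF e] .
  show "nu ` F \<subseteq> {..<2 ^ tau}" using nu(1) by (auto simp: F_def adj_def)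
  show "nu e \<notin> nu ` F"
  proof
    assume "nu e \<in> nu ` F"
    then obtain f where f: "nu e = nu f" "f \<in> adj H e" by (auto simp: F_def)
    show False using nu(2)[OF e f(2)] f(1) by simp
  qed
  have fin: "finite (adj (reach (fst (blk p e)) (snd (blk p e))) e)" using finH by (simp add: finite_adj reach_def)
  have "F \<subseteq> adj (reach (fst (blk p e)) (snd (blk p e))) e"
  proof
    fix f assume f: "f \<in> F"
    then have "blk (fst (blk p e)) f = (fst (blk p e), snd (blk p e))"
      using blk_prefix[of "fst (blk p e)" p f] by (simp add: F_def)
    then show "f \<in> adj (reach (fst (blk p e)) (snd (blk p e))) e" using f by (auto simp: F_def adj_def reach_def)
  qed
  then have F: "card F \<le> card (adj (reach (fst (blk p e)) (snd (blk p e))) e)" "finite F"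
    using card_mono[OF fin] finite_subset[OF _ fin] by auto
  have "card (nu ` F) \<le> card F" by (rule card_image_le[OF F(2)])
  then show "card (nu ` F) \<le> 48 * p\<^sup>2" using F(1) card_adj_reach[OF e] stage(3)[OF e] by linarith
qed

lemma D1: "1 \<le> 48 * p\<^sup>2"
proof -
  have "1 \<le> p\<^sup>2" using p1 by simp
  then show ?thesis by linarith
qed

lemma sched_less: "e \<in> H \<Longrightarrow> sched e < palette (48 * p\<^sup>2) tau"
  unfolding sched_def using sched_arg by (intro recolor_less D1 tau1) auto

lemma sched_neq:
  assumes e: "e \<in> H" and f: "f \<in> adj H e" "blk p f = blk p e"
  shows "sched f \<noteq> sched e"
proof -
  have fH: "f \<in> H" using f by (simp add: adj_def)
  show ?thesis unfolding sched_def
    by (rule not_sym, rule recolor_neq[OF D1 tau1 sched_arg(1,2,3,4)[OF e] _ sched_arg(2,3,4)[OF fH]])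
      (use f in auto)
qed

lemma ckey_less: "e \<in> H \<Longrightarrow> ckey e < (p + 1) * palette (48 * p\<^sup>2) tau"
proof -
  assume e: "e \<in> H"
  have "ckey e < (p - fst (blk p e)) * palette (48 * p\<^sup>2) tau + palette (48 * p\<^sup>2) tau"
    using sched_less[OF e] by (simp add: ckey_def)
  also have "\<dots> = (p - fst (blk p e) + 1) * palette (48 * p\<^sup>2) tau" by simp
  also have "\<dots> \<le> (p + 1) * palette (48 * p\<^sup>2) tau" by (intro mult_le_mono1) simp
  finally show ?thesis .
qed

lemma key_level:
  assumes e: "e \<in> H" and f: "f \<in> H" and k: "ckey f \<le> ckey e"
  shows "fst (blk p e) \<le> fst (blk p f)"
proof (rule ccontr)
  let ?q = "palette (48 * p\<^sup>2) tau"
  assume a: "\<not> ?thesis"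
  have "fst (blk p e) \<le> p" by (rule blk_le)
  then have "p - fst (blk p e) + 1 \<le> p - fst (blk p f)" using a by linarith
  then have "(p - fst (blk p e) + 1) * ?q \<le> (p - fst (blk p f)) * ?q" by (rule mult_le_mono1)
  then have "ckey e < ckey f" using sched_less[OF e] unfolding ckey_def by simp
  then show False using k by simp
qed

lemma ccol_proper:
  shows "e \<in> H \<Longrightarrow> ccol e \<in> L e" and "e \<in> H \<Longrightarrow> f \<in> adj H e \<Longrightarrow> ccol f \<noteq> ccol e"
proof -
  have size: "card {f \<in> adj H e. ckey f < ckey e \<and> stage_list f \<inter> stage_list e \<noteq> {}} < card (stage_list e)"
    if e: "e \<in> H" for e
  proof -
    have "{f \<in> adj H e. ckey f < ckey e \<and> stage_list f \<inter> stage_list e \<noteq> {}} \<subseteq>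
      adj (reach (fst (blk p e)) (snd (blk p e))) e"
    proof
      fix f assume "f \<in> {f \<in> adj H e. ckey f < ckey e \<and> stage_list f \<inter> stage_list e \<noteq> {}}"
      then have f: "f \<in> adj H e" "ckey f < ckey e" "stage_list f \<inter> stage_list e \<noteq> {}" by auto
      have "f \<in> H" using f(1) by (simp add: adj_def)
      then show "f \<in> adj (reach (fst (blk p e)) (snd (blk p e))) e"
        using key_level[OF e _ less_imp_le[OF f(2)]] adj_reach[OF e f(1) _ f(3)] by blast
    qed
    moreover have "finite (adj (reach (fst (blk p e)) (snd (blk p e))) e)"
      using finH by (simp add: finite_adj reach_def)
    ultimately show ?thesis using le_less_trans[OF card_mono card_adj_reach[OF e]] by simp
  qed
  \<comment> \<open>Equal keys force equal levels, and a common colour then forces the same block,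
    where \<open>sched\<close> tells adjacent edges apart.\<close>
  have same: "stage_list f \<inter> stage_list e = {}" if e: "e \<in> H" and f: "f \<in> adj H e" "ckey f = ckey e" for e f
  proof (rule ccontr)
    assume c: "stage_list f \<inter> stage_list e \<noteq> {}"
    have fH: "f \<in> H" using f by (simp add: adj_def)
    have l: "fst (blk p e) = fst (blk p f)" using key_level[OF e fH] key_level[OF fH e] f(2) by simp
    have "f \<in> reach (fst (blk p e)) (snd (blk p e))" using adj_reach[OF e f(1) _ c] l by (simp add: adj_def)
    then have "blk (fst (blk p f)) f = (fst (blk p e), snd (blk p e))" using l by (simp add: reach_def)
    then have "blk p f = blk p e" using blk_prefix[of "fst (blk p f)" p f] l by (simp add: prod_eq_iff)
    then have "sched f \<noteq> sched e" by (rule sched_neq[OF e f(1)])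
    then show False using f(2) l unfolding ckey_def by simp
  qed
  have "ccol e \<in> stage_list e" if "e \<in> H" for e
    unfolding ccol_def by (rule gcol_proper(1)[OF finH size same that])
  then show "e \<in> H \<Longrightarrow> ccol e \<in> L e" by (auto simp: stage_list_def sub_def)
  show "ccol f \<noteq> ccol e" if "e \<in> H" "f \<in> adj H e"
    unfolding ccol_def by (rule gcol_proper(2)[OF finH size same that])
qed

end

text \<open>One game for each of the \<open>p\<close> levels, then one round per key value of the
  greedy colouring.\<close>

definition crad :: "nat \<Rightarrow> nat \<Rightarrow> nat" where
  "crad p tau = p * (3 * game.rounds (20 * p\<^sup>2) p + 2) + 1 + (p + 1) * palette (48 * p\<^sup>2) tau"

section \<open>Locality of the list colouring with slack\<close>

context agreement
begin

lemma sub_sim: "esim t L L' \<Longrightarrow> esim t (cls.sub L p) (cls.sub L' p)"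
  unfolding esim_def cls.sub_def by (simp add: fun_eq_iff)

lemma lowdeg_sim:
  assumes "hsim t G G'" "nsim t sd sd'" "v \<in> A (Suc t)" "e \<in> E" "v \<in> e"
  shows "game.lowdeg G sd e = game.lowdeg G' sd' e"
proof -
  have "sd w = sd' w" "inc G w = inc G' w" if "w \<in> e" for w
    using nb[OF assms(3-5) that] nsimD[OF assms(2)] hsim_inc[OF assms(1)] by blast+
  then show ?thesis unfolding game.lowdeg_def by (intro sum.cong) auto
qed

lemma offset_sim:
  assumes "hsim t G G'" "nsim t sd sd'" "esim t L L'"
  shows "esim (Suc t) (cls.offset sd L p G i b) (cls.offset sd' L' p G' i b)"
proof (rule esimI)
  fix v e assume ve: "v \<in> A (Suc t)" "e \<in> E" "v \<in> e"
  have vt: "v \<in> A t" using A_leD[OF ve(1)] by simp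
  have s: "cls.sub L p e = cls.sub L' p e" by (rule esimD[OF sub_sim[OF assms(3)] vt ve(2,3)])
  have es: "esum G e = esum G' e" by (rule esimD[OF esum_sim[OF assms(1)] ve])
  show "cls.offset sd L p G i b e = cls.offset sd' L' p G' i b e"
    unfolding cls.offset_def cls.frac_def by (simp only: s es lowdeg_sim[OF assms(1,2) ve])
qed

lemma upper_sim:
  assumes "hsim t G G'" "nsim t sd sd'" "esim t L L'"
    and v: "v \<in> A (t + (3 * game.rounds (20 * p\<^sup>2) p + 2))" and e: "e \<in> E" "v \<in> e"
  shows "e \<in> cls.upper sd L p G i b \<longleftrightarrow> e \<in> cls.upper sd' L' p G' i b"
proof -
  let ?F = "game.final G sd (cls.offset sd L p G i b) (20 * p\<^sup>2) p"
  let ?F' = "game.final G' sd' (cls.offset sd' L' p G' i b) (20 * p\<^sup>2) p"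
  have v1: "v \<in> A (Suc t)" and vt: "v \<in> A t" using A_leD[OF v] by simp_all
  have "esim (Suc t + 1 + 3 * game.rounds (20 * p\<^sup>2) p) ?F ?F'"
    by (rule game_final_sim[OF hsim_le[OF assms(1)] nsim_le[OF assms(2)] offset_sim[OF assms(1-3)]]) simp_all
  then have F: "?F e = ?F' e" by (rule esimD[OF _ _ e]) (use v in \<open>simp add: algebra_simps\<close>)
  have m: "e \<in> G \<longleftrightarrow> e \<in> G'" by (rule hsim_mem[OF assms(1) vt e(2)])
  have sd: "{w \<in> e. sd w} = {w \<in> e. sd' w}" using nb[OF v1 e] nsimD[OF assms(2)] by blast
  have "e \<in> G \<and> ?F e \<in> {w \<in> e. sd w} \<longleftrightarrow> e \<in> G' \<and> ?F' e \<in> {w \<in> e. sd' w}"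
    by (simp only: F m sd)
  then show ?thesis unfolding cls.upper_def game.red_def by simp
qed

lemma blk_sim:
  assumes H: "hsim t H H'" and S: "nsim t sd sd'" and L: "esim t L L'"
  shows "esim (t + i * (3 * game.rounds (20 * p\<^sup>2) p + 2)) (cls.blk H sd L p i) (cls.blk H' sd' L' p i)"
proof (induction i)
  case 0 then show ?case by (simp add: esim_def cls.blk.simps)
next
  case (Suc i)
  define R where "R = 3 * game.rounds (20 * p\<^sup>2) p + 2"
  define T where "T = t + i * R"
  let ?s = "cls.blk H sd L p i" and ?s' = "cls.blk H' sd' L' p i"
  have IH: "esim T ?s ?s'" using Suc.IH by (simp add: T_def R_def)
  have HT: "hsim T H H'" "nsim T sd sd'" "esim T L L'"
    using hsim_le[OF H] nsim_le[OF S] esim_le[OF L] by (simp_all add: T_def)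
  have act: "hsim T (cls.active H L p ?s i b) (cls.active H' L' p ?s' i b)" for b
    unfolding cls.active_def
  proof (rule hsim_filter[OF HT(1)])
    fix v e assume ve: "v \<in> A T" "e \<in> E" "v \<in> e"
    show "(?s e = (i, b) \<and> 48 * p\<^sup>2 < card (cls.sub L p e i b)) = (?s' e = (i, b) \<and> 48 * p\<^sup>2 < card (cls.sub L' p e i b))"
      by (simp only: esimD[OF IH ve] esimD[OF sub_sim[OF HT(3)] ve])
  qed
  have "esim (T + R) (cls.blk H sd L p (Suc i)) (cls.blk H' sd' L' p (Suc i))"
  proof (rule esimI)
    fix v e assume v: "v \<in> A (T + R)" and e: "e \<in> E" "v \<in> e"
    have vT: "v \<in> A T" using A_leD[OF v] by simp
    have s: "?s e = ?s' e" by (rule esimD[OF IH vT e])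
    have m: "e \<in> cls.active H L p ?s i b \<longleftrightarrow> e \<in> cls.active H' L' p ?s' i b" for b
      by (rule hsim_mem[OF act vT e(2)])
    have u: "e \<in> cls.upper sd L p (cls.active H L p ?s i b) i b \<longleftrightarrow> e \<in> cls.upper sd' L' p (cls.active H' L' p ?s' i b) i b" for b
      by (rule upper_sim[OF act HT(2,3) _ e]) (use v in \<open>simp add: R_def\<close>)
    show "cls.blk H sd L p (Suc i) e = cls.blk H' sd' L' p (Suc i) e"
      by (simp only: cls.blk.simps s m u)
  qed
  then show ?case by (simp add: T_def R_def algebra_simps)
qed

text \<open>The bound on the keys limits the depth of the greedy colouring; it is asked of
  \<open>H\<close> alone because the keys of the two graphs agree wherever they are
  compared.\<close>

lemma ccol_sim:
  assumes H: "hsim t H H'" and S: "nsim t sd sd'" and L: "esim t L L'" and N: "esim t nu nu'"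
    and key: "\<And>e. e \<in> H \<Longrightarrow> cls.ckey H sd L nu p tau e < (p + 1) * palette (48 * p\<^sup>2) tau"
  shows "esim (t + crad p tau) (cls.ccol H sd L nu p tau) (cls.ccol H' sd' L' nu' p tau)"
proof -
  define T where "T = t + p * (3 * game.rounds (20 * p\<^sup>2) p + 2)"
  have B: "esim T (cls.blk H sd L p p) (cls.blk H' sd' L' p p)" unfolding T_def by (rule blk_sim[OF H S L])
  have HT: "hsim T H H'" "esim T L L'" "esim T nu nu'"
    using hsim_le[OF H] esim_le[OF L] esim_le[OF N] by (simp_all add: T_def)
  have SL: "esim (Suc T) (cls.stage_list H sd L p) (cls.stage_list H' sd' L' p)"
  proof (rule esimI)
    fix v e assume v: "v \<in> A (Suc T)" and e: "e \<in> E" "v \<in> e"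
    have vT: "v \<in> A T" using A_leD[OF v] by simp
    show "cls.stage_list H sd L p e = cls.stage_list H' sd' L' p e"
      unfolding cls.stage_list_def by (simp only: esimD[OF B vT e] esimD[OF sub_sim[OF HT(2)] vT e])
  qed
  have K: "esim (Suc T) (cls.ckey H sd L nu p tau) (cls.ckey H' sd' L' nu' p tau)"
  proof (rule esimI)
    fix v e assume v: "v \<in> A (Suc T)" and e: "e \<in> E" "v \<in> e"
    have vT: "v \<in> A T" using A_leD[OF v] by simp
    have b: "cls.blk H sd L p p e = cls.blk H' sd' L' p p e" by (rule esimD[OF B vT e])
    have n: "nu e = nu' e" by (rule esimD[OF HT(3) vT e])
    have F: "{f \<in> adj H e. cls.blk H sd L p p f = cls.blk H sd L p p e} =
        {f \<in> adj H' e. cls.blk H' sd' L' p p f = cls.blk H' sd' L' p p e}"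
      unfolding adj_eq[OF HT(1) v e, symmetric]
      by (rule Collect_cong, rule conj_cong[OF refl]) (simp only: adj_esim[OF HT(1) B v e] b)
    have "nu ` {f \<in> adj H e. cls.blk H sd L p p f = cls.blk H sd L p p e} =
        nu' ` {f \<in> adj H e. cls.blk H sd L p p f = cls.blk H sd L p p e}"
      by (rule image_cong[OF refl]) (use adj_esim[OF HT(1,3) v e] in blast)
    then have "cls.sched H sd L nu p tau e = cls.sched H' sd' L' nu' p tau e"
      unfolding cls.sched_def n F by simp
    then show "cls.ckey H sd L nu p tau e = cls.ckey H' sd' L' nu' p tau e"
      unfolding cls.ckey_def b by simp
  qed
  have "esim (Suc T + (p + 1) * palette (48 * p\<^sup>2) tau) (cls.ccol H sd L nu p tau) (cls.ccol H' sd' L' nu' p tau)"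
    unfolding cls.ccol_def by (rule gcol_sim[OF hsim_le[OF HT(1)] SL K key]) simp_all
  then show ?thesis by (rule esim_le) (simp add: T_def crad_def)
qed

end

section \<open>Colouring graphs of bounded degree\<close>

definition balanced_label :: "nat set set \<Rightarrow> nat set \<Rightarrow> nat" where
  "balanced_label S = (SOME f. (\<forall>e\<in>S. f e < (32::nat)) \<and> (\<forall>i. card {e \<in> S. f e = i} \<le> card S div 32 + 1))"

text \<open>Number the elements of \<open>S\<close> and reduce modulo 32.\<close>

lemma balanced_label:
  assumes "finite S"
  shows "\<forall>e\<in>S. balanced_label S e < 32" "card {e \<in> S. balanced_label S e = i} \<le> card S div 32 + 1"
proof -
  obtain h where h: "bij_betw h S {0..<card S}" using ex_bij_betw_finite_nat[OF assms] by blast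
  let ?f = "\<lambda>e. h e mod 32"
  have "card {e \<in> S. ?f e = i} \<le> card S div 32 + 1" for i
  proof -
    have "card {e \<in> S. ?f e = i} \<le> card {0..card S div 32}"
    proof (rule card_inj_on_le[where f = "\<lambda>e. h e div 32"])
      show "inj_on (\<lambda>e. h e div 32) {e \<in> S. ?f e = i}"
      proof (rule inj_onI)
        fix x y assume a: "x \<in> {e \<in> S. ?f e = i}" "y \<in> {e \<in> S. ?f e = i}" "h x div 32 = h y div 32"
        then have "h x = h y" by (metis (mono_tags, lifting) div_mult_mod_eq mem_Collect_eq)
        then show "x = y" using h a by (auto simp: bij_betw_def inj_on_def)
      qed
      show "(\<lambda>e. h e div 32) ` {e \<in> S. ?f e = i} \<subseteq> {0..card S div 32}"
      proof
        fix y assume "y \<in> (\<lambda>e. h e div 32) ` {e \<in> S. ?f e = i}"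
        then obtain e where e: "e \<in> S" "y = h e div 32" by blast
        have "h e < card S" using h e(1) by (auto simp: bij_betw_def)
        then show "y \<in> {0..card S div 32}" using e(2) by (simp add: div_le_mono less_imp_le)
      qed
    qed simp
    then show ?thesis by simp
  qed
  then have "\<exists>f. (\<forall>e\<in>S. f e < (32::nat)) \<and> (\<forall>i. card {e \<in> S. f e = i} \<le> card S div 32 + 1)"
    by (intro exI[of _ ?f]) simp
  from someI_ex[OF this] show "\<forall>e\<in>S. balanced_label S e < 32"
    "card {e \<in> S. balanced_label S e = i} \<le> card S div 32 + 1"
    unfolding balanced_label_def by blast+
qed

text \<open>Colour 0 marks an edge that is not coloured yet.\<close>

locale loop =
  fixes T :: "nat set set" and chi :: "nat \<Rightarrow> nat" and w p :: nat
begin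

definition unc :: "(nat set \<Rightarrow> nat) \<Rightarrow> nat set set" where
  "unc c = {e \<in> T. c e = 0}"

definition avail :: "(nat set \<Rightarrow> nat) \<Rightarrow> nat set \<Rightarrow> nat set" where
  "avail c e = {1..card (adj T e) + 1} - c ` adj T e"

text \<open>An initial edge colouring with \<open>2 * w\<close> bits: the unordered pair of the
  colours of the ends, written in base \<open>2 ^ w\<close>.\<close>

definition nu :: "nat set \<Rightarrow> nat" where
  "nu e = Min (chi ` e) * 2 ^ w + Max (chi ` e)"

definition side :: "nat \<Rightarrow> nat \<Rightarrow> bool" where
  "side b v \<longleftrightarrow> odd (chi v div 2 ^ b)"

text \<open>Edges with the same value form a bipartite graph with sides given by
  \<open>side\<close>, so the \<open>w\<close> bits of \<open>chi\<close> supply the bipartite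
  graphs that the token game needs.\<close>

definition dbit :: "nat set \<Rightarrow> nat" where
  "dbit e = (LEAST b. \<exists>u\<in>e. \<exists>v\<in>e. side b u \<and> \<not> side b v)"

text \<open>The sum has a single term. Each end spreads its edges evenly over 32 labels and an edge
  carries the labels of both ends, which gives \<open>32 * 32 = 1024\<close> classes per
  bit.\<close>

definition lab :: "nat set set \<Rightarrow> bool \<Rightarrow> nat set \<Rightarrow> nat" where
  "lab U s e = (\<Sum>v\<in>{v \<in> e. side (dbit e) v = s}. balanced_label (inc U v) e)"

definition cl :: "nat set set \<Rightarrow> nat set \<Rightarrow> nat" where
  "cl U e = (dbit e * 32 + lab U True e) * 32 + lab U False e"

text \<open>Edges whose uncoloured degree has already been halved wait for the next round, since
  their remaining list may be too short for slack 4.\<close>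

definition part :: "nat set set \<Rightarrow> nat \<Rightarrow> nat \<Rightarrow> (nat set \<Rightarrow> nat) \<Rightarrow> nat set set" where
  "part U D k c = {e \<in> unc c. cl U e = k \<and> D < 2 * card (adj (unc c) e)}"

primrec sweep :: "nat set set \<Rightarrow> nat \<Rightarrow> (nat set \<Rightarrow> nat) \<Rightarrow> nat \<Rightarrow> nat set \<Rightarrow> nat" where
  "sweep U D c 0 = c"
| "sweep U D c (Suc k) = (\<lambda>e. if e \<in> part U D k (sweep U D c k)
     then cls.ccol (part U D k (sweep U D c k)) (side (k div 1024)) (avail (sweep U D c k)) nu p (2 * w) e
     else sweep U D c k e)"

primrec rnd :: "nat \<Rightarrow> nat set \<Rightarrow> nat" where
  "rnd 0 = (\<lambda>e. 0)"
| "rnd (Suc j) = sweep (unc (rnd j)) (2 ^ (p - j)) (rnd j) (w * 1024)"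

definition fkey :: "nat set set \<Rightarrow> nat set \<Rightarrow> nat" where
  "fkey U e = recolor 32 (2 * w) (nu e) (nu ` adj U e)"

text \<open>The halving stops after \<open>p - 5\<close> rounds, at degree
  \<open>2 ^ 5 = 32\<close>; the rest is coloured greedily along a colouring with constant
  degree.\<close>

definition tcol :: "nat set \<Rightarrow> nat" where
  "tcol e = (let c = rnd (p - 5) in
     if e \<in> unc c then gcol (unc c) (avail c) (fkey (unc c)) e else c e)"

definition partial :: "(nat set \<Rightarrow> nat) \<Rightarrow> bool" where
  "partial c \<longleftrightarrow> (\<forall>e\<in>T. c e \<noteq> 0 \<longrightarrow> c e \<le> card (adj T e) + 1 \<and> (\<forall>f\<in>adj T e. c f \<noteq> c e))"

end

locale loop_ok = loop +
  assumes pairsT: "pairs T" and w1: "1 \<le> w" and p5: "5 \<le> p"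
    and degT: "\<And>e. e \<in> T \<Longrightarrow> card (adj T e) + 1 < 2 ^ p"
    and chi_less: "\<And>e v. e \<in> T \<Longrightarrow> v \<in> e \<Longrightarrow> chi v < 2 ^ w"
    and chi_neq: "\<And>e f u v. e \<in> T \<Longrightarrow> f \<in> T \<Longrightarrow> e \<inter> f \<noteq> {} \<Longrightarrow> u \<in> e \<Longrightarrow> v \<in> f \<Longrightarrow> u \<noteq> v \<Longrightarrow> chi u \<noteq> chi v"
begin

lemma finT: "finite T" using pairsT by (simp add: pairs_def)
lemma c2: "e \<in> T \<Longrightarrow> card e = 2" using pairsT by (simp add: pairs_def)

lemma unc_sub: "unc c \<subseteq> T" by (auto simp: unc_def)
lemma fin_unc: "finite (unc c)" using finite_subset[OF unc_sub finT] .
lemma part_sub: "part U D k c \<subseteq> unc c" "part U D k c \<subseteq> T" using unc_sub by (auto simp: part_def)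

lemma ends2: assumes "e \<in> T" obtains a b where "e = {a, b}" "a \<noteq> b" "chi a \<noteq> chi b"
proof -
  obtain a b where ab: "e = {a, b}" "a \<noteq> b" using c2[OF assms] by (auto simp: card_2_iff)
  have "chi a \<noteq> chi b" by (rule chi_neq[OF assms assms]) (use ab in auto)
  then show thesis using that ab by blast
qed

lemma nu_less: assumes "e \<in> T" shows "nu e < 2 ^ (2 * w)"
proof -
  obtain a b where ab: "e = {a, b}" using ends2[OF assms] by metis
  have l: "chi a < 2 ^ w" "chi b < 2 ^ w" using chi_less[OF assms] ab by auto
  have m: "Min (chi ` e) < 2 ^ w" "Max (chi ` e) < 2 ^ w" using l ab by auto
  have "nu e < Min (chi ` e) * 2 ^ w + 2 ^ w" unfolding nu_def using m(2) by simp
  also have "\<dots> = (Min (chi ` e) + 1) * 2 ^ w" by simp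
  also have "\<dots> \<le> 2 ^ w * 2 ^ w" using m(1) by (intro mult_le_mono1) simp
  finally show ?thesis by (simp add: mult_2 power_add)
qed

text \<open>Equal values mean that the ends carry the same set of colours, and \<open>chi\<close> is
  injective on the union of two touching edges, so the edges would coincide.\<close>

lemma nu_neq: assumes e: "e \<in> T" and f: "f \<in> adj T e" shows "nu f \<noteq> nu e"
proof
  assume eq: "nu f = nu e"
  have fT: "f \<in> T" "f \<noteq> e" "e \<inter> f \<noteq> {}" using f by (auto simp: adj_def)
  have mm: "chi ` g = {Min (chi ` g), Max (chi ` g)}" "Max (chi ` g) < 2 ^ w" if g: "g \<in> T" for g
  proof -
    obtain a b where ab: "g = {a, b}" using ends2[OF g] by metis
    show "chi ` g = {Min (chi ` g), Max (chi ` g)}" unfolding ab by (auto simp: min_def max_def)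
    show "Max (chi ` g) < 2 ^ w" using chi_less[OF g] ab by auto
  qed
  have dm: "(a * 2 ^ w + b) div 2 ^ w = a" "(a * 2 ^ w + b) mod 2 ^ w = b" if "b < 2 ^ w" for a b :: nat
    using that by simp_all
  have "Min (chi ` f) = nu f div 2 ^ w" "Max (chi ` f) = nu f mod 2 ^ w"
    unfolding nu_def using dm[OF mm(2)[OF fT(1)]] by simp_all
  moreover have "Min (chi ` e) = nu e div 2 ^ w" "Max (chi ` e) = nu e mod 2 ^ w"
    unfolding nu_def using dm[OF mm(2)[OF e]] by simp_all
  ultimately have "Min (chi ` f) = Min (chi ` e)" "Max (chi ` f) = Max (chi ` e)" using eq by simp_all
  then have "chi ` f = {Min (chi ` e), Max (chi ` e)}" by (subst mm(1)[OF fT(1)]) simp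
  also have "\<dots> = chi ` e" by (rule mm(1)[OF e, symmetric])
  finally have img: "chi ` f = chi ` e" .
  have "u \<in> f" if "u \<in> e" for u
  proof -
    have "chi u \<in> chi ` f" unfolding img using that by (rule imageI)
    then obtain v where v: "v \<in> f" "chi u = chi v" by (rule imageE) blast
    then show ?thesis using chi_neq[OF e fT(1,3) that v(1)] by metis
  qed
  moreover have "u \<in> e" if "u \<in> f" for u
  proof -
    have "chi u \<in> chi ` e" unfolding img[symmetric] using that by (rule imageI)
    then obtain v where v: "v \<in> e" "chi u = chi v" by (rule imageE) blast
    then show ?thesis using chi_neq[OF e fT(1,3) v(1) that] by metis
  qed
  ultimately show False using fT(2) by blast
qed

lemma dbit: assumes e: "e \<in> T" shows "dbit e < w" "\<And>v. v \<in> e \<Longrightarrow> side (dbit e) (other e v) = (\<not> side (dbit e) v)"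
proof -
  obtain a b where ab: "e = {a, b}" "a \<noteq> b" "chi a \<noteq> chi b" using ends2[OF e] .
  obtain i where "odd (chi a div 2 ^ i) \<noteq> odd (chi b div 2 ^ i)"
    using ab(3) bit_eq_iff[of "chi a" "chi b"] unfolding bit_iff_odd by blast
  then have ex: "\<exists>u\<in>e. \<exists>v\<in>e. side i u \<and> \<not> side i v" unfolding side_def using ab(1) by blast
  have D: "\<exists>u\<in>e. \<exists>v\<in>e. side (dbit e) u \<and> \<not> side (dbit e) v" unfolding dbit_def
    by (rule LeastI[of "\<lambda>b. \<exists>u\<in>e. \<exists>v\<in>e. side b u \<and> \<not> side b v", OF ex])
  then obtain u v where uv: "u \<in> e" "v \<in> e" "side (dbit e) u" "\<not> side (dbit e) v" by blast
  show "dbit e < w"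
  proof (rule ccontr)
    assume "\<not> dbit e < w"
    then have "(2::nat) ^ w \<le> 2 ^ dbit e" by (intro power_increasing) auto
    then have "chi u < 2 ^ dbit e" using chi_less[OF e uv(1)] by linarith
    then show False using uv(3) by (simp add: side_def)
  qed
  show "side (dbit e) (other e x) = (\<not> side (dbit e) x)" if "x \<in> e" for x
  proof -
    have "x = u \<or> x = v" using that uv ab(1) by auto
    moreover have "other e u = v" "other e v = u"
      using other_unique[OF c2[OF e] uv(1,2)] other_unique[OF c2[OF e] uv(2,1)] uv(3,4) by metis+
    ultimately show ?thesis using uv by auto
  qed
qed

lemma lab_eq:
  assumes e: "e \<in> T" and v: "v \<in> e"
  shows "lab U (side (dbit e) v) e = balanced_label (inc U v) e"
proof -
  have "{x \<in> e. side (dbit e) x = side (dbit e) v} = {v}"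
    using dbit(2)[OF e v] other_unique[OF c2[OF e] v] v by auto
  then show ?thesis unfolding lab_def by simp
qed

lemma lab_less: assumes "finite U" "e \<in> U" "U \<subseteq> T" shows "lab U s e < 32"
proof -
  have e: "e \<in> T" using assms by blast
  obtain v where v: "v \<in> e" "side (dbit e) v = s"
  proof -
    obtain x where x: "x \<in> e" using c2[OF e] by fastforce
    show thesis
    proof (cases "side (dbit e) x = s")
      case True then show thesis using that x by blast
    next
      case False
      then have "side (dbit e) (other e x) = s" using dbit(2)[OF e x] by auto
      then show thesis using that other_pair(3)[OF c2[OF e] x] by blast
    qed
  qed
  have "e \<in> inc U v" using assms(2) v by (simp add: inc_def)
  then show ?thesis using lab_eq[OF e v(1), of U] v(2) balanced_label(1)[OF finite_inc[OF assms(1)], of v] by simp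
qed

lemma cl_decode:
  assumes "finite U" "e \<in> U" "U \<subseteq> T"
  shows "cl U e div 1024 = dbit e" "cl U e div 32 mod 32 = lab U True e" "cl U e mod 32 = lab U False e"
    "cl U e < w * 1024"
proof -
  have l: "lab U True e < 32" "lab U False e < 32" using lab_less[OF assms] by auto
  have "cl U e div 32 = dbit e * 32 + lab U True e" unfolding cl_def using l by simp
  moreover have "cl U e div 1024 = cl U e div 32 div 32" by (simp flip: div_mult2_eq)
  ultimately show "cl U e div 1024 = dbit e" "cl U e div 32 mod 32 = lab U True e" using l by simp_all
  show "cl U e mod 32 = lab U False e" unfolding cl_def mod_mult_self3 using l by simp
  have "dbit e + 1 \<le> w" using dbit(1)[of e] assms by (auto simp: Suc_le_eq)
  then have "dbit e * 1024 + 1024 \<le> w * 1024" by simp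
  moreover have "lab U True e \<le> 31" "lab U False e \<le> 31" using l by simp_all
  moreover have "cl U e = dbit e * 1024 + lab U True e * 32 + lab U False e" unfolding cl_def by simp
  ultimately show "cl U e < w * 1024" by linarith
qed

lemma avail_card:
  assumes "e \<in> T"
  shows "card (adj (unc c) e) + 1 \<le> card (avail c e)"
proof -
  let ?F = "{f \<in> adj T e. c f \<noteq> 0}"
  have fa: "finite (adj T e)" using finT by (rule finite_adj)
  have F: "adj T e = ?F \<union> adj (unc c) e" "?F \<inter> adj (unc c) e = {}" by (auto simp: adj_def unc_def)
  have "finite ?F" "finite (adj (unc c) e)" using fa finite_adj[OF fin_unc] by auto
  then have "card (adj T e) = card ?F + card (adj (unc c) e)"
    using card_Un_disjoint[of ?F "adj (unc c) e"] F by simp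
  \<comment> \<open>The colour 0 of the uncoloured neighbours lies outside the range, so only
    coloured neighbours take something away.\<close>
  moreover have "avail c e = {1..card (adj T e) + 1} - c ` ?F" unfolding avail_def by force
  moreover have "card {1..card (adj T e) + 1} - card (c ` ?F) \<le> card ({1..card (adj T e) + 1} - c ` ?F)"
    using \<open>finite ?F\<close> by (intro diff_card_le_card_Diff) simp
  moreover have "card (c ` ?F) \<le> card ?F" using \<open>finite ?F\<close> by (rule card_image_le)
  ultimately show ?thesis by simp
qed

lemma extend:
  assumes P: "partial c" and Q: "Q \<subseteq> unc c"
    and g: "\<And>e. e \<in> Q \<Longrightarrow> g e \<in> avail c e" "\<And>e f. e \<in> Q \<Longrightarrow> f \<in> adj Q e \<Longrightarrow> g f \<noteq> g e"
  shows "partial (\<lambda>e. if e \<in> Q then g e else c e)"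
  unfolding partial_def
proof (intro ballI impI conjI)
  let ?c = "\<lambda>e. if e \<in> Q then g e else c e"
  fix e assume e: "e \<in> T" and nz: "?c e \<noteq> 0"
  show "?c e \<le> card (adj T e) + 1"
  proof (cases "e \<in> Q")
    case True then show ?thesis using g(1) by (auto simp: avail_def)
  next
    case False then show ?thesis using P e nz by (simp add: partial_def)
  qed
  fix f assume f: "f \<in> adj T e"
  then have f': "f \<in> T" "e \<in> adj T f" using e by (auto simp: adj_def)
  consider "e \<in> Q" "f \<in> Q" | "e \<in> Q" "f \<notin> Q" | "e \<notin> Q" "f \<in> Q" | "e \<notin> Q" "f \<notin> Q" by blast
  then show "?c f \<noteq> ?c e"
  proof cases
    case 1
    then have "f \<in> adj Q e" using f by (simp add: adj_def)
    then show ?thesis using g(2) 1 by simp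
  next
    case 2
    then have "g e \<notin> c ` adj T e" using g(1) by (simp add: avail_def)
    then have "c f \<noteq> g e" using f by (metis imageI)
    then show ?thesis using 2 by simp
  next
    case 3
    then have "g f \<notin> c ` adj T f" using g(1) by (simp add: avail_def)
    then have "c e \<noteq> g f" using f'(2) by (metis imageI)
    then show ?thesis using 3 by simp
  next
    case 4
    then show ?thesis using P e nz f by (simp add: partial_def)
  qed
qed

text \<open>In one class a node keeps a \<open>1 / 32\<close> share of its edges plus one, so four
  times the degree of an edge is about \<open>D / 8 + 8\<close>, while its list is longer than
  \<open>D / 2\<close>. From \<open>D = 32\<close> on this is enough.\<close>

lemma part_ok:
  assumes U: "U \<subseteq> T" "unc c \<subseteq> U" and D: "32 \<le> D" "\<And>e. e \<in> U \<Longrightarrow> card (adj U e) \<le> D"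
  shows "cls_ok (part U D k c) (side (k div 1024)) (avail c) nu p (2 * w)"
proof
  let ?H = "part U D k c"
  have finU: "finite U" using finite_subset[OF U(1) finT] .
  have HU: "e \<in> U" "e \<in> T" if "e \<in> ?H" for e using that part_sub U by blast+
  have cl: "cl U e = k" if "e \<in> ?H" for e using that by (simp add: part_def)
  have db: "dbit e = k div 1024" if "e \<in> ?H" for e
    using cl_decode(1)[OF finU HU(1)[OF that] U(1)] cl[OF that] by simp
  show pH: "pairs ?H" using pairs_subset[OF pairsT part_sub(2)] .
  show "1 \<le> p" using p5 by simp
  show "1 \<le> 2 * w" using w1 by simp
  show "side (k div 1024) (other e v) = (\<not> side (k div 1024) v)" if "e \<in> ?H" "v \<in> e" for e v
    using dbit(2)[OF HU(2)[OF that(1)] that(2)] db[OF that(1)] by simp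
  show "avail c e \<subseteq> {..<2 ^ p}" if "e \<in> ?H" for e
    using degT[OF HU(2)[OF that]] by (auto simp: avail_def)
  show "nu e < 2 ^ (2 * w)" if "e \<in> ?H" for e using nu_less[OF HU(2)[OF that]] .
  show "nu f \<noteq> nu e" if "e \<in> ?H" "f \<in> adj ?H e" for e f
    using nu_neq[OF HU(2)[OF that(1)]] adj_mono[OF part_sub(2)] that(2) by blast
  show "4 * esum ?H e \<le> card (avail c e)" if e: "e \<in> ?H" for e
  proof -
    have deg: "card (inc ?H v) \<le> card (inc U v) div 32 + 1" if v: "v \<in> e" for v
    proof -
      have "inc ?H v \<subseteq> {f \<in> inc U v. balanced_label (inc U v) f = balanced_label (inc U v) e}"
      proof
        fix f assume "f \<in> inc ?H v"
        then have f: "f \<in> ?H" "v \<in> f" by (auto simp: inc_def)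
        \<comment> \<open>All edges of the class at \<open>v\<close> have \<open>v\<close> on the
          same side, so the label they have in common on that side is the one given by
          \<open>v\<close> itself.\<close>
        have s: "side (dbit f) v = side (dbit e) v" using db[OF f(1)] db[OF e] by simp
        have "lab U s f = lab U s e" for s
        proof (cases s)
          case True
          then show ?thesis using cl_decode(2)[OF finU HU(1)[OF f(1)] U(1)] cl_decode(2)[OF finU HU(1)[OF e] U(1)]
            cl[OF f(1)] cl[OF e] by simp
        next
          case False
          then show ?thesis using cl_decode(3)[OF finU HU(1)[OF f(1)] U(1)] cl_decode(3)[OF finU HU(1)[OF e] U(1)]
            cl[OF f(1)] cl[OF e] by simp
        qed
        then have "balanced_label (inc U v) f = balanced_label (inc U v) e"
          using lab_eq[OF HU(2)[OF f(1)] f(2), of U] lab_eq[OF HU(2)[OF e] v, of U] s by simp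
        then show "f \<in> {f \<in> inc U v. balanced_label (inc U v) f = balanced_label (inc U v) e}"
          using f HU(1)[OF f(1)] by (simp add: inc_def)
      qed
      then have "card (inc ?H v) \<le> card {f \<in> inc U v. balanced_label (inc U v) f = balanced_label (inc U v) e}"
        using finite_inc[OF finU] by (intro card_mono) auto
      then show ?thesis using balanced_label(2)[OF finite_inc[OF finU], of v] le_trans by blast
    qed
    obtain a b where ab: "e = {a, b}" "a \<noteq> b" using ends2[OF HU(2)[OF e]] by metis
    have es: "esum G e = card (inc G a) + card (inc G b)" for G unfolding esum_def using ab by simp
    have d: "32 * card (inc ?H v) \<le> card (inc U v) + 32" if "v \<in> e" for v
      using deg[OF that] times_div_less_eq_dividend[of 32 "card (inc U v)"] by linarith
    have 1: "32 * esum ?H e \<le> esum U e + 64" using d[of a] d[of b] ab unfolding es by simp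
    have 2: "esum U e \<le> D + 2"
      using card_adj[OF pairs_subset[OF pairsT U(1)] HU(1)[OF e]] D(2)[OF HU(1)[OF e]] by simp
    have "D < 2 * card (adj (unc c) e)" using e by (simp add: part_def)
    then have 3: "D + 1 \<le> 2 * (card (avail c e) - 1)" "1 \<le> card (avail c e)"
      using avail_card[OF HU(2)[OF e], of c] by linarith+
    show ?thesis using 1 2 3 D(1) by linarith
  qed
qed

text \<open>At its turn an edge either gets a colour or has at most \<open>D / 2\<close> uncoloured
  neighbours already, and this number never grows.\<close>

lemma sweep_inv:
  assumes D: "32 \<le> D" "\<And>e. e \<in> unc c \<Longrightarrow> card (adj (unc c) e) \<le> D" and c: "partial c"
  shows "partial (sweep (unc c) D c k) \<and> unc (sweep (unc c) D c k) \<subseteq> unc c \<and>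
    (\<forall>e\<in>unc (sweep (unc c) D c k). cl (unc c) e < k \<longrightarrow> 2 * card (adj (unc (sweep (unc c) D c k)) e) \<le> D)"
proof (induction k)
  case 0 then show ?case using c by simp
next
  case (Suc k)
  let ?c = "sweep (unc c) D c k" and ?c' = "sweep (unc c) D c (Suc k)" and ?Q = "part (unc c) D k (sweep (unc c) D c k)"
  have IH: "partial ?c" "unc ?c \<subseteq> unc c"
    "\<And>e. e \<in> unc ?c \<Longrightarrow> cl (unc c) e < k \<Longrightarrow> 2 * card (adj (unc ?c) e) \<le> D" using Suc.IH by auto
  interpret q: cls_ok ?Q "side (k div 1024)" "avail ?c" nu p "2 * w"
    by (rule part_ok[OF unc_sub IH(2) D])
  have c'_eq: "?c' = (\<lambda>e. if e \<in> ?Q then q.ccol e else ?c e)" by simp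
  have P: "partial ?c'" unfolding c'_eq by (rule extend[OF IH(1) part_sub(1) q.ccol_proper])
  have pos: "0 < q.ccol e" if "e \<in> ?Q" for e using q.ccol_proper(1)[OF that] by (auto simp: avail_def)
  have "f \<in> unc ?c' \<longleftrightarrow> f \<in> unc ?c - ?Q" for f
  proof (cases "f \<in> ?Q")
    case True
    then have "?c' f \<noteq> 0" using pos[OF True] by simp
    then show ?thesis using True by (simp add: unc_def del: sweep.simps)
  next
    case False
    then have "?c' f = ?c f" by simp
    then show ?thesis using False by (simp add: unc_def del: sweep.simps)
  qed
  then have u: "unc ?c' = unc ?c - ?Q" by blast
  have "2 * card (adj (unc ?c') e) \<le> D" if e: "e \<in> unc ?c'" "cl (unc c) e < Suc k" for e
  proof -
    have "card (adj (unc ?c') e) \<le> card (adj (unc ?c) e)"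
      using u by (intro card_mono finite_adj fin_unc adj_mono) auto
    moreover have "2 * card (adj (unc ?c) e) \<le> D"
    proof (cases "cl (unc c) e < k")
      case True then show ?thesis using IH(3) e(1) u by blast
    next
      case False
      then have "cl (unc c) e = k" using e(2) by simp
      moreover have "e \<notin> ?Q" "e \<in> unc ?c" using e(1) u by auto
      ultimately show ?thesis unfolding part_def by auto
    qed
    ultimately show ?thesis by linarith
  qed
  then show ?case using P u IH(2) by blast
qed

lemma rnd_inv:
  "j \<le> p - 5 \<Longrightarrow> partial (rnd j) \<and> (\<forall>e\<in>unc (rnd j). card (adj (unc (rnd j)) e) \<le> 2 ^ (p - j))"
proof (induction j)
  case 0
  have "card (adj (unc (\<lambda>e. 0)) e) \<le> 2 ^ p" if "e \<in> T" for e
    using degT[OF that] by (simp add: unc_def)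
  then show ?case by (simp add: partial_def unc_def)
next
  case (Suc j)
  let ?D = "2 ^ (p - j) :: nat"
  have j: "p - j = Suc (p - Suc j)" "5 \<le> p - Suc j" using Suc.prems p5 by linarith+
  have IH: "partial (rnd j)" "\<And>e. e \<in> unc (rnd j) \<Longrightarrow> card (adj (unc (rnd j)) e) \<le> ?D" using Suc by auto
  have "(2::nat) ^ 5 \<le> 2 ^ (p - j)" using j by (intro power_increasing) auto
  then have D: "32 \<le> ?D" by simp
  note s = sweep_inv[OF D IH(2,1), of "w * 1024"]
  have "card (adj (unc (rnd (Suc j))) e) \<le> 2 ^ (p - Suc j)" if e: "e \<in> unc (rnd (Suc j))" for e
  proof -
    have "e \<in> unc (rnd j)" using s e by auto
    then have "cl (unc (rnd j)) e < w * 1024" by (rule cl_decode(4)[OF fin_unc _ unc_sub])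
    then have "2 * card (adj (unc (rnd (Suc j))) e) \<le> ?D" using s e by auto
    then show ?thesis unfolding j(1) by simp
  qed
  then show ?case using s by auto
qed

lemma final_ok:
  defines "U \<equiv> unc (rnd (p - 5))"
  shows "e \<in> U \<Longrightarrow> fkey U e < palette 32 (2 * w)"
    and "e \<in> U \<Longrightarrow> f \<in> adj U e \<Longrightarrow> fkey U f \<noteq> fkey U e"
proof -
  have UT: "U \<subseteq> T" unfolding U_def by (rule unc_sub)
  have a: "nu e < 2 ^ (2 * w)" "nu ` adj U e \<subseteq> {..<2 ^ (2 * w)}" "nu e \<notin> nu ` adj U e" "card (nu ` adj U e) \<le> 32"
    if e: "e \<in> U" for e
  proof -
    have eT: "e \<in> T" using e UT by blast
    show "nu e < 2 ^ (2 * w)" using nu_less[OF eT] .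
    show "nu ` adj U e \<subseteq> {..<2 ^ (2 * w)}" using nu_less UT by (auto simp: adj_def)
    show "nu e \<notin> nu ` adj U e"
    proof
      assume "nu e \<in> nu ` adj U e"
      then obtain f where "f \<in> adj U e" "nu f = nu e" by auto
      then show False using nu_neq[OF eT] adj_mono[OF UT] by blast
    qed
    have "card (adj U e) \<le> 2 ^ (p - (p - 5))" using rnd_inv[of "p - 5"] e unfolding U_def by blast
    then have "card (adj U e) \<le> 32" using p5 by simp
    moreover have "card (nu ` adj U e) \<le> card (adj U e)"
      by (intro card_image_le finite_adj) (simp add: U_def fin_unc)
    ultimately show "card (nu ` adj U e) \<le> 32" by simp
  qed
  have w2: "1 \<le> 2 * w" "1 \<le> (32::nat)" using w1 by simp_all
  show "e \<in> U \<Longrightarrow> fkey U e < palette 32 (2 * w)"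
    unfolding fkey_def by (rule recolor_less[OF w2(2,1)]) (use a in auto)
  assume e: "e \<in> U" and f: "f \<in> adj U e"
  then have fU: "f \<in> U" by (simp add: adj_def)
  show "fkey U f \<noteq> fkey U e" unfolding fkey_def
    by (rule not_sym, rule recolor_neq[OF w2(2,1) a(1-4)[OF e] _ a(2-4)[OF fU]]) (use f in simp)
qed

theorem tcol_proper:
  assumes "e \<in> T"
  shows "1 \<le> tcol e" "tcol e \<le> card (adj T e) + 1" "\<And>f. f \<in> adj T e \<Longrightarrow> tcol f \<noteq> tcol e"
proof -
  define c where "c = rnd (p - 5)"
  define U where "U = unc c"
  define h where "h = gcol U (avail c) (fkey U)"
  have P: "partial c" using rnd_inv[of "p - 5"] by (simp add: c_def)
  have UT: "U \<subseteq> T" unfolding U_def by (rule unc_sub)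
  have size: "card {f \<in> adj U e. fkey U f < fkey U e \<and> avail c f \<inter> avail c e \<noteq> {}} < card (avail c e)" if "e \<in> U" for e
  proof -
    have "card {f \<in> adj U e. fkey U f < fkey U e \<and> avail c f \<inter> avail c e \<noteq> {}} \<le> card (adj U e)"
      by (intro card_mono finite_adj) (auto simp: U_def fin_unc)
    then show ?thesis using avail_card[of e c] that UT unfolding U_def by fastforce
  qed
  have same: "avail c f \<inter> avail c e = {}" if "e \<in> U" "f \<in> adj U e" "fkey U f = fkey U e" for e f
    using final_ok(2)[of e f] that unfolding U_def c_def by blast
  have fin: "finite U" unfolding U_def by (rule fin_unc)
  have g: "e \<in> U \<Longrightarrow> h e \<in> avail c e" "e \<in> U \<Longrightarrow> f \<in> adj U e \<Longrightarrow> h f \<noteq> h e" for e f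
    unfolding h_def using gcol_proper[OF fin size same] by blast+
  have t: "tcol = (\<lambda>e. if e \<in> U then h e else c e)" unfolding tcol_def Let_def c_def U_def h_def by auto
  have P': "partial tcol" unfolding t by (rule extend[OF P _ g]) (simp_all add: U_def)
  show 1: "1 \<le> tcol e"
  proof (cases "e \<in> U")
    case True then show ?thesis using g(1) by (auto simp: t avail_def)
  next
    case False then show ?thesis using assms by (auto simp: t U_def unc_def)
  qed
  show "tcol e \<le> card (adj T e) + 1" "\<And>f. f \<in> adj T e \<Longrightarrow> tcol f \<noteq> tcol e"
    using P' assms 1 unfolding partial_def by auto
qed

end

definition lrad :: "nat \<Rightarrow> nat \<Rightarrow> nat" where
  "lrad w p = (p - 5) * (w * 1024 * (crad p (2 * w) + 1)) + 2 + palette 32 (2 * w)"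

section \<open>Locality of the colouring of bounded-degree graphs\<close>

context agreement
begin

lemma nu_sim: assumes "nsim t chi chi'" shows "esim (Suc t) (loop.nu chi w) (loop.nu chi' w)"
  unfolding loop.nu_def using nsim_image[OF assms] by (auto simp: esim_def)

lemma side_sim: "nsim t chi chi' \<Longrightarrow> nsim t (loop.side chi b) (loop.side chi' b)"
  unfolding nsim_def loop.side_def by simp

lemma dbit_sim: assumes "nsim t chi chi'" shows "esim (Suc t) (loop.dbit chi) (loop.dbit chi')"
proof (rule esimI)
  fix v e assume ve: "v \<in> A (Suc t)" "e \<in> E" "v \<in> e"
  have "loop.side chi b u = loop.side chi' b u" if "u \<in> e" for u b
    using nsimD[OF side_sim[OF assms]] nb[OF ve that] by blast
  then show "loop.dbit chi e = loop.dbit chi' e" unfolding loop.dbit_def by simp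
qed

lemma cl_sim:
  assumes "nsim t chi chi'" "hsim t U U'"
  shows "esim (Suc t) (loop.cl chi U) (loop.cl chi' U')"
proof (rule esimI)
  fix v e assume ve: "v \<in> A (Suc t)" "e \<in> E" "v \<in> e"
  have d: "loop.dbit chi e = loop.dbit chi' e" by (rule esimD[OF dbit_sim[OF assms(1)] ve])
  have s: "loop.side chi b u = loop.side chi' b u" "inc U u = inc U' u" if "u \<in> e" for u b
    using nsimD[OF side_sim[OF assms(1)]] hsim_inc[OF assms(2)] nb[OF ve that] by blast+
  have "loop.lab chi U z e = loop.lab chi' U' z e" for z
    unfolding loop.lab_def d using s by (intro sum.cong) auto
  then show "loop.cl chi U e = loop.cl chi' U' e" unfolding loop.cl_def d by simp
qed

lemma unc_sim: "hsim t T T' \<Longrightarrow> esim t c c' \<Longrightarrow> hsim t (loop.unc T c) (loop.unc T' c')"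
  unfolding loop.unc_def by (rule hsim_filter) (auto dest: esimD)

lemma avail_sim:
  assumes "hsim t T T'" "esim t c c'"
  shows "esim (Suc t) (loop.avail T c) (loop.avail T' c')"
proof (rule esimI)
  fix v e assume ve: "v \<in> A (Suc t)" "e \<in> E" "v \<in> e"
  have "c ` adj T e = c' ` adj T' e" by (rule esimD[OF adj_image_sim[OF assms] ve])
  then show "loop.avail T c e = loop.avail T' c' e" unfolding loop.avail_def
    using adj_eq[OF assms(1) ve] by simp
qed

lemma part_sim:
  assumes "nsim t chi chi'" "hsim t U U'" "hsim t T T'" "esim t c c'"
  shows "hsim (Suc t) (loop.part T chi U D k c) (loop.part T' chi' U' D k c')"
  unfolding loop.part_def
proof (rule hsim_filter[OF hsim_le[OF unc_sim[OF assms(3,4)]]])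
  fix v e assume ve: "v \<in> A (Suc t)" "e \<in> E" "v \<in> e"
  show "(loop.cl chi U e = k \<and> D < 2 * card (adj (loop.unc T c) e)) =
    (loop.cl chi' U' e = k \<and> D < 2 * card (adj (loop.unc T' c') e))"
    by (simp only: esimD[OF cl_sim[OF assms(1,2)] ve] adj_eq[OF unc_sim[OF assms(3,4)] ve])
qed simp

lemma sweep_sim:
  assumes X: "nsim t chi chi'" and T: "hsim t T T'" and c: "esim s c c'" and ts: "Suc t \<le> s"
    and ok: "loop_ok T chi w p" "32 \<le> D" "\<And>e. e \<in> loop.unc T c \<Longrightarrow> card (adj (loop.unc T c) e) \<le> D" "loop.partial T c"
  shows "esim (s + k * (crad p (2 * w) + 1)) (loop.sweep T chi w p (loop.unc T c) D c k)
     (loop.sweep T' chi' w p (loop.unc T' c') D c' k)"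
proof (induction k)
  case 0 then show ?case using c by (simp add: loop.sweep.simps)
next
  case (Suc k)
  interpret lo: loop_ok T chi w p by (rule ok(1))
  define S where "S = s + k * (crad p (2 * w) + 1)"
  let ?U = "loop.unc T c" and ?U' = "loop.unc T' c'"
  let ?c = "loop.sweep T chi w p ?U D c k" and ?c' = "loop.sweep T' chi' w p ?U' D c' k"
  let ?Q = "loop.part T chi ?U D k ?c" and ?Q' = "loop.part T' chi' ?U' D k ?c'"
  have tS: "t \<le> S" "Suc t \<le> S" "s \<le> S" using ts by (simp_all add: S_def)
  have IH: "esim S ?c ?c'" using Suc.IH by (simp add: S_def)
  have XS: "nsim S chi chi'" "hsim S T T'" "hsim S ?U ?U'"
    using nsim_le[OF X tS(1)] hsim_le[OF T tS(1)] hsim_le[OF unc_sim[OF hsim_le[OF T] c] tS(3)] ts by simp_all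
  have Q: "hsim (Suc S) ?Q ?Q'" by (rule part_sim[OF XS(1,3,2) IH])
  have ck: "cls.ckey ?Q (loop.side chi (k div 1024)) (loop.avail T ?c) (loop.nu chi w) p (2 * w) e
      < (p + 1) * palette (48 * p\<^sup>2) (2 * w)" if "e \<in> ?Q" for e
  proof -
    have "lo.unc ?c \<subseteq> ?U" using lo.sweep_inv[OF ok(2-4)] by blast
    then show ?thesis using cls_ok.ckey_less[OF lo.part_ok[OF lo.unc_sub _ ok(2,3)] that] by simp
  qed
  have C: "esim (Suc S + crad p (2 * w))
     (cls.ccol ?Q (loop.side chi (k div 1024)) (loop.avail T ?c) (loop.nu chi w) p (2 * w))
     (cls.ccol ?Q' (loop.side chi' (k div 1024)) (loop.avail T' ?c') (loop.nu chi' w) p (2 * w))"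
    by (rule ccol_sim[OF Q nsim_le[OF side_sim[OF X]] avail_sim[OF XS(2) IH] esim_le[OF nu_sim[OF X]] ck])
      (use tS in simp_all)
  have "esim (Suc S + crad p (2 * w)) (loop.sweep T chi w p ?U D c (Suc k)) (loop.sweep T' chi' w p ?U' D c' (Suc k))"
  proof (rule esimI)
    fix v e assume v: "v \<in> A (Suc S + crad p (2 * w))" and e: "e \<in> E" "v \<in> e"
    have vS: "v \<in> A S" "v \<in> A (Suc S)" using A_leD[OF v] by simp_all
    show "loop.sweep T chi w p ?U D c (Suc k) e = loop.sweep T' chi' w p ?U' D c' (Suc k) e"
      by (simp only: loop.sweep.simps hsim_mem[OF Q vS(2) e(2)] esimD[OF IH vS(1) e] esimD[OF C v e])
  qed
  then show ?case by (simp add: S_def algebra_simps)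
qed

lemma tcol_sim:
  assumes X: "nsim t chi chi'" and T: "hsim t T T'" and ok: "loop_ok T chi w p"
  shows "esim (t + lrad w p) (loop.tcol T chi w p) (loop.tcol T' chi' w p)"
proof -
  interpret lo: loop_ok T chi w p by (rule ok)
  let ?R = "w * 1024 * (crad p (2 * w) + 1)"
  have r: "j \<le> p - 5 \<Longrightarrow> esim (Suc t + j * ?R) (loop.rnd T chi w p j) (loop.rnd T' chi' w p j)" for j
  proof (induction j)
    case 0 then show ?case by (simp add: loop.rnd.simps esim_def)
  next
    case (Suc j)
    have i: "lo.partial (lo.rnd j)" "\<And>e. e \<in> lo.unc (lo.rnd j) \<Longrightarrow> card (adj (lo.unc (lo.rnd j)) e) \<le> 2 ^ (p - j)"
      using lo.rnd_inv[of j] Suc.prems by auto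
    have "(2::nat) ^ 5 \<le> 2 ^ (p - j)" using Suc.prems lo.p5 by (intro power_increasing) auto
    then have D: "32 \<le> (2::nat) ^ (p - j)" by simp
    have "esim (Suc t + j * ?R + w * 1024 * (crad p (2 * w) + 1)) (loop.rnd T chi w p (Suc j)) (loop.rnd T' chi' w p (Suc j))"
      unfolding loop.rnd.simps by (rule sweep_sim[OF X T _ _ ok D i(2,1)]) (use Suc in simp_all)
    then show ?case by (simp add: algebra_simps)
  qed
  define S where "S = Suc t + (p - 5) * ?R"
  let ?c = "loop.rnd T chi w p (p - 5)" and ?c' = "loop.rnd T' chi' w p (p - 5)"
  let ?U = "loop.unc T ?c" and ?U' = "loop.unc T' ?c'"
  have c: "esim S ?c ?c'" using r[of "p - 5"] by (simp add: S_def)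
  have TS: "hsim S T T'" using hsim_le[OF T] by (simp add: S_def)
  have U: "hsim S ?U ?U'" by (rule unc_sim[OF TS c])
  have nu: "esim S (loop.nu chi w) (loop.nu chi' w)" by (rule esim_le[OF nu_sim[OF X]]) (simp add: S_def)
  have K: "esim (Suc S) (loop.fkey chi w ?U) (loop.fkey chi' w ?U')"
  proof (rule esimI)
    fix v e assume ve: "v \<in> A (Suc S)" "e \<in> E" "v \<in> e"
    have vS: "v \<in> A S" using A_leD[OF ve(1)] by simp
    show "loop.fkey chi w ?U e = loop.fkey chi' w ?U' e" unfolding loop.fkey_def
      by (simp only: esimD[OF nu vS ve(2,3)] esimD[OF adj_image_sim[OF U nu] ve])
  qed
  have G: "esim (Suc S + palette 32 (2 * w)) (gcol ?U (loop.avail T ?c) (loop.fkey chi w ?U)) (gcol ?U' (loop.avail T' ?c') (loop.fkey chi' w ?U'))"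
    by (rule gcol_sim[OF hsim_le[OF U] avail_sim[OF TS c] K]) (simp_all add: lo.final_ok(1))
  have "esim (Suc S + palette 32 (2 * w)) (loop.tcol T chi w p) (loop.tcol T' chi' w p)"
  proof (rule esimI)
    fix v e assume v: "v \<in> A (Suc S + palette 32 (2 * w))" and e: "e \<in> E" "v \<in> e"
    have vS: "v \<in> A S" using A_leD[OF v] by simp
    show "loop.tcol T chi w p e = loop.tcol T' chi' w p e"
      unfolding loop.tcol_def Let_def by (simp only: hsim_mem[OF U vS e(2)] esimD[OF G v e] esimD[OF c vS e])
  qed
  then show ?thesis by (rule esim_le) (simp add: S_def lrad_def)
qed

end

section \<open>Arboricity and density\<close>

text \<open>A longest path inside \<open>X\<close> cannot be extended beyond its first node. So two
  edges at that node lead back to the path, and one that does not go to the second node closes a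
  cycle.\<close>

lemma min_degree_cycle:
  assumes fin: "finite X" and ne: "X \<noteq> {}" and F2: "\<And>e. e \<in> F \<Longrightarrow> card e = 2"
    and deg: "\<And>v. v \<in> X \<Longrightarrow> 2 \<le> card {e \<in> F. v \<in> e \<and> e \<subseteq> X}"
  shows "\<exists>vs. is_cycle F vs"
proof -
  define P where "P = {vs. vs \<noteq> [] \<and> set vs \<subseteq> X \<and> distinct vs \<and>
    (\<forall>i. Suc i < length vs \<longrightarrow> {vs ! i, vs ! Suc i} \<in> F)}"
  have finP: "finite P" by (rule finite_subset[OF _ finite_subset_distinct[OF fin]]) (auto simp: P_def)
  obtain x0 where "x0 \<in> X" using ne by blast
  then have "[x0] \<in> P" by (simp add: P_def)
  then have neP: "length ` P \<noteq> {}" by blast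
  obtain vs where vs: "vs \<in> P" "length vs = Max (length ` P)" using Max_in[OF _ neP] finP by auto
  have mx: "length ys \<le> length vs" if "ys \<in> P" for ys using vs(2) that finP by simp
  define x where "x = vs ! 0"
  have l0: "0 < length vs" using vs(1) by (simp add: P_def)
  have xX: "x \<in> X" using vs(1) l0 nth_mem[OF l0] by (auto simp: P_def x_def)
  obtain S where S: "S \<subseteq> {e \<in> F. x \<in> e \<and> e \<subseteq> X}" "card S = 2"
    using deg[OF xX] by (rule obtain_subset_with_card_n)
  then obtain e1 e2 where e12: "e1 \<noteq> e2" "e1 \<in> S" "e2 \<in> S" by (auto simp: card_2_iff)
  have idx: "\<exists>i. 0 < i \<and> i < length vs \<and> e = {vs ! 0, vs ! i}" if e: "e \<in> S" for e
  proof -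
    have e': "e \<in> F" "x \<in> e" "e \<subseteq> X" using e S by auto
    note o = other_pair[OF F2[OF e'(1)] e'(2)]
    define y where "y = other e x"
    have y: "e = {x, y}" "y \<noteq> x" "y \<in> X" using o(1,2,3) e'(3) by (auto simp: y_def)
    have "y \<in> set vs"
    proof (rule ccontr)
      assume ny: "y \<notin> set vs"
      have "{(y # vs) ! i, (y # vs) ! Suc i} \<in> F" if "Suc i < length (y # vs)" for i
      proof (cases i)
        case 0
        then show ?thesis using y(1) e'(1) by (simp add: x_def insert_commute)
      next
        case (Suc j)
        then show ?thesis using vs(1) that by (simp add: P_def)
      qed
      then have "y # vs \<in> P" using vs(1) ny y(3) by (simp add: P_def)
      from mx[OF this] show False by simp
    qed
    then obtain i where i: "i < length vs" "vs ! i = y" by (auto simp: in_set_conv_nth)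
    have "i \<noteq> 0"
    proof
      assume "i = 0"
      then show False using i(2) y(2) x_def by simp
    qed
    then show ?thesis using i y(1) x_def by blast
  qed
  obtain i1 where i1: "0 < i1" "i1 < length vs" "e1 = {vs ! 0, vs ! i1}" using idx[OF e12(2)] by blast
  obtain i2 where i2: "0 < i2" "i2 < length vs" "e2 = {vs ! 0, vs ! i2}" using idx[OF e12(3)] by blast
  have "i1 \<noteq> i2" using i1(3) i2(3) e12(1) by blast
  then obtain j where j: "2 \<le> j" "j < length vs" "{vs ! 0, vs ! j} \<in> F"
  proof -
    assume a: "\<And>j. 2 \<le> j \<Longrightarrow> j < length vs \<Longrightarrow> {vs ! 0, vs ! j} \<in> F \<Longrightarrow> thesis"
    have F: "e1 \<in> F" "e2 \<in> F" using e12 S by auto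
    show thesis
    proof (cases "2 \<le> i1")
      case True then show thesis using a i1 F by simp
    next
      case False
      then have "2 \<le> i2" using i1(1) i2(1) \<open>i1 \<noteq> i2\<close> by linarith
      then show thesis using a i2 F by simp
    qed
  qed
  have len: "length (take (Suc j) vs) = Suc j" using j(2) by simp
  have "is_cycle F (take (Suc j) vs)" unfolding is_cycle_def len
  proof (intro conjI allI impI)
    show "3 \<le> Suc j" using j(1) by simp
    show "distinct (take (Suc j) vs)" using vs(1) by (simp add: P_def)
    fix i assume i: "i < Suc j"
    show "{take (Suc j) vs ! i, take (Suc j) vs ! ((i + 1) mod Suc j)} \<in> F"
    proof (cases "i = j")
      case True
      then have "(i + 1) mod Suc j = 0" by simp
      then show ?thesis using True j(3) by (simp add: insert_commute)
    next
      case False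
      then have "(i + 1) mod Suc j = Suc i" "Suc i < Suc j" using i by simp_all
      then show ?thesis using vs(1) j(2) i by (simp add: P_def)
    qed
  qed
  then show ?thesis by blast
qed

lemma simple_graphD: assumes "simple_graph V E" "e \<in> E" shows "card e = 2 \<and> e \<subseteq> V"
proof -
  obtain u v where "u \<noteq> v" "u \<in> V" "v \<in> V" "e = {u, v}" using assms unfolding simple_graph_def by blast
  then show ?thesis by simp
qed

lemma simple_graph_finite: assumes "simple_graph V E" shows "finite E"
proof -
  have "E \<subseteq> Pow V" using simple_graphD[OF assms] by blast
  then show ?thesis using assms finite_subset[of E "Pow V"] by (simp add: simple_graph_def)
qed

text \<open>Some node of \<open>X\<close> has degree at most one inside \<open>X\<close>, as there
  would be a cycle otherwise; remove it and induct.\<close>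

lemma forest_density:
  assumes "forest V F" and "finite X"
  shows "card {e \<in> F. e \<subseteq> X} \<le> card X"
  using assms(2)
proof (induction "card X" arbitrary: X)
  case 0
  then have X: "X = {}" by simp
  have "\<not> e \<subseteq> X" if "e \<in> F" for e
    using simple_graphD[of V F e] assms(1) that X by (auto simp: forest_def)
  then have "{e \<in> F. e \<subseteq> X} = {}" by blast
  then show ?case by (metis card.empty le0)
next
  case (Suc m)
  have sg: "simple_graph V F" using assms(1) by (simp add: forest_def)
  have "\<exists>v\<in>X. card {e \<in> F. v \<in> e \<and> e \<subseteq> X} \<le> 1"
  proof (rule ccontr)
    assume a: "\<not> ?thesis"
    have "\<exists>vs. is_cycle F vs"
    proof (rule min_degree_cycle[OF Suc.prems])
      show "X \<noteq> {}" using Suc.hyps(2) by auto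
      show "card e = 2" if "e \<in> F" for e using simple_graphD[OF sg that] by blast
      show "2 \<le> card {e \<in> F. v \<in> e \<and> e \<subseteq> X}" if "v \<in> X" for v
      proof -
        have "\<not> card {e \<in> F. v \<in> e \<and> e \<subseteq> X} \<le> 1" using a that by blast
        then show ?thesis by linarith
      qed
    qed
    then show False using assms(1) by (simp add: forest_def)
  qed
  then obtain v where v: "v \<in> X" "card {e \<in> F. v \<in> e \<and> e \<subseteq> X} \<le> 1" by blast
  have m: "m = card (X - {v})" using Suc v(1) by simp
  have eq: "{e \<in> F. e \<subseteq> X} = {e \<in> F. e \<subseteq> X - {v}} \<union> {e \<in> F. v \<in> e \<and> e \<subseteq> X}" by blast
  have "card {e \<in> F. e \<subseteq> X} \<le> card {e \<in> F. e \<subseteq> X - {v}} + card {e \<in> F. v \<in> e \<and> e \<subseteq> X}"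
    unfolding eq by (rule card_Un_le)
  also have "\<dots> \<le> card (X - {v}) + 1"
    using Suc.hyps(1)[OF m] Suc.prems v(2) by (intro add_mono) auto
  finally show ?case using m Suc.hyps(2) by simp
qed

text \<open>The easy half of the Nash-Williams theorem. From here on arboricity acts only through
  this density bound.\<close>

lemma arboricity_density:
  assumes sg: "simple_graph V E" and a: "arboricity V E \<le> a" and X: "finite X"
  shows "card {e \<in> E. e \<subseteq> X} \<le> a * card X"
proof -
  have finE: "finite E" by (rule simple_graph_finite[OF sg])
  let ?Q = "\<lambda>k. \<exists>P :: nat set \<Rightarrow> nat. (\<forall>e\<in>E. P e < k) \<and> (\<forall>i<k. forest V {e \<in> E. P e = i})"
  obtain h where h: "bij_betw h E {0..<card E}" using ex_bij_betw_finite_nat[OF finE] by blast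
  \<comment> \<open>Some partition into forests exists, one with every edge in a class of its own;
    this makes the \<open>LEAST\<close> in \<open>arboricity\<close> attained.\<close>
  have "forest V {e \<in> E. h e = i}" for i
  proof -
    have "\<not> is_cycle {e \<in> E. h e = i} vs" for vs
    proof
      assume c: "is_cycle {e \<in> E. h e = i} vs"
      then have l: "3 \<le> length vs" "distinct vs" by (auto simp: is_cycle_def)
      have "{vs ! i', vs ! ((i' + 1) mod length vs)} \<in> {e \<in> E. h e = i}" if "i' < length vs" for i'
        using c that by (simp add: is_cycle_def)
      note st = this
      have "0 < length vs" "1 < length vs" "(0 + 1) mod length vs = 1" "(1 + 1) mod length vs = 2" using l(1) by auto
      then have "{vs ! 0, vs ! 1} \<in> {e \<in> E. h e = i}" "{vs ! 1, vs ! 2} \<in> {e \<in> E. h e = i}"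
        using st[of 0] st[of 1] by metis+
      then have "{vs ! 0, vs ! 1} = {vs ! 1, vs ! 2}"
        using h by (auto simp: bij_betw_def inj_on_def)
      then have "vs ! 0 = vs ! 2" by (auto simp: doubleton_eq_iff)
      moreover have "0 < length vs" "2 < length vs" using l(1) by auto
      ultimately show False using nth_eq_iff_index_eq[OF l(2), of 0 2] by simp
    qed
    moreover have "simple_graph V {e \<in> E. h e = i}" using sg by (auto simp: simple_graph_def)
    ultimately show ?thesis by (simp add: forest_def)
  qed
  moreover have "\<forall>e\<in>E. h e < card E" using h by (auto simp: bij_betw_def)
  ultimately have "\<exists>k. ?Q k" by blast
  from LeastI_ex[OF this] have "?Q (arboricity V E)" unfolding arboricity_def .
  then obtain P where P: "\<forall>e\<in>E. P e < arboricity V E" "\<forall>i<arboricity V E. forest V {e \<in> E. P e = i}" by blast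
  have "{e \<in> E. e \<subseteq> X} \<subseteq> (\<Union>i<arboricity V E. {e \<in> {e \<in> E. P e = i}. e \<subseteq> X})" using P(1) by auto
  then have "card {e \<in> E. e \<subseteq> X} \<le> card (\<Union>i<arboricity V E. {e \<in> {e \<in> E. P e = i}. e \<subseteq> X})"
    using finE by (intro card_mono) auto
  also have "\<dots> \<le> (\<Sum>i<arboricity V E. card {e \<in> {e \<in> E. P e = i}. e \<subseteq> X})" by (rule card_UN_le) simp
  also have "\<dots> \<le> (\<Sum>i<arboricity V E. card X)"
    using P(2) by (intro sum_mono forest_density[OF _ X]) auto
  also have "\<dots> \<le> a * card X" using a by (simp add: mult_le_mono1)
  finally show ?thesis .
qed

section \<open>Peeling off vertices of low degree\<close>

locale peel =
  fixes E :: "nat set set" and a k N :: nat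
begin

definition liveE :: "(nat \<Rightarrow> bool) \<Rightarrow> nat set set" where
  "liveE s = {e \<in> E. \<forall>u\<in>e. s u}"

definition hi :: "(nat \<Rightarrow> bool) \<Rightarrow> nat \<Rightarrow> bool" where
  "hi s v \<longleftrightarrow> k < card (inc (liveE s) v)"

definition up :: "(nat \<Rightarrow> bool) \<Rightarrow> nat \<Rightarrow> nat set set" where
  "up s v = {e \<in> inc (liveE s) v. hi s (other e v)}"

primrec live :: "nat \<Rightarrow> nat \<Rightarrow> bool" where
  "live 0 = (\<lambda>v. True)"
| "live (Suc i) = (\<lambda>v. live i v \<and> (hi (live i) v \<or> 2 * a < card (up (live i) v)))"

text \<open>The cap \<open>N\<close> is never reached in the graphs of interest; it makes the level of an edge computable
  within a bounded distance in every graph.\<close>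

definition elev :: "nat set \<Rightarrow> nat" where
  "elev e = (LEAST i. N \<le> i \<or> \<not> (\<forall>u\<in>e. live (Suc i) u))"

text \<open>An edge is judged at the last stage at which both its ends are alive.\<close>

definition low :: "nat set set" where
  "low = {e \<in> E. \<forall>u\<in>e. \<not> hi (live (elev e)) u}"

text \<open>For an edge outside \<open>low\<close>, the orientation leads from the end that is about
  to be removed to the end whose degree is still high.\<close>

definition head_of :: "nat set \<Rightarrow> nat" where
  "head_of e = (SOME u. u \<in> e \<and> hi (live (elev e)) u)"

lemma live_anti: "i \<le> j \<Longrightarrow> live j v \<Longrightarrow> live i v"
proof (induction j)
  case (Suc j) then show ?case by (cases "i = Suc j") auto
qed simp

lemma elev_le: "elev e \<le> N" unfolding elev_def by (rule Least_le) simp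

lemma elev_live: "u \<in> e \<Longrightarrow> live (elev e) u"
proof (cases "elev e")
  case (Suc j)
  assume u: "u \<in> e"
  have "\<not> (N \<le> j \<or> \<not> (\<forall>u\<in>e. live (Suc j) u))"
    by (rule not_less_Least) (use Suc in \<open>simp add: elev_def del: live.simps\<close>)
  then show ?thesis using u Suc by (simp del: live.simps)
qed simp

lemma elev_dead: "elev e < N \<Longrightarrow> \<exists>u\<in>e. \<not> live (Suc (elev e)) u"
proof -
  assume a: "elev e < N"
  have "N \<le> elev e \<or> \<not> (\<forall>u\<in>e. live (Suc (elev e)) u)" unfolding elev_def by (rule LeastI[of _ N]) simp
  then show ?thesis using a by (auto simp del: live.simps)
qed

end

locale peel_ok = peel +
  fixes V :: "nat set" and Q :: nat
  assumes pairsE: "pairs E" and finV: "finite V" and EV: "\<And>e. e \<in> E \<Longrightarrow> e \<subseteq> V"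
    and dens: "\<And>X. finite X \<Longrightarrow> card {e \<in> E. e \<subseteq> X} \<le> a * card X"
    and k: "k = 4 * a * Q" and QN: "card V < Q ^ N"
begin

lemma finE: "finite E" using pairsE by (simp add: pairs_def)
lemma c2: "e \<in> E \<Longrightarrow> card e = 2" using pairsE by (simp add: pairs_def)
lemma liveE_sub: "liveE s \<subseteq> E" by (auto simp: liveE_def)
lemma fin_inc: "finite (inc (liveE s) v)" using finite_inc[OF finite_subset[OF liveE_sub finE]] .

text \<open>By density at most a \<open>2 * a / k\<close> share of the nodes has high degree. Every
  other survivor sends more than \<open>2 * a\<close> edges to those nodes, which by density is
  possible only if there are at most as many such survivors as high-degree nodes. With
  \<open>k = 4 * a * Q\<close> both kinds together are a \<open>1 / Q\<close> share.\<close>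

lemma shrink: "card {v \<in> V. live (Suc i) v} * Q \<le> card {v \<in> V. live i v}"
proof -
  define s where "s = live i"
  define X where "X = {v \<in> V. s v}"
  define Hi where "Hi = {v \<in> X. hi s v}"
  define Y where "Y = {v \<in> X. \<not> hi s v \<and> 2 * a < card (up s v)}"
  have fin: "finite X" "finite Hi" "finite Y" using finV by (simp_all add: X_def Hi_def Y_def)
  have finL: "finite (liveE s)" using finite_subset[OF liveE_sub finE] .
  have LX: "e \<subseteq> X" if "e \<in> liveE s" for e using that EV by (auto simp: liveE_def X_def)
  have nxt: "{v \<in> V. live (Suc i) v} = Hi \<union> Y" by (auto simp: Hi_def Y_def X_def s_def)
  have hand: "(\<Sum>v\<in>X. card (inc (liveE s) v)) = 2 * card (liveE s)"
  proof -
    have "(\<Sum>v\<in>X. card (inc (liveE s) v)) = (\<Sum>e\<in>liveE s. card {v \<in> X. v \<in> e})"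
      unfolding inc_def by (rule sum_card_swap) (use fin finL in simp_all)
    also have "\<dots> = (\<Sum>e\<in>liveE s. 2)"
    proof (rule sum.cong[OF refl])
      fix e assume e: "e \<in> liveE s"
      have "{v \<in> X. v \<in> e} = e" using LX[OF e] by blast
      then show "card {v \<in> X. v \<in> e} = 2" using c2 e liveE_sub by auto
    qed
    finally show ?thesis by simp
  qed
  have "(k + 1) * card Hi = (\<Sum>v\<in>Hi. k + 1)" by simp
  also have "\<dots> \<le> (\<Sum>v\<in>Hi. card (inc (liveE s) v))" by (intro sum_mono) (auto simp: Hi_def hi_def)
  also have "\<dots> \<le> (\<Sum>v\<in>X. card (inc (liveE s) v))" by (intro sum_mono2) (auto simp: fin Hi_def)
  also have "\<dots> \<le> 2 * (a * card X)"
  proof -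
    have "liveE s \<subseteq> {e \<in> E. e \<subseteq> X}" using LX liveE_sub by blast
    then have "card (liveE s) \<le> card {e \<in> E. e \<subseteq> X}" using finE by (intro card_mono) auto
    then show ?thesis unfolding hand using dens[OF fin(1)] by linarith
  qed
  finally have h1: "(k + 1) * card Hi \<le> 2 * (a * card X)" .
  have upc: "other e v \<in> Hi \<and> e = {v, other e v}" if "e \<in> up s v" for e v
  proof -
    have e: "e \<in> liveE s" "v \<in> e" "hi s (other e v)" using that by (auto simp: up_def inc_def)
    note o = other_pair[OF c2[OF subsetD[OF liveE_sub e(1)]] e(2)]
    have "other e v \<in> X" using LX[OF e(1)] o(3) by blast
    then show ?thesis using e(3) o(1) by (simp add: Hi_def)
  qed
  have "(2 * a + 1) * card Y = (\<Sum>v\<in>Y. 2 * a + 1)" by simp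
  also have "\<dots> \<le> (\<Sum>v\<in>Y. card (up s v))" by (intro sum_mono) (auto simp: Y_def)
  also have "\<dots> = card (\<Union>v\<in>Y. up s v)"
  proof (rule card_UN_disjoint[symmetric])
    show "\<forall>v\<in>Y. finite (up s v)" using fin_inc by (simp add: up_def)
    show "\<forall>v\<in>Y. \<forall>v'\<in>Y. v \<noteq> v' \<longrightarrow> up s v \<inter> up s v' = {}"
    proof (intro ballI impI)
      fix v v' assume v: "v \<in> Y" "v' \<in> Y" "v \<noteq> v'"
      have False if "e \<in> up s v" "e \<in> up s v'" for e
      proof -
        have "v' \<in> e" using that(2) by (simp add: up_def inc_def)
        then have "v' \<in> {v, other e v}" using upc[OF that(1)] by simp
        then have "v' = other e v" using v(3) by simp
        then show False using upc[OF that(1)] v(2) by (simp add: Hi_def Y_def)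
      qed
      then show "up s v \<inter> up s v' = {}" by blast
    qed
  qed (fact fin(3))
  also have "\<dots> \<le> card {e \<in> E. e \<subseteq> Y \<union> Hi}"
  proof (rule card_mono)
    show "(\<Union>v\<in>Y. up s v) \<subseteq> {e \<in> E. e \<subseteq> Y \<union> Hi}"
    proof
      fix e assume "e \<in> (\<Union>v\<in>Y. up s v)"
      then obtain v where v: "v \<in> Y" "e \<in> up s v" by blast
      have "e \<in> E" using v(2) liveE_sub by (auto simp: up_def inc_def)
      moreover have "{v, other e v} \<subseteq> Y \<union> Hi" using upc[OF v(2)] v(1) by blast
      then have "e \<subseteq> Y \<union> Hi" using upc[OF v(2)] by metis
      ultimately show "e \<in> {e \<in> E. e \<subseteq> Y \<union> Hi}" by blast
    qed
  qed (use finE in simp)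
  also have "\<dots> \<le> a * card (Y \<union> Hi)" by (rule dens) (use fin in simp)
  also have "\<dots> \<le> a * (card Y + card Hi)" by (intro mult_le_mono2 card_Un_le)
  finally have "(a + 1) * card Y \<le> a * card Hi" by (simp add: algebra_simps)
  also have "\<dots> \<le> (a + 1) * card Hi" by simp
  finally have h2: "card Y \<le> card Hi" by (simp only: mult_le_cancel1)
  have "card (Hi \<union> Y) \<le> 2 * card Hi" using card_Un_le[of Hi Y] h2 by linarith
  then have h3: "card (Hi \<union> Y) * Q \<le> 2 * card Hi * Q" by (rule mult_le_mono1)
  have "2 * card Hi * Q \<le> card X"
  proof (cases "a = 0")
    case True then show ?thesis using h1 by simp
  next
    case False
    have "(2 * a) * (2 * card Hi * Q) \<le> (k + 1) * card Hi" unfolding k by (simp add: algebra_simps)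
    then have "(2 * a) * (2 * card Hi * Q) \<le> (2 * a) * card X" using h1 by linarith
    then show ?thesis using False by (simp add: mult.commute)
  qed
  then have "card (Hi \<union> Y) * Q \<le> card X" using h3 by linarith
  moreover have "X = {v \<in> V. live i v}" by (simp add: X_def s_def)
  ultimately show ?thesis unfolding nxt by simp
qed

lemma no_live: "v \<in> V \<Longrightarrow> \<not> live N v"
proof
  assume v: "v \<in> V" "live N v"
  have "card {v \<in> V. live i v} * Q ^ i \<le> card V" for i
  proof (induction i)
    case (Suc i)
    have "card {v \<in> V. live (Suc i) v} * Q ^ Suc i = card {v \<in> V. live (Suc i) v} * Q * Q ^ i" by simp
    also have "\<dots> \<le> card {v \<in> V. live i v} * Q ^ i" by (rule mult_le_mono1[OF shrink])
    finally show ?case using Suc by linarith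
  qed simp
  from this[of N] have "card {v \<in> V. live N v} * Q ^ N < 1 * Q ^ N" using QN by linarith
  then have "card {v \<in> V. live N v} < 1" by (simp only: mult_less_cancel2)
  then have "{v \<in> V. live N v} = {}" using finV by simp
  then show False using v by blast
qed

lemma elev_less: assumes "e \<in> E" shows "elev e < N"
proof (rule ccontr)
  assume "\<not> elev e < N"
  then have "elev e = N" using elev_le[of e] by simp
  moreover obtain v where "v \<in> e" using c2[OF assms] by fastforce
  ultimately show False using elev_live no_live EV[OF assms] by (metis subsetD)
qed

text \<open>Take the low edge at \<open>v\<close> of smallest level: at that stage all low edges at
  \<open>v\<close> are still alive, and \<open>v\<close> does not have high degree.\<close>

lemma low_deg: "card (inc low v) \<le> k"
proof (cases "inc low v = {}")
  case False
  define i where "i = (LEAST i. \<exists>e\<in>inc low v. elev e = i)"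
  have "\<exists>i. \<exists>e\<in>inc low v. elev e = i" using False by blast
  from LeastI_ex[OF this] obtain e where e: "e \<in> inc low v" "elev e = i" unfolding i_def by blast
  have le: "i \<le> elev f" if "f \<in> inc low v" for f unfolding i_def by (rule Least_le) (use that in blast)
  have "inc low v \<subseteq> inc (liveE (live i)) v"
  proof
    fix f assume f: "f \<in> inc low v"
    have "live i u" if "u \<in> f" for u using live_anti[OF le[OF f] elev_live[OF that]] .
    then show "f \<in> inc (liveE (live i)) v" using f by (auto simp: inc_def liveE_def low_def)
  qed
  then have "card (inc low v) \<le> card (inc (liveE (live i)) v)" using fin_inc by (rule card_mono[rotated])
  moreover have "\<not> hi (live i) v" using e by (auto simp: inc_def low_def)
  ultimately show ?thesis by (simp add: hi_def)
qed simp

lemma not_low: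
  assumes "e \<in> E - low"
  shows "head_of e \<in> e" "hi (live (elev e)) (head_of e)" "\<not> live (Suc (elev e)) (other e (head_of e))"
    "e \<in> up (live (elev e)) (other e (head_of e))" "card (up (live (elev e)) (other e (head_of e))) \<le> 2 * a"
proof -
  let ?i = "elev e" and ?u = "other e (head_of e)"
  have e: "e \<in> E" using assms by simp
  have "\<exists>u. u \<in> e \<and> hi (live ?i) u" using assms by (auto simp: low_def)
  from someI_ex[OF this] show h: "head_of e \<in> e" "hi (live ?i) (head_of e)" unfolding head_of_def by auto
  obtain x where x: "x \<in> e" "\<not> live (Suc ?i) x" using elev_dead[OF elev_less[OF e]] by blast
  have "live ?i x" by (rule elev_live[OF x(1)])
  then have nx: "\<not> hi (live ?i) x" "card (up (live ?i) x) \<le> 2 * a" using x(2) by auto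
  have "x = ?u" by (rule other_unique[OF c2[OF e] h(1) x(1)]) (use nx(1) h(2) in blast)
  then show "\<not> live (Suc ?i) ?u" "card (up (live ?i) ?u) \<le> 2 * a" using x(2) nx(2) by simp_all
  have o: "other e ?u = head_of e" "?u \<in> e" using other_pair[OF c2[OF e] h(1)] by auto
  have "e \<in> liveE (live ?i)" using e elev_live[of _ e] by (simp add: liveE_def)
  then show "e \<in> up (live ?i) ?u" using o h(2) by (simp add: up_def inc_def)
qed

text \<open>The tail of an edge dies right after the level of the edge, so all out-edges of
  \<open>u\<close> have the same level. They are among the edges from \<open>u\<close> to
  high-degree nodes at that stage, at most \<open>2 * a\<close> since \<open>u\<close> was
  removed.\<close>

lemma out_deg: "card {e \<in> E - low. u \<in> e \<and> head_of e \<noteq> u} \<le> 2 * a"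
proof (cases "{e \<in> E - low. u \<in> e \<and> head_of e \<noteq> u} = {}")
  case False
  have tail: "other e (head_of e) = u" if "e \<in> E - low" "u \<in> e" "head_of e \<noteq> u" for e
    using other_unique[OF c2 not_low(1)[OF that(1)] that(2)] that by auto
  obtain e where e: "e \<in> E - low" "u \<in> e" "head_of e \<noteq> u" using False by blast
  have "{f \<in> E - low. u \<in> f \<and> head_of f \<noteq> u} \<subseteq> up (live (elev e)) u"
  proof
    fix f assume "f \<in> {f \<in> E - low. u \<in> f \<and> head_of f \<noteq> u}"
    then have f: "f \<in> E - low" "u \<in> f" "head_of f \<noteq> u" by auto
    have "\<not> live (Suc (elev e)) u" "\<not> live (Suc (elev f)) u" "live (elev e) u" "live (elev f) u"
      using not_low(3)[OF e(1)] not_low(3)[OF f(1)] tail[OF e] tail[OF f] elev_live e(2) f(2) by simp_all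
    then have "elev e = elev f" using live_anti by (metis Suc_leI linorder_neqE_nat)
    then show "f \<in> up (live (elev e)) u" using not_low(4)[OF f(1)] tail[OF f] by simp
  qed
  moreover have "finite (up (live (elev e)) u)" using fin_inc by (simp add: up_def)
  ultimately have "card {f \<in> E - low. u \<in> f \<and> head_of f \<noteq> u} \<le> card (up (live (elev e)) u)" by (rule card_mono[rotated])
  then show ?thesis using not_low(5)[OF e(1)] tail[OF e] by simp
qed (metis card.empty le0)

end

section \<open>Locality of the peeling process\<close>

context agreement
begin

lemma liveE_sim:
  assumes "nsim t s s'" "1 \<le> t" shows "hsim (Suc t) (peel.liveE E s) (peel.liveE E' s')"
  unfolding peel.liveE_def
proof (rule hsim_filter[OF hsim_le[OF hsim_base]])
  fix v e assume ve: "v \<in> A (Suc t)" "e \<in> E" "v \<in> e"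
  show "(\<forall>u\<in>e. s u) = (\<forall>u\<in>e. s' u)" using nb[OF ve] nsimD[OF assms(1)] by blast
qed simp

lemma hi_sim: "nsim t s s' \<Longrightarrow> 1 \<le> t \<Longrightarrow> nsim (Suc t) (peel.hi E k s) (peel.hi E' k s')"
  using hsim_inc[OF liveE_sim] by (auto simp: nsim_def peel.hi_def)

lemma up_sim:
  assumes "nsim t s s'" "1 \<le> t" shows "nsim (Suc (Suc t)) (peel.up E k s) (peel.up E' k s')"
proof (rule nsimI)
  fix v assume v: "v \<in> A (Suc (Suc t))"
  have v1: "v \<in> A (Suc t)" using A_leD[OF v] by simp
  have i: "inc (peel.liveE E s) v = inc (peel.liveE E' s') v" by (rule hsim_inc[OF liveE_sim[OF assms] v1])
  show "peel.up E k s v = peel.up E' k s' v" unfolding peel.up_def i[symmetric]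
  proof (rule Collect_cong, rule conj_cong[OF refl])
    fix e assume "e \<in> inc (peel.liveE E s) v"
    then have e: "e \<in> E" "v \<in> e" by (auto simp: inc_def peel.liveE_def)
    show "peel.hi E k s (other e v) = peel.hi E' k s' (other e v)"
      by (rule nsimD[OF hi_sim[OF assms] nb[OF v e other_in[OF e]]])
  qed
qed

text \<open>A stage costs two rounds: one to learn which neighbours are alive, one to learn which of
  them have high degree.\<close>

lemma live_sim: "nsim (1 + 2 * i) (peel.live E a k i) (peel.live E' a k i)"
proof (induction i)
  case 0 then show ?case by (simp add: nsim_def peel.live.simps)
next
  case (Suc i)
  have "nsim (Suc (Suc (1 + 2 * i))) (peel.live E a k (Suc i)) (peel.live E' a k (Suc i))"
  proof (rule nsimI)
    fix v assume v: "v \<in> A (Suc (Suc (1 + 2 * i)))"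
    have v1: "v \<in> A (1 + 2 * i)" "v \<in> A (Suc (1 + 2 * i))" using A_leD[OF v] by simp_all
    show "peel.live E a k (Suc i) v = peel.live E' a k (Suc i) v" unfolding peel.live.simps
      using nsimD[OF Suc v1(1)] nsimD[OF hi_sim[OF Suc] v1(2)] nsimD[OF up_sim[OF Suc] v] by simp
  qed
  then show ?case by simp
qed

lemma elev_sim: "esim (2 + 2 * N) (peel.elev E a k N) (peel.elev E' a k N)"
proof (rule esimI)
  fix v e assume v: "v \<in> A (2 + 2 * N)" and e: "e \<in> E" "v \<in> e"
  have "peel.live E a k (Suc i) u = peel.live E' a k (Suc i) u" if "u \<in> e" "i < N" for u i
  proof -
    have "u \<in> A (1 + 2 * N)" using nb[of v "1 + 2 * N", OF _ e that(1)] v by simp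
    then have "u \<in> A (1 + 2 * Suc i)" by (rule A_leD) (use that(2) in simp)
    then show ?thesis by (rule nsimD[OF live_sim])
  qed
  then have "(\<lambda>i. N \<le> i \<or> \<not> (\<forall>u\<in>e. peel.live E a k (Suc i) u)) = (\<lambda>i. N \<le> i \<or> \<not> (\<forall>u\<in>e. peel.live E' a k (Suc i) u))"
    by (metis (no_types, lifting) not_le)
  then show "peel.elev E a k N e = peel.elev E' a k N e" unfolding peel.elev_def by simp
qed

lemma hi_elev_sim:
  assumes v: "v \<in> A (3 + 2 * N)" and e: "e \<in> E" "v \<in> e" "u \<in> e"
  shows "peel.hi E k (peel.live E a k (peel.elev E a k N e)) u = peel.hi E' k (peel.live E' a k (peel.elev E' a k N e)) u"
proof -
  have el: "peel.elev E a k N e = peel.elev E' a k N e"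
    by (rule esimD[OF elev_sim _ e(1,2)]) (use A_leD[OF v] in simp)
  have "v \<in> A (Suc (2 + 2 * N))" using A_leD[OF v] by simp
  then have "u \<in> A (2 + 2 * N)" by (rule nb[OF _ e])
  then have "u \<in> A (Suc (1 + 2 * peel.elev E a k N e))" by (rule A_leD) (use peel.elev_le[of E a k N e] in simp)
  moreover have "nsim (Suc (1 + 2 * i)) (peel.hi E k (peel.live E a k i)) (peel.hi E' k (peel.live E' a k i))" for i
    by (rule hi_sim[OF live_sim]) simp
  ultimately show ?thesis unfolding el[symmetric] using nsimD by blast
qed

lemma low_sim: "hsim (3 + 2 * N) (peel.low E a k N) (peel.low E' a k N)"
  unfolding peel.low_def
  by (rule hsim_filter[OF hsim_le[OF hsim_base]]) (use hi_elev_sim in auto)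

lemma head_sim: "esim (3 + 2 * N) (peel.head_of E a k N) (peel.head_of E' a k N)"
proof (rule esimI)
  fix v e assume ve: "v \<in> A (3 + 2 * N)" "e \<in> E" "v \<in> e"
  have "(\<lambda>u. u \<in> e \<and> peel.hi E k (peel.live E a k (peel.elev E a k N e)) u) =
      (\<lambda>u. u \<in> e \<and> peel.hi E' k (peel.live E' a k (peel.elev E' a k N e)) u)"
    using hi_elev_sim[OF ve] by blast
  then show "peel.head_of E a k N e = peel.head_of E' a k N e" unfolding peel.head_of_def by simp
qed

lemma hsim_diff: assumes "hsim t T T'" shows "hsim t (E - T) (E' - T')"
proof (rule hsimI)
  have "1 \<le> t" using assms by (simp add: hsim_def)
  then have base: "hsim t E E'" using hsim_le[OF hsim_base] by blast
  fix v e assume "v \<in> A t" "e \<in> E" "v \<in> e"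
  then show "e \<in> E - T \<longleftrightarrow> e \<in> E' - T'" using hsim_mem[OF assms] hsim_mem[OF base] by blast
qed (use assms in \<open>auto simp: hsim_def\<close>)

end

section \<open>Colouring an orientation of small out-degree\<close>

definition injlab :: "nat set set \<Rightarrow> nat set \<Rightarrow> nat" where
  "injlab S = (SOME f. inj_on f S \<and> f ` S \<subseteq> {..<card S})"

lemma injlab: assumes "finite S" shows "inj_on (injlab S) S" "injlab S ` S \<subseteq> {..<card S}"
proof -
  obtain h where h: "bij_betw h S {0..<card S}" using ex_bij_betw_finite_nat[OF assms] by blast
  then have "inj_on h S \<and> h ` S \<subseteq> {..<card S}" by (auto simp: bij_betw_def)
  then have "\<exists>f. inj_on f S \<and> f ` S \<subseteq> {..<card S}" by blast
  from someI_ex[OF this] show "inj_on (injlab S) S" "injlab S ` S \<subseteq> {..<card S}" unfolding injlab_def by auto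
qed

locale orient =
  fixes B :: "nat set set" and head :: "nat set \<Rightarrow> nat" and t0 t1 :: nat
begin

definition out :: "nat \<Rightarrow> nat set set" where
  "out u = {e \<in> inc B u. head e \<noteq> u}"

definition tail :: "nat set \<Rightarrow> nat" where
  "tail e = other e (head e)"

definition lb :: "nat set \<Rightarrow> nat" where
  "lb e = injlab (out (tail e)) e"

text \<open>At most one node, but kept as a set because \<open>recolor\<close> takes the set of
  neighbouring colours.\<close>

definition par :: "nat \<Rightarrow> nat \<Rightarrow> nat set" where
  "par j u = head ` {e \<in> out u. lb e = j}"

text \<open>One large reduction brings \<open>t0\<close> bits down to \<open>t1\<close>; then each
  step saves one bit until 8 are left, as \<open>palette 1 t \<le> 2 ^ (t - 1)\<close> needs
  \<open>t \<ge> 9\<close>. This slow descent is affordable because \<open>t1\<close> will be linear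
  in \<open>q\<close>.\<close>

definition bits :: "nat \<Rightarrow> nat" where
  "bits i = (if i = 0 then t0 else t1 - (i - 1))"

primrec nm :: "nat \<Rightarrow> nat \<Rightarrow> nat \<Rightarrow> nat" where
  "nm j 0 = (\<lambda>u. u)"
| "nm j (Suc i) = (\<lambda>u. recolor 1 (bits i) (nm j i u) (nm j i ` par j u))"

definition steps :: nat where "steps = t1 - 7"

text \<open>Among edges with equal label and equal colour of the head, no head is the tail of
  another edge. So the edges of a slot form stars around their heads.\<close>

definition slot :: "nat set \<Rightarrow> nat" where
  "slot e = lb e * 256 + nm (lb e) steps (head e)"

text \<open>The tail breaks ties inside a star and makes the keys injective. It costs no rounds,
  since the centre can treat its whole star at once.\<close>

definition okey :: "nat set \<Rightarrow> nat" where
  "okey e = slot e * 2 ^ t0 + tail e"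

end

locale orient_ok = orient +
  fixes b :: nat
  assumes pairsB: "pairs B" and headB: "\<And>e. e \<in> B \<Longrightarrow> head e \<in> e"
    and outB: "\<And>u. card {e \<in> B. u \<in> e \<and> head e \<noteq> u} \<le> b"
    and small: "\<And>e u. e \<in> B \<Longrightarrow> u \<in> e \<Longrightarrow> u < 2 ^ t0"
    and t0: "1 \<le> t0" and t1: "8 \<le> t1" and t01: "palette 1 t0 \<le> 2 ^ t1"
begin

lemma c2: "e \<in> B \<Longrightarrow> card e = 2" using pairsB by (simp add: pairs_def)
lemma finB: "finite B" using pairsB by (simp add: pairs_def)
lemma fin_out: "finite (out u)" using finite_inc[OF finB] by (simp add: out_def)

lemma out_card: "card (out u) \<le> b"
proof -
  have "out u = {e \<in> B. u \<in> e \<and> head e \<noteq> u}" by (auto simp: out_def inc_def)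
  then show ?thesis using outB by simp
qed

lemma tail: assumes "e \<in> B" shows "tail e \<in> e" "tail e \<noteq> head e" "e = {head e, tail e}" "e \<in> out (tail e)"
proof -
  note o = other_pair[OF c2[OF assms] headB[OF assms]]
  show "tail e \<in> e" "tail e \<noteq> head e" "e = {head e, tail e}" using o(1,2,3) by (simp_all add: tail_def)
  then show "e \<in> out (tail e)" using assms by (simp add: out_def inc_def)
qed

lemma out_tail: "e \<in> out u \<Longrightarrow> e \<in> B \<and> tail e = u"
proof -
  assume "e \<in> out u"
  then have e: "e \<in> B" "u \<in> e" "head e \<noteq> u" by (auto simp: out_def inc_def)
  have "u = other e (head e)" by (rule other_unique[OF c2[OF e(1)] headB[OF e(1)] e(2)]) (use e(3) in blast)
  then show ?thesis using e(1) by (simp add: tail_def)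
qed

lemma lb_less: assumes "e \<in> B" shows "lb e < b"
proof -
  have "injlab (out (tail e)) e \<in> {..<card (out (tail e))}" using injlab(2)[OF fin_out] tail(4)[OF assms] by blast
  then show ?thesis unfolding lb_def using out_card[of "tail e"] by simp
qed

lemma lb_inj: assumes "e \<in> B" "f \<in> B" "tail e = tail f" "lb e = lb f" shows "e = f"
proof -
  have "injlab (out (tail e)) e = injlab (out (tail e)) f" using assms(3,4) by (simp add: lb_def)
  then show ?thesis using inj_onD[OF injlab(1)[OF fin_out]] tail(4)[OF assms(1)] tail(4)[OF assms(2)] assms(3) by metis
qed

lemma par_card: "card (par j u) \<le> 1"
proof -
  have "e = f" if "e \<in> out u" "lb e = j" "f \<in> out u" "lb f = j" for e f
    using lb_inj[of e f] out_tail[OF that(1)] out_tail[OF that(3)] that by simp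
  then have "x = y" if "x \<in> par j u" "y \<in> par j u" for x y using that unfolding par_def by blast
  moreover have "finite (par j u)" using fin_out by (simp add: par_def)
  ultimately show ?thesis using card_le_Suc0_iff_eq by (metis One_nat_def)
qed

lemma par_vert: "x \<in> par j u \<Longrightarrow> x \<in> \<Union>B \<and> x \<noteq> u"
proof -
  assume "x \<in> par j u"
  then obtain e where "e \<in> out u" "x = head e" by (auto simp: par_def)
  then show ?thesis using out_tail headB by (auto simp: out_def)
qed

lemma palette_le: "9 \<le> t \<Longrightarrow> palette 1 t \<le> 2 ^ (t - 1)"
proof -
  assume t: "9 \<le> t"
  have "(t + 9) * (2 * (t + 9) + 1) \<le> 2 ^ (t + 8)" for t :: nat
  proof (induction t)
    case (Suc t)
    have "(Suc t + 9) * (2 * (Suc t + 9) + 1) \<le> 2 * ((t + 9) * (2 * (t + 9) + 1))" by (simp add: algebra_simps)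
    also have "\<dots> \<le> 2 * 2 ^ (t + 8)" using Suc by simp
    also have "\<dots> = 2 ^ (Suc t + 8)" by (simp only: add_Suc power_Suc)
    finally show ?case .
  qed simp
  from this[of "t - 9"] show ?thesis using t by (simp add: palette_def)
qed

lemma bits_step: assumes "i < steps" shows "1 \<le> bits i" "palette 1 (bits i) \<le> 2 ^ bits (Suc i)"
proof -
  show "1 \<le> bits i" using assms t0 t1 by (auto simp: bits_def steps_def)
  show "palette 1 (bits i) \<le> 2 ^ bits (Suc i)"
  proof (cases i)
    case 0 then show ?thesis using t01 by (simp add: bits_def)
  next
    case (Suc j)
    have "bits i = t1 - j" "bits (Suc i) = t1 - j - 1" "9 \<le> t1 - j" using assms Suc by (auto simp: bits_def steps_def)
    then show ?thesis using palette_le by metis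
  qed
qed

text \<open>\<open>recolor_neq\<close> asks only one of two nodes to see the other, so every node
  compares itself with its single parent, however many children it has. This is why degree 1
  suffices in \<open>recolor\<close>.\<close>

lemma nm_inv:
  "i \<le> steps \<Longrightarrow> u \<in> \<Union>B \<Longrightarrow> nm j i u < 2 ^ bits i \<and> (\<forall>x\<in>par j u. nm j i x \<noteq> nm j i u)"
proof (induction i arbitrary: u)
  case 0
  then show ?case using small par_vert by (auto simp: bits_def)
next
  case (Suc i)
  have i: "i < steps" using Suc.prems(1) by simp
  have arg: "nm j i v < 2 ^ bits i" "nm j i ` par j v \<subseteq> {..<2 ^ bits i}" "nm j i v \<notin> nm j i ` par j v"
    "card (nm j i ` par j v) \<le> 1" if v: "v \<in> \<Union>B" for v
  proof -
    have IH: "nm j i z < 2 ^ bits i" "\<forall>x\<in>par j z. nm j i x \<noteq> nm j i z" if "z \<in> \<Union>B" for z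
      using Suc.IH[OF less_imp_le[OF i] that] by auto
    show "nm j i v < 2 ^ bits i" using IH v by blast
    show "nm j i ` par j v \<subseteq> {..<2 ^ bits i}" using IH(1) par_vert by blast
    show "nm j i v \<notin> nm j i ` par j v" using IH(2)[OF v] by (metis imageE)
    have "finite (par j v)" using fin_out by (simp add: par_def)
    then show "card (nm j i ` par j v) \<le> 1" using card_image_le par_card[of j v] le_trans by blast
  qed
  have "nm j (Suc i) u < 2 ^ bits (Suc i)"
    using recolor_less[OF _ bits_step(1)[OF i] arg[OF Suc.prems(2)]] bits_step(2)[OF i] by simp
  moreover have "nm j (Suc i) x \<noteq> nm j (Suc i) u" if x: "x \<in> par j u" for x
  proof -
    have xB: "x \<in> \<Union>B" using par_vert[OF x] by blast
    have "recolor 1 (bits i) (nm j i u) (nm j i ` par j u) \<noteq> recolor 1 (bits i) (nm j i x) (nm j i ` par j x)"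
      by (rule recolor_neq[OF _ bits_step(1)[OF i] arg[OF Suc.prems(2)] _ arg(2-4)[OF xB]]) (use x in simp_all)
    then show ?thesis by simp
  qed
  ultimately show ?case by blast
qed

lemma nm_final: "u \<in> \<Union>B \<Longrightarrow> nm j steps u < 256"
proof -
  assume "u \<in> \<Union>B"
  then have "nm j steps u < 2 ^ bits steps" using nm_inv[of steps u j] by simp
  moreover have "bits steps = 8" using t1 by (auto simp: bits_def steps_def)
  ultimately show ?thesis by simp
qed

lemma head_vert: "e \<in> B \<Longrightarrow> head e \<in> \<Union>B" using headB by blast

lemma slot_less: assumes "e \<in> B" shows "slot e < 256 * b"
proof -
  have "slot e < (lb e + 1) * 256" using nm_final[OF head_vert[OF assms], of "lb e"] by (simp add: slot_def)
  also have "\<dots> \<le> b * 256" using lb_less[OF assms] by (intro mult_le_mono1) simp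
  finally show ?thesis by simp
qed

lemma slot_eq: assumes "e \<in> B" "f \<in> B" "slot e = slot f"
  shows "lb e = lb f" "nm (lb e) steps (head e) = nm (lb e) steps (head f)"
proof -
  have l: "nm (lb e) steps (head e) < 256" "nm (lb f) steps (head f) < 256"
    using nm_final head_vert assms by blast+
  have "slot e div 256 = lb e" "slot f div 256 = lb f" unfolding slot_def using l by simp_all
  then show "lb e = lb f" using assms(3) by simp
  then show "nm (lb e) steps (head e) = nm (lb e) steps (head f)" using assms(3) by (simp add: slot_def)
qed

lemma tail_small: "e \<in> B \<Longrightarrow> tail e < 2 ^ t0" using small tail(1) by blast

lemma okey_mono: assumes "e \<in> B" "f \<in> B" "okey f < okey e" shows "slot f \<le> slot e"
proof (rule ccontr)
  assume "\<not> slot f \<le> slot e"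
  then have "(slot e + 1) * 2 ^ t0 \<le> slot f * 2 ^ t0" by (intro mult_le_mono1) simp
  then have "okey e < okey f" unfolding okey_def using tail_small[OF assms(1)] by simp
  then show False using assms(3) by simp
qed

lemma okey_inj: assumes "e \<in> B" "f \<in> B" "okey f = okey e" shows "f = e"
proof -
  have dm: "(x * 2 ^ t0 + y) div 2 ^ t0 = x" "(x * 2 ^ t0 + y) mod 2 ^ t0 = y" if "y < 2 ^ t0" for x y :: nat
    using that by simp_all
  have "slot f = slot e" "tail f = tail e"
    using dm[OF tail_small[OF assms(1)], of "slot e"] dm[OF tail_small[OF assms(2)], of "slot f"] assms(3)
    unfolding okey_def by metis+
  then show ?thesis using slot_eq(1)[OF assms(2,1)] lb_inj[OF assms(2,1)] by blast
qed

text \<open>A common tail together with the common label would make the edges equal. If the head of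
  one were the tail of the other, that node and its own parent would carry the same colour.\<close>

lemma star: assumes e: "e \<in> B" and f: "f \<in> adj B e" and s: "slot f = slot e" shows "head f = head e"
proof -
  have fB: "f \<in> B" "f \<noteq> e" using f by (auto simp: adj_def)
  obtain x where x: "x \<in> f" "x \<in> e" using f by (auto simp: adj_def)
  note sl = slot_eq[OF fB(1) e s]
  have no: False if g: "g \<in> B" "h \<in> B" "head g = tail h" "lb g = lb h" "nm (lb g) steps (head g) = nm (lb g) steps (head h)" for g h
  proof -
    have "head h \<in> par (lb h) (tail h)" unfolding par_def using tail(4)[OF g(2)] by blast
    then have "nm (lb h) steps (head h) \<noteq> nm (lb h) steps (tail h)"
      using nm_inv[of steps "tail h" "lb h"] tail(1)[OF g(2)] g(2) by blast
    then show False using g by simp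
  qed
  have "x = head e \<or> x = tail e" "x = head f \<or> x = tail f" using x tail(3)[OF e] tail(3)[OF fB(1)] by blast+
  then consider "head f = head e" | "tail f = tail e" | "head f = tail e" | "head e = tail f" by metis
  then show ?thesis
  proof cases
    case 2 then show ?thesis using lb_inj[OF fB(1) e] sl(1) fB(2) by blast
  next
    case 3 then show ?thesis using no[OF fB(1) e] sl by simp
  next
    case 4 then show ?thesis using no[OF e fB(1)] sl by simp
  qed simp
qed

end

section \<open>Locality of the colouring of the oriented edges\<close>

context agreement
begin

lemma out_sim:
  assumes "hsim t B B'" "esim t head head'" shows "nsim t (orient.out B head) (orient.out B' head')"
proof (rule nsimI)
  fix v assume v: "v \<in> A t"
  have "head e = head' e" if "e \<in> inc B v" for e
    using esimD[OF assms(2) v] that hsim_sub(1)[OF assms(1)] by (auto simp: inc_def)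
  then show "orient.out B head v = orient.out B' head' v"
    unfolding orient.out_def hsim_inc[OF assms(1) v, symmetric]
    by (intro Collect_cong conj_cong refl) simp
qed

lemma tail_sim: assumes "esim t head head'" shows "esim t (orient.tail head) (orient.tail head')"
  using assms by (simp add: esim_def orient.tail_def)

lemma lb_sim:
  assumes "hsim t B B'" "esim t head head'" "\<And>e. e \<in> B \<Longrightarrow> head e \<in> e"
    and v: "v \<in> A (Suc t)" and e: "e \<in> B" "v \<in> e"
  shows "orient.lb B head e = orient.lb B' head' e"
proof -
  have eE: "e \<in> E" using e(1) hsim_sub(1)[OF assms(1)] by blast
  have tail: "orient.tail head e = orient.tail head' e"
    by (rule esimD[OF tail_sim[OF assms(2)] _ eE e(2)]) (use A_leD[OF v] in simp)
  have "orient.tail head e \<in> e" unfolding orient.tail_def by (rule other_in[OF eE assms(3)[OF e(1)]])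
  then have "orient.tail head e \<in> A t" by (rule nb[OF v eE e(2)])
  then show ?thesis unfolding orient.lb_def tail[symmetric] using nsimD[OF out_sim[OF assms(1,2)]] by simp
qed

lemma par_sim:
  assumes "hsim t B B'" "esim t head head'" "\<And>e. e \<in> B \<Longrightarrow> head e \<in> e"
  shows "nsim (Suc t) (orient.par B head j) (orient.par B' head' j)"
proof (rule nsimI)
  fix v assume v: "v \<in> A (Suc t)"
  have vt: "v \<in> A t" using A_leD[OF v] by simp
  have o: "orient.out B head v = orient.out B' head' v" by (rule nsimD[OF out_sim[OF assms(1,2)] vt])
  have B: "e \<in> B" "v \<in> e" "e \<in> E" if "e \<in> orient.out B head v" for e
    using that hsim_sub(1)[OF assms(1)] by (auto simp: orient.out_def inc_def)
  have "{e \<in> orient.out B head v. orient.lb B head e = j} = {e \<in> orient.out B head v. orient.lb B' head' e = j}"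
    using lb_sim[OF assms v] B by (intro Collect_cong) (metis (no_types, lifting))
  moreover have "head e = head' e" if "e \<in> orient.out B head v" for e using esimD[OF assms(2) vt] B[OF that] by blast
  ultimately show "orient.par B head j v = orient.par B' head' j v"
    unfolding orient.par_def o[symmetric] by (intro image_cong) auto
qed

lemma nm_sim:
  assumes "hsim t B B'" "esim t head head'" "\<And>e. e \<in> B \<Longrightarrow> head e \<in> e"
  shows "nsim (Suc t + i) (orient.nm B head t0 t1 j i) (orient.nm B' head' t0 t1 j i)"
proof (induction i)
  case 0 then show ?case by (simp add: nsim_def orient.nm.simps)
next
  case (Suc i)
  show ?case
  proof (rule nsimI)
    fix v assume v: "v \<in> A (Suc t + Suc i)"
    have v1: "v \<in> A (Suc t)" "v \<in> A (Suc t + i)" using A_leD[OF v] by simp_all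
    have p: "orient.par B head j v = orient.par B' head' j v" by (rule nsimD[OF par_sim[OF assms] v1(1)])
    have "x \<in> A (Suc t + i)" if x: "x \<in> orient.par B head j v" for x
    proof -
      obtain e where e: "e \<in> B" "v \<in> e" "x = head e" using x by (auto simp: orient.par_def orient.out_def inc_def)
      have eE: "e \<in> E" using e(1) hsim_sub(1)[OF assms(1)] by blast
      show ?thesis by (rule nb[OF _ eE e(2)]) (use v e assms(3) in auto)
    qed
    then have "orient.nm B head t0 t1 j i ` orient.par B head j v = orient.nm B' head' t0 t1 j i ` orient.par B head j v"
      using nsimD[OF Suc] by (intro image_cong refl) blast
    then show "orient.nm B head t0 t1 j (Suc i) v = orient.nm B' head' t0 t1 j (Suc i) v"
      using nsimD[OF Suc v1(2)] p by (simp add: orient.nm.simps)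
  qed
qed

lemma slot_sim:
  assumes "hsim t B B'" "esim t head head'" "\<And>e. e \<in> B \<Longrightarrow> head e \<in> e"
    and v: "v \<in> A (t + 2 + orient.steps t1)" and e: "e \<in> B" "v \<in> e"
  shows "orient.slot B head t0 t1 e = orient.slot B' head' t0 t1 e"
proof -
  have eE: "e \<in> E" using e(1) hsim_sub(1)[OF assms(1)] by blast
  have v1: "v \<in> A (Suc t)" by (rule A_leD[OF v]) simp
  have l: "orient.lb B head e = orient.lb B' head' e" by (rule lb_sim[OF assms(1-3) v1 e])
  have h: "head e = head' e" by (rule esimD[OF assms(2) _ eE e(2)]) (use A_leD[OF v] in simp)
  have "head e \<in> A (Suc t + orient.steps t1)"
    using nb[of v "Suc t + orient.steps t1", OF _ eE e(2) assms(3)[OF e(1)]] v by simp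
  then show ?thesis unfolding orient.slot_def h[symmetric] l[symmetric]
    using nsimD[OF nm_sim[OF assms(1-3)]] by simp
qed

text \<open>Within one slot the greedy procedure runs through stars, each of which is seen
  completely from its centre, so a whole slot costs only three rounds.\<close>

lemma gcol_star_sim:
  assumes H: "hsim t B B'" and L: "\<And>v e. v \<in> A t \<Longrightarrow> e \<in> B \<Longrightarrow> v \<in> e \<Longrightarrow> L e = L' e"
    and K: "\<And>v e. v \<in> A t \<Longrightarrow> e \<in> B \<Longrightarrow> v \<in> e \<Longrightarrow> key e = key' e"
    and head: "\<And>e. e \<in> B \<Longrightarrow> head e \<in> e"
    and mono: "\<And>e f. e \<in> B \<Longrightarrow> f \<in> B \<Longrightarrow> key f < key e \<Longrightarrow> slot f \<le> slot e"
    and star: "\<And>e f. e \<in> B \<Longrightarrow> f \<in> adj B e \<Longrightarrow> slot f = slot e \<Longrightarrow> head f = head e"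
  shows "e \<in> B \<Longrightarrow> v \<in> e \<Longrightarrow> v \<in> A (t + 3 * slot e + 3) \<Longrightarrow> gcol B L key e = gcol B' L' key' e"
proof (induction "slot e" arbitrary: e v rule: less_induct)
  case less
  define s where "s = slot e"
  have BE: "f \<in> E" if "f \<in> B" for f using that hsim_sub(1)[OF H] by blast
  \<comment> \<open>The inner induction follows the keys inside the star at \<open>h\<close>. The
    centre, and with it the radius, stays fixed; only edges of earlier slots are referred to the
    outer induction, with a smaller radius.\<close>
  have centre: "gcol B L key f = gcol B' L' key' f"
    if "f \<in> B" "slot f = s" "head f = h" "h \<in> A (t + 3 * s + 2)" for f h using that
  proof (induction "key f" arbitrary: f rule: less_induct)
    case inner: less
    note f = inner.prems
    have hf: "h \<in> f" using head[OF f(1)] f(3) by simp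
    have ht: "h \<in> A t" "h \<in> A (Suc (t + 3 * s + 1))" using A_leD[OF f(4)] by simp_all
    have fB': "f \<in> B'" using hsim_mem[OF H ht(1) hf] f(1) by blast
    have a: "adj B f = adj B' f" by (rule adj_eq[OF hsim_le[OF H] ht(2) BE[OF f(1)] hf]) simp
    have kf: "key f = key' f" by (rule K[OF ht(1) f(1) hf])
    have Lf: "L f = L' f" by (rule L[OF ht(1) f(1) hf])
    have g: "key g = key' g" "key g < key f \<Longrightarrow> gcol B L key g = gcol B' L' key' g" if gA: "g \<in> adj B f" for g
    proof -
      have gB: "g \<in> B" using gA by (simp add: adj_def)
      obtain x where x: "x \<in> g" "x \<in> f" using gA by (auto simp: adj_def)
      have xA: "x \<in> A (t + 3 * s + 1)" by (rule nb[OF ht(2) BE[OF f(1)] hf x(2)])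
      show "key g = key' g" by (rule K[OF _ gB x(1)]) (use A_leD[OF xA] in simp)
      assume lt: "key g < key f"
      have le: "slot g \<le> s" using mono[OF f(1) gB lt] f(2) by simp
      show "gcol B L key g = gcol B' L' key' g"
      proof (cases "slot g = s")
        case True
        then have "head g = h" using star[OF f(1) gA] f(2,3) by simp
        then show ?thesis using inner.hyps[OF lt gB True] f(4) by simp
      next
        case False
        then have "slot g < slot e" using le s_def by simp
        moreover have "x \<in> A (t + 3 * slot g + 3)" by (rule A_leD[OF xA]) (use False le in simp)
        ultimately show ?thesis using less.hyps[OF _ gB x(1)] by blast
      qed
    qed
    show ?case unfolding gcol_rec[OF f(1)] gcol_rec[OF fB'] a[symmetric] kf[symmetric] Lf[symmetric]
      using g by (intro arg_cong[where f = Least] ext) (metis (no_types, lifting))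
  qed
  have "v \<in> A (Suc (t + 3 * s + 2))" using A_leD[OF less.prems(3)] by (simp add: s_def)
  then have "head e \<in> A (t + 3 * s + 2)" by (rule nb[OF _ BE[OF less.prems(1)] less.prems(2) head[OF less.prems(1)]])
  then show ?case using centre[OF less.prems(1)] s_def by blast
qed

end

section \<open>The complete algorithm\<close>

text \<open>In a graph \<open>T\<close> these are the nodes at distance one or two from
  \<open>v\<close>.\<close>

definition nb2 :: "nat set set \<Rightarrow> nat \<Rightarrow> nat set" where
  "nb2 T v = {u. u \<noteq> v \<and> (\<exists>e\<in>T. \<exists>f\<in>T. v \<in> e \<and> u \<in> f \<and> e \<inter> f \<noteq> {})}"

lemma nb2_card:
  assumes "pairs T" "\<And>v. card (inc T v) \<le> k"
  shows "card (nb2 T v) \<le> 4 * k * k" "finite (nb2 T v)"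
proof -
  have fin: "finite (inc T x)" for x using assms(1) by (simp add: pairs_def finite_inc)
  have c2: "card e = 2 \<and> finite e" if "e \<in> inc T x" for e x
  proof -
    have "card e = 2" using that assms(1) by (auto simp: pairs_def inc_def)
    then show ?thesis using card.infinite[of e] by fastforce
  qed
  let ?U = "\<Union>e\<in>inc T v. \<Union>x\<in>e. \<Union>f\<in>inc T x. f"
  have sub: "nb2 T v \<subseteq> ?U"
  proof
    fix u assume "u \<in> nb2 T v"
    then obtain e f x where "e \<in> T" "f \<in> T" "v \<in> e" "u \<in> f" "x \<in> e" "x \<in> f" unfolding nb2_def by blast
    then show "u \<in> ?U" unfolding inc_def by blast
  qed
  have finU: "finite ?U" using fin c2 by (intro finite_UN_I) auto
  then show "finite (nb2 T v)" using sub finite_subset by blast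
  have "card (nb2 T v) \<le> card ?U" by (rule card_mono[OF finU sub])
  also have "\<dots> \<le> (\<Sum>e\<in>inc T v. card (\<Union>x\<in>e. \<Union>f\<in>inc T x. f))" by (rule card_UN_le[OF fin])
  also have "\<dots> \<le> (\<Sum>e\<in>inc T v. 2 * (k * 2))"
  proof (rule sum_mono)
    fix e assume e: "e \<in> inc T v"
    have "card (\<Union>x\<in>e. \<Union>f\<in>inc T x. f) \<le> (\<Sum>x\<in>e. card (\<Union>f\<in>inc T x. f))" using c2[OF e] by (intro card_UN_le) simp
    also have "\<dots> \<le> (\<Sum>x\<in>e. k * 2)"
    proof (rule sum_mono)
      fix x
      have "card (\<Union>f\<in>inc T x. f) \<le> (\<Sum>f\<in>inc T x. card f)" by (rule card_UN_le[OF fin])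
      also have "\<dots> = (\<Sum>f\<in>inc T x. 2)" using c2 by (intro sum.cong) auto
      also have "\<dots> \<le> k * 2" using assms(2)[of x] by simp
      finally show "card (\<Union>f\<in>inc T x. f) \<le> k * 2" .
    qed
    also have "\<dots> = 2 * (k * 2)" using c2[OF e] by simp
    finally show "card (\<Union>x\<in>e. \<Union>f\<in>inc T x. f) \<le> 2 * (k * 2)" .
  qed
  also have "\<dots> = card (inc T v) * (2 * (k * 2))" by simp
  also have "\<dots> \<le> k * (2 * (k * 2))" by (rule mult_le_mono1[OF assms(2)])
  finally show "card (nb2 T v) \<le> 4 * k * k" by simp
qed

definition peel_rounds :: "nat \<Rightarrow> nat" where "peel_rounds q = q ^ 12 + 1"
text \<open>Identifiers are at most \<open>n ^ c \<le> 2 ^ (c * q ^ 13)\<close>; the additional bit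
  makes the inequality strict.\<close>

definition id_bits :: "nat \<Rightarrow> nat \<Rightarrow> nat" where "id_bits c q = c * q ^ 13 + 1"
text \<open>This is \<open>2 * (4 * q + 6) + 2 * (13 * q + c) + 2\<close>, the exponent in
  \<open>palette_bound\<close> for degree \<open>2 ^ (4 * q + 6)\<close> and identifier length at
  most \<open>2 ^ (13 * q + c)\<close>.\<close>

definition chi_bits :: "nat \<Rightarrow> nat \<Rightarrow> nat" where "chi_bits c q = 34 * q + 2 * c + 14"
text \<open>The same exponent for degree 1 is \<open>2 * (13 * q + c) + 2\<close>; it is enlarged so
  that it is always at least 8.\<close>

definition name_bits :: "nat \<Rightarrow> nat \<Rightarrow> nat" where "name_bits c q = 26 * q + 2 * c + 8"

locale algo =
  fixes c q a :: nat and E :: "nat set set"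
begin

definition low :: "nat set set" where
  "low = peel.low E a (4 * a * 2 ^ q) (peel_rounds q)"

definition hd_of :: "nat set \<Rightarrow> nat" where
  "hd_of = peel.head_of E a (4 * a * 2 ^ q) (peel_rounds q)"

definition chi :: "nat \<Rightarrow> nat" where
  "chi v = recolor (2 ^ (4 * q + 6)) (id_bits c q) v (nb2 low v)"

definition lcol :: "nat set \<Rightarrow> nat" where
  "lcol = loop.tcol low chi (chi_bits c q) (2 * q + 5)"

definition hlist :: "nat set \<Rightarrow> nat set" where
  "hlist e = {1..card (adj E e) + 1} - lcol ` adj low e"

definition hkey :: "nat set \<Rightarrow> nat" where
  "hkey = orient.okey (E - low) hd_of (id_bits c q) (name_bits c q)"

definition col :: "nat set \<Rightarrow> nat" where
  "col e = (if e \<in> low then lcol e else gcol (E - low) hlist hkey e)"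

end

text \<open>\<open>1536 = 3 * 256 * 2\<close>: three rounds for each of the
  \<open>256 * (2 * a)\<close> slots.\<close>

definition rad :: "nat \<Rightarrow> nat \<Rightarrow> nat \<Rightarrow> nat" where
  "rad c q a = 8 + 2 * peel_rounds q + lrad (chi_bits c q) (2 * q + 5) + name_bits c q + 1536 * a"

text \<open>\<open>recolor\<close> yields a number of colours polynomial in the bit length of
  identifiers, so only the logarithm of that length enters the new bit length, and it is linear in
  \<open>q\<close>.\<close>

lemma id_bits_le: "1 \<le> q \<Longrightarrow> id_bits c q \<le> 2 ^ (13 * q + c)"
proof -
  assume q: "1 \<le> q"
  have "q \<le> 2 ^ q" by (rule less_imp_le[OF less_exp])
  then have "q ^ 13 \<le> (2 ^ q) ^ 13" by (rule power_mono) simp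
  then have 1: "q ^ 13 \<le> 2 ^ (13 * q)" by (simp only: power_mult[symmetric] mult.commute)
  have "c + 1 \<le> 2 ^ c" using less_exp[of c] by (simp only: Suc_eq_plus1[symmetric] Suc_le_eq)
  moreover have "1 \<le> q ^ 13" using q by simp
  then have "id_bits c q \<le> (c + 1) * q ^ 13" unfolding id_bits_def by simp
  ultimately have "id_bits c q \<le> 2 ^ c * 2 ^ (13 * q)" using mult_le_mono[OF _ 1] le_trans by blast
  then show ?thesis by (simp add: power_add mult.commute)
qed

lemma palette_bound:
  assumes "1 \<le> D" "D \<le> 2 ^ x" "1 \<le> t" "t \<le> 2 ^ y"
  shows "palette D t \<le> 2 ^ (2 * x + 2 * y + 2)"
proof -
  have 1: "D * t \<le> 2 ^ (x + y)" using assms by (simp add: power_add mult_le_mono)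
  have "1 \<le> D * t" using assms by simp
  then have "2 * (D * t) + 1 \<le> 4 * (D * t)" by simp
  also have "\<dots> \<le> 4 * 2 ^ (x + y)" using 1 by simp
  finally have "palette D t \<le> 2 ^ (x + y) * (4 * 2 ^ (x + y))" unfolding palette_def using 1 by (rule mult_le_mono[rotated])
  also have "\<dots> = 2 ^ (2 * x + 2 * y + 2)" by (simp add: power_add power_mult power2_eq_square algebra_simps)
  finally show ?thesis .
qed

locale algo_ok = algo +
  fixes V :: "nat set"
  assumes pairsE: "pairs E" and finV: "finite V" and EV: "\<And>e. e \<in> E \<Longrightarrow> e \<subseteq> V"
    and dens: "\<And>X. finite X \<Longrightarrow> card {e \<in> E. e \<subseteq> X} \<le> a * card X"
    and q1: "1 \<le> q" and aq: "a \<le> 2 ^ q" and nq: "card V \<le> 2 ^ (q ^ 13)"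
    and ids: "\<And>v. v \<in> V \<Longrightarrow> v < 2 ^ id_bits c q"
begin

sublocale pe: peel_ok E a "4 * a * 2 ^ q" "peel_rounds q" V "2 ^ q"
proof
  have "q * q ^ 12 = q ^ 13" by (simp flip: power_Suc)
  then have "q * peel_rounds q = q ^ 13 + q" unfolding peel_rounds_def by (simp only: distrib_left mult_1_right)
  then have "((2::nat) ^ q) ^ peel_rounds q = 2 ^ (q ^ 13 + q)" by (simp flip: power_mult)
  moreover have "(2::nat) ^ (q ^ 13) < 2 ^ (q ^ 13 + q)" using q1 by (intro power_strict_increasing) auto
  ultimately show "card V < (2 ^ q) ^ peel_rounds q" using nq by linarith
qed (use pairsE finV EV dens in auto)

lemma low_eq: "low = pe.low" by (simp add: low_def)
lemma low_sub: "low \<subseteq> E" by (auto simp: low_eq pe.low_def)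
lemma pairs_low: "pairs low" using pairs_subset[OF pairsE low_sub] .
lemma hd_eq: "hd_of = pe.head_of" by (simp add: hd_of_def)

lemma k_le: "4 * a * 2 ^ q \<le> 2 ^ (2 * q + 2)"
proof -
  have "4 * a * 2 ^ q \<le> 4 * 2 ^ q * 2 ^ q" using aq by simp
  also have "\<dots> = 2 ^ (2 * q + 2)" by (simp add: power_add power_mult power2_eq_square mult_2 algebra_simps)
  finally show ?thesis .
qed

lemma id1: "1 \<le> id_bits c q" by (simp add: id_bits_def)

lemma nb2_low: "card (nb2 low v) \<le> 2 ^ (4 * q + 6)" "finite (nb2 low v)"
proof -
  note n = nb2_card[OF pairs_low, of "4 * a * 2 ^ q" v, unfolded low_eq, OF pe.low_deg]
  show "finite (nb2 low v)" using n(2) by (simp add: low_eq)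
  have "4 * (4 * a * 2 ^ q) * (4 * a * 2 ^ q) \<le> 4 * 2 ^ (2 * q + 2) * 2 ^ (2 * q + 2)" by (intro mult_le_mono k_le) simp
  also have "\<dots> = 2 ^ (4 * q + 6)"
  proof -
    have "(4::nat) * 2 ^ (2 * q + 2) * 2 ^ (2 * q + 2) = 2 ^ 2 * 2 ^ (2 * q + 2) * 2 ^ (2 * q + 2)" by simp
    also have "\<dots> = 2 ^ (2 + (2 * q + 2) + (2 * q + 2))" by (simp only: power_add)
    also have "2 + (2 * q + 2) + (2 * q + 2) = 4 * q + 6" by simp
    finally show ?thesis .
  qed
  finally show "card (nb2 low v) \<le> 2 ^ (4 * q + 6)" using n(1) unfolding low_eq by linarith
qed

lemma chi_arg:
  assumes "v \<in> V"
  shows "v < 2 ^ id_bits c q" "nb2 low v \<subseteq> {..<2 ^ id_bits c q}" "v \<notin> nb2 low v" "card (nb2 low v) \<le> 2 ^ (4 * q + 6)"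
proof -
  show "v < 2 ^ id_bits c q" by (rule ids[OF assms])
  have "u \<in> V" if "u \<in> nb2 low v" for u using that low_sub EV unfolding nb2_def by blast
  then show "nb2 low v \<subseteq> {..<2 ^ id_bits c q}" using ids by blast
  show "v \<notin> nb2 low v" by (simp add: nb2_def)
qed (rule nb2_low)

lemma D1: "1 \<le> (2::nat) ^ (4 * q + 6)" by simp

lemma lo: "loop_ok low chi (chi_bits c q) (2 * q + 5)"
proof
  show "pairs low" by (rule pairs_low)
  show "1 \<le> chi_bits c q" by (simp add: chi_bits_def)
  show "5 \<le> 2 * q + 5" by simp
  show "card (adj low e) + 1 < 2 ^ (2 * q + 5)" if e: "e \<in> low" for e
  proof -
    obtain u v where uv: "e = {u, v}" "u \<noteq> v" using pairs_low e by (auto simp: pairs_def card_2_iff)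
    have "card (adj low e) + 2 = card (inc low u) + card (inc low v)"
      using card_adj[OF pairs_low e] uv by (simp add: esum_def)
    also have "\<dots> \<le> 2 ^ (2 * q + 2) + 2 ^ (2 * q + 2)"
      using pe.low_deg[of u] pe.low_deg[of v] k_le unfolding low_eq by linarith
    also have "\<dots> \<le> 2 ^ (2 * q + 5)" by (simp add: power_add)
    finally show ?thesis by simp
  qed
  show "chi v < 2 ^ chi_bits c q" if "e \<in> low" "v \<in> e" for e v
  proof -
    have v: "v \<in> V" using that low_sub EV by blast
    have "chi v < palette (2 ^ (4 * q + 6)) (id_bits c q)" unfolding chi_def by (rule recolor_less[OF D1 id1 chi_arg[OF v]])
    also have "\<dots> \<le> 2 ^ (2 * (4 * q + 6) + 2 * (13 * q + c) + 2)"
      by (rule palette_bound[OF D1 _ id1 id_bits_le[OF q1]]) simp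
    also have "2 * (4 * q + 6) + 2 * (13 * q + c) + 2 = chi_bits c q" by (simp add: chi_bits_def)
    finally show ?thesis .
  qed
  show "chi u \<noteq> chi v" if "e \<in> low" "f \<in> low" "e \<inter> f \<noteq> {}" "u \<in> e" "v \<in> f" "u \<noteq> v" for e f u v
  proof -
    have V: "u \<in> V" "v \<in> V" using that low_sub EV by blast+
    have "v \<in> nb2 low u" unfolding nb2_def using that by blast
    then show ?thesis unfolding chi_def by (rule recolor_neq[OF D1 id1 chi_arg[OF V(1)] _ chi_arg(2-4)[OF V(2)]])
  qed
qed

lemma oo: "orient_ok (E - low) hd_of (id_bits c q) (name_bits c q) (2 * a)"
proof
  show "pairs (E - low)" using pairs_subset[OF pairsE] by blast
  show "hd_of e \<in> e" if "e \<in> E - low" for e using pe.not_low(1) that by (simp add: low_eq hd_eq)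
  show "card {e \<in> E - low. u \<in> e \<and> hd_of e \<noteq> u} \<le> 2 * a" for u using pe.out_deg by (simp add: low_eq hd_eq)
  show "u < 2 ^ id_bits c q" if "e \<in> E - low" "u \<in> e" for e u using ids EV that by blast
  show "1 \<le> id_bits c q" by (rule id1)
  show "8 \<le> name_bits c q" by (simp add: name_bits_def)
  have "palette 1 (id_bits c q) \<le> 2 ^ (2 * 0 + 2 * (13 * q + c) + 2)"
    by (rule palette_bound[OF _ _ id1 id_bits_le[OF q1]]) simp_all
  also have "\<dots> \<le> 2 ^ name_bits c q" by (intro power_increasing) (simp_all add: name_bits_def)
  finally show "palette 1 (id_bits c q) \<le> 2 ^ name_bits c q" .
qed

interpretation lo: loop_ok low chi "chi_bits c q" "2 * q + 5" by (rule lo)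
interpretation oo: orient_ok "E - low" hd_of "id_bits c q" "name_bits c q" "2 * a" by (rule oo)

text \<open>The low neighbours remove at most one colour each from
  \<open>card (adj E e) + 1\<close>, which leaves more colours than there are neighbours outside
  \<open>low\<close>. Equal keys do not occur, the keys being injective.\<close>

lemma hcol:
  assumes e: "e \<in> E - low"
  shows "gcol (E - low) hlist hkey e \<in> hlist e"
    and "\<And>f. f \<in> adj (E - low) e \<Longrightarrow> gcol (E - low) hlist hkey f \<noteq> gcol (E - low) hlist hkey e"
proof -
  have fin: "finite (E - low)" "finite E" using pe.finE by auto
  have size: "card {f \<in> adj (E - low) e. hkey f < hkey e \<and> hlist f \<inter> hlist e \<noteq> {}} < card (hlist e)"
    if "e \<in> E - low" for e
  proof -
    have "adj E e = adj low e \<union> adj (E - low) e" "adj low e \<inter> adj (E - low) e = {}"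
      using low_sub by (auto simp: adj_def)
    then have "card (adj E e) = card (adj low e) + card (adj (E - low) e)"
      using card_Un_disjoint[OF finite_adj finite_adj, of low "E - low" e e] fin finite_subset[OF low_sub fin(2)] by simp
    moreover have "card {1..card (adj E e) + 1} - card (lcol ` adj low e) \<le> card (hlist e)"
      unfolding hlist_def using finite_adj[OF finite_subset[OF low_sub fin(2)]] by (intro diff_card_le_card_Diff) simp
    moreover have "card (lcol ` adj low e) \<le> card (adj low e)"
      by (rule card_image_le[OF finite_adj[OF finite_subset[OF low_sub fin(2)]]])
    moreover have "card {f \<in> adj (E - low) e. hkey f < hkey e \<and> hlist f \<inter> hlist e \<noteq> {}} \<le> card (adj (E - low) e)"
      using finite_adj[OF fin(1)] by (intro card_mono) auto
    ultimately show ?thesis by simp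
  qed
  have same: "hlist f \<inter> hlist e = {}" if "e \<in> E - low" "f \<in> adj (E - low) e" "hkey f = hkey e" for e f
  proof -
    have f: "f \<in> E - low" "f \<noteq> e" using that(2) by (auto simp: adj_def)
    have "f = e" by (rule oo.okey_inj[OF that(1) f(1)]) (use that(3) in \<open>simp add: hkey_def\<close>)
    then show ?thesis using f(2) by blast
  qed
  show "gcol (E - low) hlist hkey e \<in> hlist e" by (rule gcol_proper(1)[OF fin(1) size same e])
  show "gcol (E - low) hlist hkey f \<noteq> gcol (E - low) hlist hkey e" if "f \<in> adj (E - low) e" for f
    by (rule gcol_proper(2)[OF fin(1) size same e that])
qed

lemma col_range: assumes "e \<in> E" shows "1 \<le> col e" "col e \<le> card (adj E e) + 1"
proof -
  have "1 \<le> col e \<and> col e \<le> card (adj E e) + 1"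
  proof (cases "e \<in> low")
    case True
    have "card (adj low e) \<le> card (adj E e)" by (intro card_mono finite_adj pe.finE adj_mono low_sub)
    then show ?thesis using lo.tcol_proper(1,2)[OF True] True by (simp add: col_def lcol_def)
  next
    case False
    then show ?thesis using hcol(1)[of e] assms by (simp add: col_def hlist_def)
  qed
  then show "1 \<le> col e" "col e \<le> card (adj E e) + 1" by auto
qed

lemma col_neq_aux: assumes "e \<in> E - low" "f \<in> low" "f \<in> adj E e" shows "col f \<noteq> col e"
proof -
  have "f \<in> adj low e" using assms by (simp add: adj_def)
  then have "lcol f \<in> lcol ` adj low e" by (rule imageI)
  moreover have "gcol (E - low) hlist hkey e \<notin> lcol ` adj low e" using hcol(1)[OF assms(1)] by (simp add: hlist_def)
  ultimately have "lcol f \<noteq> gcol (E - low) hlist hkey e" by metis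
  then show ?thesis using assms by (simp add: col_def)
qed

lemma col_neq: assumes "e \<in> E" "f \<in> adj E e" shows "col f \<noteq> col e"
proof -
  have f: "f \<in> E" "e \<in> adj E f" using assms by (auto simp: adj_def)
  consider "e \<in> low" "f \<in> low" | "e \<in> E - low" "f \<in> low" | "e \<in> low" "f \<in> E - low" | "e \<in> E - low" "f \<in> E - low"
    using assms(1) f(1) by blast
  then show ?thesis
  proof cases
    case 1
    then have "f \<in> adj low e" using assms(2) by (simp add: adj_def)
    then show ?thesis using lo.tcol_proper(3)[OF 1(1)] 1 by (simp add: col_def lcol_def)
  next
    case 2 then show ?thesis using col_neq_aux assms by blast
  next
    case 3 then show ?thesis using col_neq_aux[OF 3(2,1) f(2)] by simp
  next
    case 4
    then have "f \<in> adj (E - low) e" using assms(2) by (simp add: adj_def)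
    then show ?thesis using hcol(2)[OF 4(1)] 4 by (simp add: col_def)
  qed
qed

text \<open>The radii of the successive pieces of the construction add up to \<open>rad\<close>.
  \<open>E'\<close> stands for the edges that one node knows, on which it evaluates the same
  definitions.\<close>

lemma col_local:
  assumes ag: "agreement E E' A" and v: "v \<in> A (rad c q a)" and e: "e \<in> E" "v \<in> e"
  shows "col e = algo.col c q a E' e"
proof -
  interpret ag: agreement E E' A by (rule ag)
  define t where "t = 3 + 2 * peel_rounds q"
  let ?low' = "algo.low q a E'" and ?hd' = "algo.hd_of q a E'" and ?chi' = "algo.chi c q a E'"
  let ?lcol' = "algo.lcol c q a E'" and ?hlist' = "algo.hlist c q a E'" and ?hkey' = "algo.hkey c q a E'"
  have L: "ag.hsim t low ?low'" unfolding low_def algo.low_def t_def by (rule ag.low_sim)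
  have Hd: "ag.esim t hd_of ?hd'" unfolding hd_of_def algo.hd_of_def t_def by (rule ag.head_sim)
  have X: "ag.nsim (Suc (Suc t)) chi ?chi'"
  proof (rule ag.nsimI)
    fix x assume x: "x \<in> A (Suc (Suc t))"
    have x1: "x \<in> A t" using ag.A_leD[OF x] by simp
    have m: "g \<in> low \<longleftrightarrow> g \<in> ?low'" if "x \<in> g" for g by (rule ag.hsim_mem[OF L x1 that])
    have m2: "f \<in> low \<longleftrightarrow> f \<in> ?low'" if g: "g \<in> low" "x \<in> g" "g \<inter> f \<noteq> {}" for f g
    proof -
      obtain y where y: "y \<in> g" "y \<in> f" using g(3) by blast
      have "g \<in> E" using g(1) low_sub by blast
      then have "y \<in> A (Suc t)" using ag.nb[OF x _ g(2) y(1)] by blast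
      then have "y \<in> A t" using ag.A_leD by simp
      then show ?thesis by (rule ag.hsim_mem[OF L _ y(2)])
    qed
    have "(\<exists>e\<in>low. \<exists>f\<in>low. x \<in> e \<and> u \<in> f \<and> e \<inter> f \<noteq> {}) \<longleftrightarrow>
        (\<exists>e\<in>?low'. \<exists>f\<in>?low'. x \<in> e \<and> u \<in> f \<and> e \<inter> f \<noteq> {})" (is "?l \<longleftrightarrow> ?r") for u
    proof
      assume ?l
      then obtain g f where gf: "g \<in> low" "f \<in> low" "x \<in> g" "u \<in> f" "g \<inter> f \<noteq> {}" by blast
      have "g \<in> ?low'" "f \<in> ?low'" using m[OF gf(3)] m2[OF gf(1,3,5)] gf(1,2) by simp_all
      then show ?r using gf by blast
    next
      assume ?r
      then obtain g f where gf: "g \<in> ?low'" "f \<in> ?low'" "x \<in> g" "u \<in> f" "g \<inter> f \<noteq> {}" by blast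
      have g: "g \<in> low" using m[OF gf(3)] gf(1) by simp
      have "f \<in> low" using m2[OF g gf(3,5)] gf(2) by simp
      then show ?l using gf g by blast
    qed
    then have "nb2 low x = nb2 ?low' x" unfolding nb2_def by simp
    then show "chi x = ?chi' x" unfolding chi_def algo.chi_def by simp
  qed
  define t2 where "t2 = Suc (Suc t) + lrad (chi_bits c q) (2 * q + 5)"
  have C: "ag.esim t2 lcol ?lcol'" unfolding lcol_def algo.lcol_def t2_def
    by (rule ag.tcol_sim[OF X ag.hsim_le[OF L] lo]) simp
  have L2: "ag.hsim t2 low ?low'" by (rule ag.hsim_le[OF L]) (simp add: t2_def)
  have E2: "ag.hsim t2 E E'" by (rule ag.hsim_le[OF ag.hsim_base]) (simp add: t2_def)
  define t3 where "t3 = t2 + 3 + name_bits c q"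
  have hl: "hlist f = ?hlist' f" if "x \<in> A t3" "f \<in> E" "x \<in> f" for x f
  proof -
    have x: "x \<in> A (Suc t2)" by (rule ag.A_leD[OF that(1)]) (simp add: t3_def)
    have "lcol ` adj low f = ?lcol' ` adj ?low' f" by (rule ag.esimD[OF ag.adj_image_sim[OF L2 C] x that(2,3)])
    then show ?thesis unfolding hlist_def algo.hlist_def using ag.adj_eq[OF E2 x that(2,3)] by simp
  qed
  have B: "ag.hsim t (E - low) (E' - ?low')" by (rule ag.hsim_diff[OF L])
  have hdin: "hd_of f \<in> f" if "f \<in> E - low" for f by (rule oo.headB[OF that])
  have hk: "hkey f = ?hkey' f" if "x \<in> A t3" "f \<in> E - low" "x \<in> f" for x f
  proof -
    have fE: "f \<in> E" using that(2) by simp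
    have x1: "x \<in> A (t + 2 + orient.steps (name_bits c q))"
      by (rule ag.A_leD[OF that(1)]) (simp add: t3_def t2_def orient.steps_def)
    have x2: "x \<in> A t" by (rule ag.A_leD[OF that(1)]) (simp add: t3_def t2_def)
    show ?thesis unfolding hkey_def algo.hkey_def orient.okey_def
      by (simp only: ag.slot_sim[OF B Hd hdin x1 that(2,3)] ag.esimD[OF ag.tail_sim[OF Hd] x2 fE that(3)])
  qed
  have t3r: "t3 + 1536 * a \<le> rad c q a" unfolding t3_def t2_def t_def rad_def by simp
  have v3: "v \<in> A t" by (rule ag.A_leD[OF v]) (use t3r in \<open>simp add: t3_def t2_def\<close>)
  have m: "e \<in> low \<longleftrightarrow> e \<in> ?low'" by (rule ag.hsim_mem[OF L v3 e(2)])
  show ?thesis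
  proof (cases "e \<in> low")
    case True
    have "v \<in> A t2" by (rule ag.A_leD[OF v]) (use t3r in \<open>simp add: t3_def\<close>)
    then have "lcol e = ?lcol' e" by (rule ag.esimD[OF C _ e])
    then show ?thesis using True m by (simp add: col_def algo.col_def)
  next
    case False
    then have eB: "e \<in> E - low" using e by simp
    let ?slot = "orient.slot (E - low) hd_of (id_bits c q) (name_bits c q)"
    have s: "?slot e < 256 * (2 * a)" by (rule oo.slot_less[OF eB])
    have B3: "ag.hsim t3 (E - low) (E' - ?low')" by (rule ag.hsim_le[OF B]) (simp add: t3_def t2_def)
    have vA: "v \<in> A (t3 + 3 * ?slot e + 3)" by (rule ag.A_leD[OF v]) (use t3r s in linarith)
    have "gcol (E - low) hlist hkey e = gcol (E' - ?low') ?hlist' ?hkey' e"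
    proof (rule ag.gcol_star_sim[where head = hd_of and slot = ?slot, OF B3 _ _ hdin _ _ eB e(2) vA])
      show "hlist f = ?hlist' f" if "x \<in> A t3" "f \<in> E - low" "x \<in> f" for x f using hl that by blast
      show "hkey f = ?hkey' f" if "x \<in> A t3" "f \<in> E - low" "x \<in> f" for x f by (rule hk[OF that])
      show "?slot f \<le> ?slot g" if "g \<in> E - low" "f \<in> E - low" "hkey f < hkey g" for f g
        by (rule oo.okey_mono[OF that(1,2)]) (use that(3) in \<open>simp add: hkey_def\<close>)
      show "hd_of f = hd_of g" if "g \<in> E - low" "f \<in> adj (E - low) g" "?slot f = ?slot g" for f g
        by (rule oo.star[OF that])
    qed
    then show ?thesis using False m by (simp add: col_def algo.col_def)
  qed
qed

end

section \<open>Round complexity\<close>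

definition pb :: "nat \<Rightarrow> (nat \<Rightarrow> nat) \<Rightarrow> bool" where
  "pb d f \<longleftrightarrow> (\<exists>C. \<forall>q\<ge>1. f q \<le> C * q ^ d)"

lemma pb_const: "pb 0 (\<lambda>q. k)" unfolding pb_def by (intro exI[of _ k]) simp
lemma pb_id: "pb 1 (\<lambda>q. q)" unfolding pb_def by (intro exI[of _ 1]) simp

lemma pb_le: assumes "pb d f" "d \<le> d'" shows "pb d' f"
proof -
  obtain C where C: "\<forall>q\<ge>1. f q \<le> C * q ^ d" using assms(1) unfolding pb_def by blast
  have "f q \<le> C * q ^ d'" if "1 \<le> q" for q
  proof -
    have "C * q ^ d \<le> C * q ^ d'" using power_increasing[OF assms(2) that] by simp
    then show ?thesis using C that le_trans by blast
  qed
  then show ?thesis unfolding pb_def by blast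
qed

lemma pb_add: assumes "pb d f" "pb d g" shows "pb d (\<lambda>q. f q + g q)"
proof -
  obtain C C' where C: "\<forall>q\<ge>1. f q \<le> C * q ^ d" "\<forall>q\<ge>1. g q \<le> C' * q ^ d" using assms unfolding pb_def by blast
  have "f q + g q \<le> (C + C') * q ^ d" if "1 \<le> q" for q
  proof -
    have "f q \<le> C * q ^ d" "g q \<le> C' * q ^ d" using C that by blast+
    then show ?thesis by (simp add: distrib_right)
  qed
  then show ?thesis unfolding pb_def by blast
qed

lemma pb_mult: assumes "pb d f" "pb d' g" shows "pb (d + d') (\<lambda>q. f q * g q)"
proof -
  obtain C C' where C: "\<forall>q\<ge>1. f q \<le> C * q ^ d" "\<forall>q\<ge>1. g q \<le> C' * q ^ d'" using assms unfolding pb_def by blast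
  have "f q * g q \<le> (C * C') * q ^ (d + d')" if "1 \<le> q" for q
  proof -
    have "f q * g q \<le> (C * q ^ d) * (C' * q ^ d')" using C that by (intro mult_le_mono) blast+
    then show ?thesis by (simp add: power_add algebra_simps)
  qed
  then show ?thesis unfolding pb_def by blast
qed

lemma pb_power: assumes "pb d f" shows "pb (d * n) (\<lambda>q. f q ^ n)"
proof (induction n)
  case 0 then show ?case using pb_const[of 1] by simp
next
  case (Suc n)
  from pb_mult[OF assms Suc] show ?case by simp
qed

lemma pb_cmult: "pb d f \<Longrightarrow> pb d (\<lambda>q. k * f q)"
  using pb_mult[OF pb_const[of k]] by simp

lemma pb_addc: "pb d f \<Longrightarrow> pb d (\<lambda>q. f q + k)"
  using pb_add[OF _ pb_le[OF pb_const[of k]]] by simp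

lemma pb_palette: assumes "pb d f" "pb d' g" shows "pb (2 * (d + d')) (\<lambda>q. palette (f q) (g q))"
proof -
  have 1: "pb (d + d') (\<lambda>q. f q * g q)" by (rule pb_mult[OF assms])
  have "pb ((d + d') + (d + d')) (\<lambda>q. f q * g q * (2 * (f q * g q) + 1))"
    by (rule pb_mult[OF 1 pb_addc[OF pb_cmult[OF 1]]])
  then show ?thesis unfolding palette_def mult_2[of "d + d'"] .
qed

text \<open>The powers accumulate: \<open>K ^ 4\<close> with quadratic \<open>K\<close> gives 8, the
  phases of the game 9, the levels of the colour space 10, the classes 11, and the degree halvings
  12. All palettes have smaller powers.\<close>

lemma pb_rad: "pb 12 (\<lambda>q. rad c q 0)"
proof -
  have p: "pb 1 (\<lambda>q. 2 * q + 5)" by (intro pb_addc pb_cmult pb_id)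
  have p2: "pb 2 (\<lambda>q. (2 * q + 5)\<^sup>2)" using pb_power[OF p, of 2] by simp
  have w: "pb 1 (\<lambda>q. chi_bits c q)" unfolding chi_bits_def by (intro pb_addc pb_cmult pb_id)
  have w2: "pb 1 (\<lambda>q. 2 * chi_bits c q)" by (rule pb_cmult[OF w])
  have nbits: "pb 12 (\<lambda>q. name_bits c q)" unfolding name_bits_def
    by (rule pb_le[of 1]) (intro pb_addc pb_cmult pb_id, simp)
  have pr: "pb 12 (\<lambda>q. 2 * peel_rounds q)" unfolding peel_rounds_def
    using pb_cmult[OF pb_addc[OF pb_power[OF pb_id, of 12]], of 2 1] by simp
  have K4: "pb 8 (\<lambda>q. 8 * (20 * (2 * q + 5)\<^sup>2) ^ 4)" using pb_cmult[OF pb_power[OF pb_cmult[OF p2, of 20], of 4], of 8] by simp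
  have rounds: "pb 9 (\<lambda>q. game.rounds (20 * (2 * q + 5)\<^sup>2) (2 * q + 5))"
    unfolding game.rounds_def using pb_mult[OF K4 pb_addc[OF p, of 1]] by simp
  have r2: "pb 9 (\<lambda>q. 3 * game.rounds (20 * (2 * q + 5)\<^sup>2) (2 * q + 5) + 2)" by (intro pb_addc pb_cmult rounds)
  have c1: "pb 10 (\<lambda>q. (2 * q + 5) * (3 * game.rounds (20 * (2 * q + 5)\<^sup>2) (2 * q + 5) + 2))"
    using pb_mult[OF p r2] by simp
  have pal: "pb 6 (\<lambda>q. palette (48 * (2 * q + 5)\<^sup>2) (2 * chi_bits c q))"
    using pb_palette[OF pb_cmult[OF p2, of 48] w2] by simp
  have c2: "pb 10 (\<lambda>q. (2 * q + 5 + 1) * palette (48 * (2 * q + 5)\<^sup>2) (2 * chi_bits c q))"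
    by (rule pb_le[OF pb_mult[OF pb_addc[OF p, of 1] pal]]) simp
  have cr: "pb 10 (\<lambda>q. crad (2 * q + 5) (2 * chi_bits c q))"
    unfolding crad_def by (rule pb_add[OF pb_addc[OF c1] c2])
  have l1: "pb 11 (\<lambda>q. chi_bits c q * 1024 * (crad (2 * q + 5) (2 * chi_bits c q) + 1))"
    using pb_mult[OF pb_mult[OF w pb_const[of 1024]] pb_addc[OF cr, of 1]] by simp
  have "pb 12 (\<lambda>q. 2 * q * (chi_bits c q * 1024 * (crad (2 * q + 5) (2 * chi_bits c q) + 1)))"
    using pb_mult[OF pb_cmult[OF pb_id, of 2] l1] by simp
  then have l2: "pb 12 (\<lambda>q. (2 * q + 5 - 5) * (chi_bits c q * 1024 * (crad (2 * q + 5) (2 * chi_bits c q) + 1)))"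
    by simp
  have "pb 12 (\<lambda>q. palette 32 (2 * chi_bits c q))"
    by (rule pb_le[OF pb_palette[OF pb_const[of 32] w2]]) simp
  then have lr: "pb 12 (\<lambda>q. lrad (chi_bits c q) (2 * q + 5))"
    unfolding lrad_def by (rule pb_add[OF pb_addc[OF l2]])
  have "pb 12 (\<lambda>q. 2 * peel_rounds q + lrad (chi_bits c q) (2 * q + 5) + name_bits c q + 8)"
    by (rule pb_addc[OF pb_add[OF pb_add[OF pr lr] nbits]])
  then show ?thesis unfolding rad_def by (simp add: algebra_simps)
qed

lemma rad_split: "rad c q a = rad c q 0 + 1536 * a" by (simp add: rad_def)

text \<open>Rounding up gives \<open>n \<le> 2 ^ (q ^ 13)\<close> and \<open>a \<le> 2 ^ q\<close>
  without error terms; the maximum ensures \<open>1 \<le> q\<close> also when the logarithm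
  vanishes.\<close>

definition qof :: "nat \<Rightarrow> nat" where
  "qof n = max 1 (nat \<lceil>log 2 (real n) powr (1 / 13)\<rceil>)"

lemma qof_ge: "log 2 (real n) powr (1 / 13) \<le> real (qof n)"
proof -
  have "log 2 (real n) powr (1 / 13) \<le> real (nat \<lceil>log 2 (real n) powr (1 / 13)\<rceil>)" by (rule real_nat_ceiling_ge)
  also have "\<dots> \<le> real (qof n)" by (simp add: qof_def)
  finally show ?thesis .
qed

lemma n_le_qof: "n \<le> 2 ^ (qof n ^ 13)"
proof (cases "n = 0")
  case False
  then have l: "0 \<le> log 2 (real n)" by simp
  have "log 2 (real n) \<le> real (qof n) ^ 13"
  proof (cases "log 2 (real n) = 0")
    case False
    then have "log 2 (real n) = (log 2 (real n) powr (1 / 13)) powr 13" using l by (simp add: powr_powr)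
    also have "\<dots> = (log 2 (real n) powr (1 / 13)) ^ 13" using False l by (simp add: powr_realpow flip: powr_numeral)
    also have "\<dots> \<le> real (qof n) ^ 13" by (rule power_mono[OF qof_ge]) simp
    finally show ?thesis .
  qed simp
  then have "real n \<le> 2 powr (real (qof n) ^ 13)" using False by (simp add: log_le_iff)
  also have "\<dots> = real (2 ^ (qof n ^ 13))" by (simp add: powr_realpow flip: of_nat_power)
  finally show ?thesis by (simp only: of_nat_le_iff)
qed simp

lemma a_le_qof: assumes "real a \<le> 2 powr (log 2 (real n) powr (1 / 13))" shows "a \<le> 2 ^ qof n"
proof -
  have "2 powr (log 2 (real n) powr (1 / 13)) \<le> 2 powr real (qof n)" using qof_ge[of n] by simp
  also have "\<dots> = real (2 ^ qof n)" by (simp add: powr_realpow)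
  finally have "real a \<le> real (2 ^ qof n)" using assms by linarith
  then show ?thesis by (simp only: of_nat_le_iff)
qed

text \<open>For \<open>n \<ge> 2\<close> the root is at least 1, so rounding up at most doubles it,
  and \<open>4096 = 2 ^ 12\<close>.\<close>

lemma qof_upper: assumes "2 \<le> n" shows "real (qof n) ^ 12 \<le> 4096 * log 2 (real n) powr (12 / 13)"
proof -
  define x where "x = log 2 (real n) powr (1 / 13)"
  have l: "1 \<le> log 2 (real n)" using assms by (simp add: le_log_iff)
  then have x1: "1 \<le> x" unfolding x_def by (simp add: ge_one_powr_ge_zero)
  have "real (nat \<lceil>x\<rceil>) \<le> x + 1" using x1 by linarith
  then have "real (nat \<lceil>x\<rceil>) \<le> 2 * x" "1 \<le> 2 * x" using x1 by linarith+
  then have "real (qof n) \<le> 2 * x" unfolding qof_def x_def[symmetric] by (simp only: of_nat_max of_nat_1 max.bounded_iff)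
  then have "real (qof n) ^ 12 \<le> (2 * x) ^ 12" by (rule power_mono) simp
  also have "\<dots> = 4096 * x ^ 12" by (simp add: power_mult_distrib)
  also have "x ^ 12 = x powr 12" using x1 by (simp add: powr_realpow flip: powr_numeral)
  also have "x powr 12 = log 2 (real n) powr (12 / 13)" unfolding x_def by (simp add: powr_powr)
  finally show ?thesis .
qed

lemma rad_bound:
  "\<exists>C\<ge>0. \<forall>n a. 2 \<le> n \<longrightarrow> real (rad c (qof n) a) \<le> C * (real a + log 2 (real n) powr (12 / 13))"
proof -
  obtain D where D: "\<forall>q\<ge>1. rad c q 0 \<le> D * q ^ 12" using pb_rad unfolding pb_def by blast
  define C where "C = 4096 * real D + 1536"
  have "real (rad c (qof n) a) \<le> C * (real a + log 2 (real n) powr (12 / 13))" if n: "2 \<le> n" for n a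
  proof -
    define y where "y = log 2 (real n) powr (12 / 13)"
    have y0: "0 \<le> y" by (simp add: y_def)
    have "rad c (qof n) a \<le> D * qof n ^ 12 + 1536 * a"
      using D rad_split[of c "qof n" a] by (simp add: qof_def)
    then have "real (rad c (qof n) a) \<le> real (D * qof n ^ 12 + 1536 * a)" by (rule of_nat_mono)
    also have "\<dots> = real D * real (qof n) ^ 12 + 1536 * real a" by simp
    also have "\<dots> \<le> real D * (4096 * y) + 1536 * real a"
      using mult_left_mono[OF qof_upper[OF n], of "real D"] by (simp add: y_def)
    also have "\<dots> \<le> C * (real a + y)"
      unfolding C_def using y0 mult_nonneg_nonneg[of "real D" "real a"] by (simp add: algebra_simps)
    finally show ?thesis by (simp add: y_def)
  qed
  then show ?thesis by (intro exI[of _ C]) (simp add: C_def)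
qed

section \<open>Simulation in the LOCAL model\<close>

definition enc :: "nat set set \<Rightarrow> nat" where "enc G = set_encode (set_encode ` G)"
definition dec :: "nat \<Rightarrow> nat set set" where "dec m = set_decode ` set_decode m"

lemma dec_enc: assumes "finite G" "\<And>e. e \<in> G \<Longrightarrow> finite e" shows "dec (enc G) = G"
proof -
  have "dec (enc G) = set_decode ` set_encode ` G" using assms(1) by (simp add: dec_def enc_def)
  also have "\<dots> = (\<lambda>e. e) ` G" unfolding image_image by (rule image_cong) (use assms(2) in auto)
  finally show ?thesis by simp
qed

definition mkst :: "nat \<Rightarrow> nat \<Rightarrow> nat set set \<Rightarrow> nat" where
  "mkst x i G = prod_encode (x, prod_encode (i, enc G))"

definition st_par :: "nat \<Rightarrow> nat" where "st_par s = fst (prod_decode s)"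
definition st_id :: "nat \<Rightarrow> nat" where "st_id s = fst (prod_decode (snd (prod_decode s)))"
definition st_graph :: "nat \<Rightarrow> nat set set" where "st_graph s = dec (snd (prod_decode (snd (prod_decode s))))"

lemma mkst_sel: "st_par (mkst x i G) = x" "st_id (mkst x i G) = i" "st_graph (mkst x i G) = dec (enc G)"
  by (simp_all add: mkst_def st_par_def st_id_def st_graph_def)

text \<open>Messages are whole states. The index under which a message arrives reveals the
  neighbour's identifier, and thereby the incident edge.\<close>

definition gather :: "nat \<Rightarrow> (nat \<Rightarrow> nat option) \<Rightarrow> nat" where
  "gather s m = mkst (st_par s) (st_id s)
     (st_graph s \<union> {{st_id s, i} |i. m i \<noteq> None} \<union> \<Union>{st_graph z |z i. m i = Some z})"

primrec known :: "nat set set \<Rightarrow> (nat \<Rightarrow> nat) \<Rightarrow> nat \<Rightarrow> nat \<Rightarrow> nat set set" where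
  "known E ID 0 = (\<lambda>v. {})"
| "known E ID (Suc t) = (\<lambda>v. known E ID t v \<union> (`) ID ` inc E v \<union> \<Union>{known E ID t u |u. {u, v} \<in> E})"

locale net =
  fixes V :: "nat set" and E :: "nat set set" and ID :: "nat \<Rightarrow> nat"
  assumes sg: "simple_graph V E" and inj: "inj_on ID V"
begin

text \<open>The graph as the nodes perceive it, with identifiers in place of vertices; the colouring
  is evaluated here.\<close>

definition G :: "nat set set" where "G = (`) ID ` E"

lemma finE: "finite E" by (rule simple_graph_finite[OF sg])
lemma c2: "e \<in> E \<Longrightarrow> card e = 2" and EV: "e \<in> E \<Longrightarrow> e \<subseteq> V" using simple_graphD[OF sg] by blast+
lemma finG: "finite G" using finE by (simp add: G_def)
lemma edgeV: "{u, v} \<in> E \<Longrightarrow> u \<in> V \<and> v \<in> V" using EV by blast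

lemma inj_image: "inj_on ((`) ID) (Pow V)" by (rule inj_on_image_Pow[OF inj])

lemma card_G: assumes "e \<in> E" shows "card (ID ` e) = 2"
  using card_image[OF inj_on_subset[OF inj EV[OF assms]]] c2[OF assms] by simp

lemma pairsG: "pairs G" unfolding pairs_def using finG card_G by (auto simp: G_def)

lemma finG_mem: "g \<in> G \<Longrightarrow> finite g"
proof -
  assume "g \<in> G"
  then have "card g = 2" using pairsG by (simp add: pairs_def)
  then show ?thesis using card.infinite[of g] by fastforce
qed

lemma known_sub: "known E ID t v \<subseteq> G"
proof (induction t arbitrary: v)
  case (Suc t)
  have "(`) ID ` inc E v \<subseteq> G" unfolding G_def inc_def by blast
  then show ?case using Suc.IH by auto
qed simp

lemma known_mono: "known E ID t v \<subseteq> known E ID (Suc t) v" by auto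

lemma known_dec: "dec (enc (known E ID t v)) = known E ID t v"
  using dec_enc[OF finite_subset[OF known_sub finG]] finG_mem known_sub by blast

lemma some_nb:
  assumes "{u, v} \<in> E" shows "(SOME w. {w, v} \<in> E \<and> ID w = ID u) = u"
proof (rule some_equality)
  show "{u, v} \<in> E \<and> ID u = ID u" using assms by simp
  show "w = u" if "{w, v} \<in> E \<and> ID w = ID u" for w
    using inj_onD[OF inj, of w u] that edgeV assms by blast
qed

lemma run_known:
  assumes "\<And>i. init i = mkst x i {}" and v: "v \<in> V"
  shows "local_run init (\<lambda>s. s) gather E ID t v = mkst x (ID v) (known E ID t v)"
  using v
proof (induction t arbitrary: v)
  case 0 then show ?case using assms(1) by simp
next
  case (Suc t)
  let ?run = "local_run init (\<lambda>s. s) gather E ID t"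
  let ?m = "\<lambda>i. if \<exists>u. {u, v} \<in> E \<and> ID u = i then Some (?run (SOME u. {u, v} \<in> E \<and> ID u = i)) else None"
  have "{{ID v, i} |i. ?m i \<noteq> None} = (`) ID ` inc E v"
  proof (intro equalityI subsetI)
    fix g assume "g \<in> {{ID v, i} |i. ?m i \<noteq> None}"
    then obtain u where u: "{u, v} \<in> E" "g = {ID v, ID u}" by (auto split: if_splits)
    then have "g = ID ` {u, v}" "{u, v} \<in> inc E v" by (auto simp: inc_def)
    then show "g \<in> (`) ID ` inc E v" by blast
  next
    fix g assume "g \<in> (`) ID ` inc E v"
    then obtain e where e: "e \<in> E" "v \<in> e" "g = ID ` e" by (auto simp: inc_def)
    have o: "e = {v, other e v}" by (rule other_pair(1)[OF c2[OF e(1)] e(2)])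
    then have "{other e v, v} \<in> E" using e(1) by (metis insert_commute)
    then have "?m (ID (other e v)) \<noteq> None" by auto
    moreover have "g = {ID v, ID (other e v)}" unfolding e(3) by (subst o) simp
    ultimately show "g \<in> {{ID v, i} |i. ?m i \<noteq> None}" by blast
  qed
  moreover have "{st_graph z |z i. ?m i = Some z} = {known E ID t u |u. {u, v} \<in> E}"
  proof -
    have graph: "st_graph (?run u) = known E ID t u" if "{u, v} \<in> E" for u
      using Suc.IH edgeV[OF that] by (simp add: mkst_sel known_dec)
    show ?thesis
    proof (intro equalityI subsetI)
      fix g assume "g \<in> {st_graph z |z i. ?m i = Some z}"
      then obtain z i where z: "g = st_graph z" "?m i = Some z" by blast
      from z(2) have ex: "\<exists>u. {u, v} \<in> E \<and> ID u = i" by (metis option.distinct(1))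
      then obtain u where u: "{u, v} \<in> E" "ID u = i" by blast
      have "z = ?run u" using z(2) ex some_nb[OF u(1)] u(2) by simp
      then show "g \<in> {known E ID t u |u. {u, v} \<in> E}" using z(1) graph[OF u(1)] u(1) by blast
    next
      fix g assume "g \<in> {known E ID t u |u. {u, v} \<in> E}"
      then obtain u where u: "{u, v} \<in> E" "g = known E ID t u" by blast
      have "?m (ID u) = Some (?run u)" using u(1) some_nb[OF u(1)] by auto
      then show "g \<in> {st_graph z |z i. ?m i = Some z}" using graph[OF u(1)] u(2) by blast
    qed
  qed
  moreover have "local_run init (\<lambda>s. s) gather E ID (Suc t) v = gather (?run v) ?m" by simp
  moreover have "st_par (?run v) = x" "st_id (?run v) = ID v" "st_graph (?run v) = known E ID t v"
    using Suc.IH[OF Suc.prems] by (simp_all add: mkst_sel known_dec)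
  ultimately show ?case by (simp only: gather_def[of "?run v" ?m] known.simps)
qed

text \<open>A node counts as close at stage \<open>s\<close> if whatever it would know after
  \<open>s\<close> rounds is known to \<open>v0\<close> after \<open>T\<close> rounds. This replaces
  any notion of distance, and \<open>v0\<close> itself qualifies at stage \<open>T\<close>.\<close>

lemma agree:
  "agreement G (known E ID T v0) (\<lambda>s. {ID v |v. v \<in> V \<and> known E ID s v \<subseteq> known E ID T v0})"
proof
  let ?K = "known E ID T v0"
  show "finite G" "finite ?K" using finG finite_subset[OF known_sub] by auto
  show "card e = 2" if "e \<in> G" for e using that pairsG by (simp add: pairs_def)
  show "{ID v |v. v \<in> V \<and> known E ID (Suc t) v \<subseteq> ?K} \<subseteq> {ID v |v. v \<in> V \<and> known E ID t v \<subseteq> ?K}" for t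
    using known_mono by blast
  fix t x assume "x \<in> {ID v |v. v \<in> V \<and> known E ID (Suc t) v \<subseteq> ?K}"
  then obtain v where v: "x = ID v" "v \<in> V" "known E ID (Suc t) v \<subseteq> ?K" by blast
  have at: "\<exists>e\<in>inc E v. g = ID ` e" if g: "g \<in> inc G x" for g
  proof -
    have "g \<in> (`) ID ` E" "ID v \<in> g" using g v(1) by (simp_all add: inc_def G_def)
    then obtain e where e: "e \<in> E" "g = ID ` e" "ID v \<in> ID ` e" by auto
    have "v \<in> e" using e(3) inj_on_image_mem_iff[OF inj v(2) EV[OF e(1)]] by blast
    then show ?thesis using e by (auto simp: inc_def)
  qed
  show "inc G x = inc ?K x"
  proof
    show "inc G x \<subseteq> inc ?K x"
    proof
      fix g assume g: "g \<in> inc G x"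
      then obtain e where "e \<in> inc E v" "g = ID ` e" using at by blast
      then have "g \<in> known E ID (Suc t) v" by simp
      then have "g \<in> ?K" by (rule subsetD[OF v(3)])
      then show "g \<in> inc ?K x" using g by (simp add: inc_def)
    qed
    show "inc ?K x \<subseteq> inc G x" by (rule inc_mono[OF known_sub])
  qed
  fix g y assume g: "g \<in> inc G x" "y \<in> g"
  obtain e where e: "e \<in> E" "v \<in> e" "g = ID ` e" using at[OF g(1)] by (auto simp: inc_def)
  obtain u where u: "u \<in> e" "y = ID u" using g(2) e(3) by blast
  have "known E ID t u \<subseteq> known E ID (Suc t) v"
  proof (cases "u = v")
    case True then show ?thesis using known_mono by blast
  next
    case False
    then have "u = other e v" using other_unique[OF c2[OF e(1)] e(2) u(1)] by blast
    then have "{u, v} = e" using other_pair(1)[OF c2[OF e(1)] e(2)] by (metis insert_commute)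
    then have "{u, v} \<in> E" using e(1) by simp
    then show ?thesis by auto
  qed
  then show "y \<in> {ID v |v. v \<in> V \<and> known E ID t v \<subseteq> ?K}" using u v(3) EV[OF e(1)] by blast
qed

lemma adj_image_card: assumes e: "e \<in> E" shows "adj G (ID ` e) = (`) ID ` adj E e" "card (adj G (ID ` e)) = card (adj E e)"
proof -
  have ne: "ID ` f \<noteq> ID ` e \<longleftrightarrow> f \<noteq> e" if "f \<in> E" for f
    using inj_on_eq_iff[OF inj_image, of f e] EV that e by auto
  have it: "ID ` f \<inter> ID ` e \<noteq> {} \<longleftrightarrow> f \<inter> e \<noteq> {}" if "f \<in> E" for f
    using inj_on_image_Int[OF inj EV[OF that] EV[OF e]] by (metis image_is_empty)
  show eq: "adj G (ID ` e) = (`) ID ` adj E e" 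
  proof (intro equalityI subsetI)
    fix g assume "g \<in> adj G (ID ` e)"
    then obtain f where f: "f \<in> E" "g = ID ` f" "ID ` f \<noteq> ID ` e" "ID ` f \<inter> ID ` e \<noteq> {}" unfolding adj_def G_def by blast
    then have "f \<in> adj E e" using ne[OF f(1)] it[OF f(1)] by (simp add: adj_def)
    then show "g \<in> (`) ID ` adj E e" using f(2) by blast
  next
    fix g assume "g \<in> (`) ID ` adj E e"
    then obtain f where f: "f \<in> E" "g = ID ` f" "f \<noteq> e" "f \<inter> e \<noteq> {}" unfolding adj_def by blast
    then show "g \<in> adj G (ID ` e)" using ne[OF f(1)] it[OF f(1)] by (simp add: adj_def G_def)
  qed
  have "inj_on ((`) ID) (adj E e)" by (rule inj_on_subset[OF inj_image]) (use EV in \<open>auto simp: adj_def\<close>)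
  then show "card (adj G (ID ` e)) = card (adj E e)" unfolding eq by (rule card_image)
qed

lemma dens:
  assumes d: "\<And>X. finite X \<Longrightarrow> card {e \<in> E. e \<subseteq> X} \<le> a * card X" and X: "finite X"
  shows "card {g \<in> G. g \<subseteq> X} \<le> a * card X"
proof -
  define Y where "Y = {v \<in> V. ID v \<in> X}"
  have fY: "finite Y" using sg by (simp add: simple_graph_def Y_def)
  have "card Y \<le> card X"
    by (rule card_inj_on_le[of ID]) (use inj_on_subset[OF inj] X in \<open>auto simp: Y_def\<close>)
  have "{g \<in> G. g \<subseteq> X} \<subseteq> (`) ID ` {e \<in> E. e \<subseteq> Y}" using EV unfolding G_def Y_def by blast
  then have "card {g \<in> G. g \<subseteq> X} \<le> card ((`) ID ` {e \<in> E. e \<subseteq> Y})" using finE by (intro card_mono) auto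
  also have "\<dots> \<le> card {e \<in> E. e \<subseteq> Y}" using finE by (intro card_image_le) simp
  also have "\<dots> \<le> a * card Y" by (rule d[OF fY])
  also have "\<dots> \<le> a * card X" using \<open>card Y \<le> card X\<close> by simp
  finally show ?thesis .
qed

end

definition start :: "nat \<Rightarrow> nat \<Rightarrow> nat \<Rightarrow> nat" where
  "start n a i = mkst (prod_encode (n, a)) i {}"

definition answer :: "nat \<Rightarrow> nat \<Rightarrow> nat \<Rightarrow> nat" where
  "answer c s j = (let (n, a) = prod_decode (st_par s) in algo.col c (qof n) a (st_graph s) {st_id s, j})"

text \<open>The two ends of an edge evaluate the colouring on different known parts of the graph. By
  \<open>col_local\<close> each obtains the value on the whole graph, so their outputs
  agree.\<close>

lemma solves:
  assumes sg: "simple_graph V E" and ar: "arboricity V E \<le> a"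
    and a: "real a \<le> 2 powr (log 2 (real (card V)) powr (1 / 13))" and ids: "valid_ids c V ID"
  shows "solves_edge_coloring (start (card V) a) (\<lambda>s. s) gather (answer c) (rad c (qof (card V)) a) E ID"
proof -
  define q where "q = qof (card V)"
  interpret ne: net V E ID by unfold_locales (use sg ids in \<open>auto simp: valid_ids_def\<close>)
  have finV: "finite V" using sg by (simp add: simple_graph_def)
  have inj: "inj_on ID V" by (rule ne.inj)
  interpret al: algo_ok c q a ne.G "ID ` V"
  proof
    show "pairs ne.G" by (rule ne.pairsG)
    show "finite (ID ` V)" using finV by simp
    show "e \<subseteq> ID ` V" if "e \<in> ne.G" for e using that ne.EV by (auto simp: ne.G_def)
    show "card {e \<in> ne.G. e \<subseteq> X} \<le> a * card X" if "finite X" for X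
      by (rule ne.dens[OF arboricity_density[OF sg ar] that])
    show "1 \<le> q" by (simp add: q_def qof_def)
    show "a \<le> 2 ^ q" unfolding q_def by (rule a_le_qof[OF a])
    show "card (ID ` V) \<le> 2 ^ (q ^ 13)" unfolding q_def card_image[OF inj] by (rule n_le_qof)
    show "v < 2 ^ id_bits c q" if "v \<in> ID ` V" for v
    proof -
      have "v \<le> card V ^ c" using that ids by (auto simp: valid_ids_def)
      also have "\<dots> \<le> (2 ^ (q ^ 13)) ^ c" unfolding q_def by (rule power_mono[OF n_le_qof]) simp
      also have "\<dots> = 2 ^ (c * q ^ 13)" by (simp add: mult.commute flip: power_mult)
      also have "\<dots> < 2 ^ id_bits c q" by (simp add: id_bits_def)
      finally show ?thesis .
    qed
  qed
  define col where "col e = al.col (ID ` e)" for e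
  have GE: "ID ` e \<in> ne.G" if "e \<in> E" for e using that by (simp add: ne.G_def)
  have "edge_deg_plus1_coloring E col" unfolding edge_deg_plus1_coloring_def
  proof (intro conjI ballI impI)
    fix e assume e: "e \<in> E"
    have deg: "edge_degree E e = card (adj ne.G (ID ` e))"
      using ne.adj_image_card(2)[OF e] by (simp add: edge_degree_def adj_def)
    show "1 \<le> col e" "col e \<le> edge_degree E e + 1"
      unfolding col_def deg using al.col_range[OF GE[OF e]] by auto
    fix f assume f: "f \<in> E" "e \<noteq> f \<and> e \<inter> f \<noteq> {}"
    then have "ID ` f \<in> adj ne.G (ID ` e)" unfolding ne.adj_image_card(1)[OF e] by (auto simp: adj_def)
    then show "col e \<noteq> col f" unfolding col_def using al.col_neq[OF GE[OF e]] by metis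
  qed
  moreover have "answer c (local_run (start (card V) a) (\<lambda>s. s) gather E ID (rad c q a) u) (ID v) = col {u, v}"
    if uv: "{u, v} \<in> E" for u v
  proof -
    let ?K = "known E ID (rad c q a) u"
    have u: "u \<in> V" using ne.edgeV[OF uv] by blast
    have run: "local_run (start (card V) a) (\<lambda>s. s) gather E ID (rad c q a) u = mkst (prod_encode (card V, a)) (ID u) ?K"
      by (rule ne.run_known[OF _ u]) (simp add: start_def)
    have "al.col (ID ` {u, v}) = algo.col c q a ?K (ID ` {u, v})"
      by (rule al.col_local[OF ne.agree[of "rad c q a" u] _ GE[OF uv], of "ID u"]) (use u in auto)
    then show ?thesis unfolding run answer_def col_def by (simp add: mkst_sel ne.known_dec q_def)
  qed
  ultimately show ?thesis unfolding solves_edge_coloring_def q_def by blast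
qed

lemma tree_arboricity: assumes "tree V E" shows "simple_graph V E" "arboricity V E \<le> 1"
proof -
  have f: "forest V E" using assms by (simp add: tree_def)
  then show "simple_graph V E" by (simp add: forest_def)
  have "(\<forall>e\<in>E. (0::nat) < 1) \<and> (\<forall>i<1. forest V {e \<in> E. (0::nat) = i})"
  proof (intro conjI allI impI ballI)
    fix i :: nat assume "i < 1"
    then have "{e \<in> E. 0 = i} = E" by simp
    then show "forest V {e \<in> E. 0 = i}" using f by simp
  qed simp
  then have "\<exists>P :: nat set \<Rightarrow> nat. (\<forall>e\<in>E. P e < 1) \<and> (\<forall>i<1. forest V {e \<in> E. P e = i})"
    by (intro exI[of _ "\<lambda>e. 0"])
  then show "arboricity V E \<le> 1" unfolding arboricity_def by (rule Least_le)
qed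

theorem theorem1p3:
  fixes c :: nat
  shows
  "(\<exists>(init :: nat \<Rightarrow> nat \<Rightarrow> nat) (send :: nat \<Rightarrow> nat) step out (R :: nat \<Rightarrow> nat) (C :: real).
      (\<forall>n::nat. n \<ge> 2 \<longrightarrow> real (R n) \<le> C * log 2 (real n) powr (12/13)) \<and>
      (\<forall>V E ID. tree V E \<longrightarrow> valid_ids c V ID \<longrightarrow>
          solves_edge_coloring (init (card V)) send step out (R (card V)) E ID))
   \<and>
   (\<exists>(init :: nat \<Rightarrow> nat \<Rightarrow> nat \<Rightarrow> nat) (send :: nat \<Rightarrow> nat) step out (R :: nat \<Rightarrow> nat \<Rightarrow> nat) (C :: real).
      (\<forall>n a::nat. n \<ge> 2 \<longrightarrow> real a \<le> 2 powr (log 2 (real n) powr (1/13)) \<longrightarrow>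
          real (R n a) \<le> C * (real a + log 2 (real n) powr (12/13))) \<and>
      (\<forall>V E ID a. simple_graph V E \<longrightarrow> arboricity V E \<le> a \<longrightarrow>
          real a \<le> 2 powr (log 2 (real (card V)) powr (1/13)) \<longrightarrow> valid_ids c V ID \<longrightarrow>
          solves_edge_coloring (init (card V) a) send step out (R (card V) a) E ID))"
proof
  obtain C where C: "0 \<le> C" "\<And>n a. 2 \<le> n \<Longrightarrow> real (rad c (qof n) a) \<le> C * (real a + log 2 (real n) powr (12/13))"
    using rad_bound by blast
  have "real (rad c (qof n) 1) \<le> 2 * C * log 2 (real n) powr (12/13)" if n: "2 \<le> n" for n
  proof -
    \<comment> \<open>A tree is the case \<open>a = 1\<close>; from \<open>n = 2\<close> on, this
      summand is absorbed by the power of the logarithm at the price of a factor 2.\<close>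
    have "1 \<le> log 2 (real n)" using n by (simp add: le_log_iff)
    then have "1 \<le> log 2 (real n) powr (12/13)" by (simp add: ge_one_powr_ge_zero)
    then have "C * (real 1 + log 2 (real n) powr (12/13)) \<le> C * (2 * log 2 (real n) powr (12/13))"
      using C(1) by (intro mult_left_mono) auto
    then show ?thesis using C(2)[OF n, of 1] by (simp add: mult.assoc mult.left_commute)
  qed
  moreover have "solves_edge_coloring (start (card V) 1) (\<lambda>s. s) gather (answer c) (rad c (qof (card V)) 1) E ID"
    if "tree V E" "valid_ids c V ID" for V E ID
    by (rule solves[OF tree_arboricity[OF that(1)] _ that(2)]) (simp add: ge_one_powr_ge_zero)
  ultimately show "\<exists>(init :: nat \<Rightarrow> nat \<Rightarrow> nat) (send :: nat \<Rightarrow> nat) step out (R :: nat \<Rightarrow> nat) (C :: real).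
      (\<forall>n::nat. n \<ge> 2 \<longrightarrow> real (R n) \<le> C * log 2 (real n) powr (12/13)) \<and>
      (\<forall>V E ID. tree V E \<longrightarrow> valid_ids c V ID \<longrightarrow>
          solves_edge_coloring (init (card V)) send step out (R (card V)) E ID)"
    by (intro exI[of _ "\<lambda>n. start n 1"] exI[of _ "\<lambda>s. s"] exI[of _ gather] exI[of _ "answer c"]
        exI[of _ "\<lambda>n. rad c (qof n) 1"] exI[of _ "2 * C"]) blast
  show "\<exists>(init :: nat \<Rightarrow> nat \<Rightarrow> nat \<Rightarrow> nat) (send :: nat \<Rightarrow> nat) step out (R :: nat \<Rightarrow> nat \<Rightarrow> nat) (C :: real).
      (\<forall>n a::nat. n \<ge> 2 \<longrightarrow> real a \<le> 2 powr (log 2 (real n) powr (1/13)) \<longrightarrow>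
          real (R n a) \<le> C * (real a + log 2 (real n) powr (12/13))) \<and>
      (\<forall>V E ID a. simple_graph V E \<longrightarrow> arboricity V E \<le> a \<longrightarrow>
          real a \<le> 2 powr (log 2 (real (card V)) powr (1/13)) \<longrightarrow> valid_ids c V ID \<longrightarrow>
          solves_edge_coloring (init (card V) a) send step out (R (card V) a) E ID)"
    by (intro exI[of _ start] exI[of _ "\<lambda>s. s"] exI[of _ gather] exI[of _ "answer c"]
        exI[of _ "\<lambda>n a. rad c (qof n) a"] exI[of _ C]) (use C(2) solves in blast)
qed

end
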